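(* Let $M$ be a regular $(H,K_{\mathrm{II}})$-Weingarten canal surface in $\mathbb{R}^3$. Then $M$ is one of the following: (i) a surface of revolution; (ii) a canal surface with radius $r(s)=c_1s+c_2$, $c_1\neq\pm1$, and with center curve whose curvature is $\kappa=\dfrac{c_3}{r^{1/3}}$, where $c_1,c_2,c_3$ are real constants; (iii) a tubular surface whose center curve has nonzero constant curvature.
   Context: A canal surface in $\mathbb{R}^3$ is the envelope of a 1-parameter family of spheres; the curve $\alpha$ formed by the centers of the spheres is its center curve and $r(s)$, the radius of the sphere centered at $\alpha(s)$, is its radius. For a unit speed center curve $\alpha:I\to\mathbb{R}^3$ with Frenet frame $T,N,B$, curvature $\kappa$ and torsion $\tau$ (if $\alpha$ is a straight line, $\kappa=0$ and $T,N,B$ is a constant orthonormal frame), the canal surface is parametrized by $$C(s,t)=\alpha(s)-R(s)T-Q(s)\cos(t)N+Q(s)\sin(t)B,\qquad R=rr',\quad Q=\pm r\sqrt{1-r'^2}.$$ Regular means that the first fundamental form is nondegenerate. Within this class, a tubular surface (tube) is a canal surface with constant radius $r$; a surface of revolution is a canal surface whose center curve is a straight line ($\kappa=0$). With $E=\langle C_s,C_s\rangle$, $F=\langle C_s,C_t\rangle$, $G=\langle C_t,C_t\rangle$, $n$ a unit normal, $e=\langle C_{ss},n\rangle$, $f=\langle C_{st},n\rangle$, $g=\langle C_{tt},n\rangle$, the mean curvature is $H=\frac{Eg-2Ff+Ge}{2(EG-F^2)}$. When the second fundamental form $\mathrm{II}$ is nondegenerate, the second Gaussian curvature $K_{\mathrm{II}}$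 (the Gaussian curvature of $\mathrm{II}$ regarded as a (pseudo-)Riemannian metric) is $$K_{\mathrm{II}}=\frac{1}{(|eg|-f^2)^2}\left\{\begin{vmatrix}-\frac12e_{tt}+f_{st}-\frac12g_{ss}&\frac12e_s&f_s-\frac12e_t\\ f_t-\frac12g_s&e&f\\ \frac12g_t&f&g\end{vmatrix}-\begin{vmatrix}0&\frac12e_t&\frac12g_s\\ \frac12e_t&e&f\\ \frac12g_s&f&g\end{vmatrix}\right\}.$$ Whenever $K_{\mathrm{II}}$ is mentioned, $\mathrm{II}$ is assumed nondegenerate. The surface is called $(X,Y)$-Weingarten if the Jacobi function $\Phi(X,Y)=X_sY_t-X_tY_s$ vanishes identically. *)

theory Defs
  imports "HOL-Analysis.Analysis"
begin

definition smooth_on :: "real set \<Rightarrow> (real \<Rightarrow> 'a::real_normed_vector) \<Rightarrow> bool" where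
  "smooth_on I f \<longleftrightarrow>
     (\<exists>D. (\<forall>x\<in>I. D 0 x = f x) \<and>
          (\<forall>n::nat. \<forall>x\<in>I. (D n has_vector_derivative D (Suc n) x) (at x)))"

definition tangent :: "(real \<Rightarrow> real^3) \<Rightarrow> real \<Rightarrow> real^3" where
  "tangent \<alpha> s = vector_derivative \<alpha> (at s)"

text \<open>The tangent and the curvature are only meaningful for unit speed curves.\<close>

definition curvature :: "(real \<Rightarrow> real^3) \<Rightarrow> real \<Rightarrow> real" where
  "curvature \<alpha> s = norm (vector_derivative (tangent \<alpha>) (at s))"

text \<open>Either the curvature vanishes nowhere and \<open>T, N, B\<close> is the usual Frenet frame, or the curve is
  a straight line and \<open>T, N, B\<close> is a constant orthonormal frame.\<close>

definition frenet_frame ::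
  "real set \<Rightarrow> (real \<Rightarrow> real^3) \<Rightarrow> (real \<Rightarrow> real^3) \<Rightarrow> (real \<Rightarrow> real^3) \<Rightarrow> bool" where
  "frenet_frame I \<alpha> N B \<longleftrightarrow>
     (\<forall>s\<in>I. curvature \<alpha> s \<noteq> 0 \<and>
            N s = vector_derivative (tangent \<alpha>) (at s) /\<^sub>R curvature \<alpha> s \<and>
            B s = cross3 (tangent \<alpha> s) (N s)) \<or>
     (\<exists>T0 N0 B0. norm T0 = 1 \<and> norm N0 = 1 \<and> norm B0 = 1 \<and>
            T0 \<bullet> N0 = 0 \<and> T0 \<bullet> B0 = 0 \<and> N0 \<bullet> B0 = 0 \<and>
            (\<forall>s\<in>I. curvature \<alpha> s = 0 \<and> tangent \<alpha> s = T0 \<and> N s = N0 \<and> B s = B0))"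

text \<open>The number \<open>\<sigma>\<close> is the sign \<open>\<plusminus>1\<close> in \<open>Q = \<plusminus> r sqrt (1 - r'\<^sup>2)\<close>.\<close>

definition canal_surface ::
  "(real \<Rightarrow> real^3) \<Rightarrow> (real \<Rightarrow> real^3) \<Rightarrow> (real \<Rightarrow> real^3) \<Rightarrow> (real \<Rightarrow> real) \<Rightarrow> real
     \<Rightarrow> real \<Rightarrow> real \<Rightarrow> real^3" where
  "canal_surface \<alpha> N B r \<sigma> s t =
     (let R = r s * deriv r s;
          Q = \<sigma> * r s * sqrt (1 - (deriv r s)\<^sup>2)
      in \<alpha> s - R *\<^sub>R tangent \<alpha> s - (Q * cos t) *\<^sub>R N s + (Q * sin t) *\<^sub>R B s)"

definition pd_s :: "(real \<Rightarrow> real \<Rightarrow> 'a::real_normed_vector) \<Rightarrow> real \<Rightarrow> real \<Rightarrow> 'a" where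
  "pd_s F s t = vector_derivative (\<lambda>x. F x t) (at s)"

definition pd_t :: "(real \<Rightarrow> real \<Rightarrow> 'a::real_normed_vector) \<Rightarrow> real \<Rightarrow> real \<Rightarrow> 'a" where
  "pd_t F s t = vector_derivative (\<lambda>x. F s x) (at t)"

definition ffE :: "(real \<Rightarrow> real \<Rightarrow> real^3) \<Rightarrow> real \<Rightarrow> real \<Rightarrow> real" where
  "ffE C s t = pd_s C s t \<bullet> pd_s C s t"

definition ffF :: "(real \<Rightarrow> real \<Rightarrow> real^3) \<Rightarrow> real \<Rightarrow> real \<Rightarrow> real" where
  "ffF C s t = pd_s C s t \<bullet> pd_t C s t"

definition ffG :: "(real \<Rightarrow> real \<Rightarrow> real^3) \<Rightarrow> real \<Rightarrow> real \<Rightarrow> real" where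
  "ffG C s t = pd_t C s t \<bullet> pd_t C s t"

text \<open>Replacing the unit normal by its opposite changes the sign of both \<open>H\<close> and \<open>K\<^sub>I\<^sub>I\<close>, hence
  does not change their Jacobi function.\<close>

definition unit_normal :: "(real \<Rightarrow> real \<Rightarrow> real^3) \<Rightarrow> real \<Rightarrow> real \<Rightarrow> real^3" where
  "unit_normal C s t =
     cross3 (pd_s C s t) (pd_t C s t) /\<^sub>R norm (cross3 (pd_s C s t) (pd_t C s t))"

definition sfe :: "(real \<Rightarrow> real \<Rightarrow> real^3) \<Rightarrow> real \<Rightarrow> real \<Rightarrow> real" where
  "sfe C s t = pd_s (pd_s C) s t \<bullet> unit_normal C s t"

definition sff :: "(real \<Rightarrow> real \<Rightarrow> real^3) \<Rightarrow> real \<Rightarrow> real \<Rightarrow> real" where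
  "sff C s t = pd_t (pd_s C) s t \<bullet> unit_normal C s t"

definition sfg :: "(real \<Rightarrow> real \<Rightarrow> real^3) \<Rightarrow> real \<Rightarrow> real \<Rightarrow> real" where
  "sfg C s t = pd_t (pd_t C) s t \<bullet> unit_normal C s t"

definition regular_on :: "(real \<times> real) set \<Rightarrow> (real \<Rightarrow> real \<Rightarrow> real^3) \<Rightarrow> bool" where
  "regular_on U C \<longleftrightarrow> (\<forall>(s,t)\<in>U. ffE C s t * ffG C s t - (ffF C s t)\<^sup>2 \<noteq> 0)"

definition II_nondegenerate_on :: "(real \<times> real) set \<Rightarrow> (real \<Rightarrow> real \<Rightarrow> real^3) \<Rightarrow> bool" where
  "II_nondegenerate_on U C \<longleftrightarrow> (\<forall>(s,t)\<in>U. sfe C s t * sfg C s t - (sff C s t)\<^sup>2 \<noteq> 0)"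

definition mean_curvature :: "(real \<Rightarrow> real \<Rightarrow> real^3) \<Rightarrow> real \<Rightarrow> real \<Rightarrow> real" where
  "mean_curvature C s t =
     (ffE C s t * sfg C s t - 2 * ffF C s t * sff C s t + ffG C s t * sfe C s t) /
     (2 * (ffE C s t * ffG C s t - (ffF C s t)\<^sup>2))"

text \<open>Brioschi's formula for the second fundamental form, with the customary factor
  \<open>(\<bar>eg\<bar> - f\<^sup>2)\<^sup>2\<close> in the denominator.  Where \<open>eg \<ge> 0\<close> this is the Gaussian curvature of the second
  fundamental form; where \<open>eg < 0\<close> the latter has \<open>(eg - f\<^sup>2)\<^sup>2\<close> in place of that factor.\<close>

definition second_gaussian_curvature :: "(real \<Rightarrow> real \<Rightarrow> real^3) \<Rightarrow> real \<Rightarrow> real \<Rightarrow> real" where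
  "second_gaussian_curvature C s t =
     (let e = sfe C; f = sff C; g = sfg C in
      1 / (\<bar>e s t * g s t\<bar> - (f s t)\<^sup>2)\<^sup>2 *
      (det (vector
        [vector [- (1/2) * pd_t (pd_t e) s t + pd_t (pd_s f) s t - (1/2) * pd_s (pd_s g) s t,
                 (1/2) * pd_s e s t,
                 pd_s f s t - (1/2) * pd_t e s t],
         vector [pd_t f s t - (1/2) * pd_s g s t, e s t, f s t],
         vector [(1/2) * pd_t g s t, f s t, g s t]] :: real^3^3)
     - det (vector
        [vector [0, (1/2) * pd_t e s t, (1/2) * pd_s g s t],
         vector [(1/2) * pd_t e s t, e s t, f s t],
         vector [(1/2) * pd_s g s t, f s t, g s t]] :: real^3^3)))"

definition Weingarten_on ::
  "(real \<times> real) set \<Rightarrow> (real \<Rightarrow> real \<Rightarrow> real) \<Rightarrow> (real \<Rightarrow> real \<Rightarrow> real) \<Rightarrow> bool" where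
  "Weingarten_on U X Y \<longleftrightarrow>
     (\<forall>(s,t)\<in>U. pd_s X s t * pd_t Y s t - pd_t X s t * pd_s Y s t = 0)"

text \<open>The next two notions are used within the class of canal surfaces.\<close>

definition surface_of_revolution :: "real set \<Rightarrow> (real \<Rightarrow> real^3) \<Rightarrow> bool" where
  "surface_of_revolution I \<alpha> \<longleftrightarrow> (\<forall>s\<in>I. curvature \<alpha> s = 0)"

definition tubular_surface :: "real set \<Rightarrow> (real \<Rightarrow> real) \<Rightarrow> bool" where
  "tubular_surface I r \<longleftrightarrow> (\<exists>c. \<forall>s\<in>I. r s = c)"

end

theory Submission
  imports Defs "HOL-Complex_Analysis.Conformal_Mappings"
begin

text \<open>
  Let the center curve have nonvanishing curvature \<open>\<kappa>\<close>; the other case is a surface of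
  revolution. It turns out that the surface is then always a tube over a curve of constant curvature.

  Write \<open>u = r'\<close>, \<open>p = \<plusminus> sqrt (1 - u\<^sup>2)\<close>, \<open>a = r'' / p\<close> and \<open>A = \<kappa> cos t - a\<close>, \<open>P = p + r A\<close>. Up to a locally
  constant sign, the principal curvatures are \<open>1 / r\<close> and \<open>A / P\<close>, so \<open>H = (p + 2 r A) / (2 r P)\<close>. Brioschi's
  formula gives \<open>K\<^sub>I\<^sub>I = Y / (4 r\<^sup>2 \<Omega>\<^sup>2)\<close> with the same sign, where \<open>Y\<close> is a trigonometric polynomial in \<open>t\<close>
  of degree four (\<open>brioschi_determinants\<close>). Here \<open>\<Omega>\<close> is \<open>L = A P\<close> where \<open>e g \<ge> 0\<close>; where \<open>e g < 0\<close>, the factor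
  \<open>(\<bar>e g\<bar> - f\<^sup>2)\<^sup>2\<close> makes it a different polynomial \<open>W\<close>. Every open set contains a rectangle with one
  of these formulas throughout (\<open>curvature_rectangle\<close>).

  Cleared of denominators, the Jacobi function at a fixed \<open>s\<close> is a trigonometric polynomial in \<open>t\<close>
  that vanishes on an interval, so all its coefficients vanish. Its highest coefficient is computed
  from those of its constituents, which only requires their leading terms.

  For \<open>\<Omega> = L\<close>, the highest terms of \<open>K\<^sub>I\<^sub>I\<close> and \<open>H\<close> agree as \<open>A\<close> tends to infinity. Replacing \<open>K\<^sub>I\<^sub>I\<close> by
  \<open>K\<^sub>I\<^sub>I - H\<close>, whose numerator \<open>Z\<close> has degree two only, the highest coefficient is a nonzero multiple of \<open>u\<close>
  (\<open>jacobi_Z_imp_u_zero\<close>). So \<open>u = 0\<close>.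

  For \<open>\<Omega> = W\<close> and \<open>u \<noteq> 0\<close>, the highest coefficient yields \<open>\<tau> = 0\<close> and a differential equation for \<open>r\<close>
  (\<open>jacobi_W_imp\<close>). By \<open>\<tau> = 0\<close> the Jacobi function is essentially a polynomial in \<open>A\<close>. Its next two
  coefficients determine first \<open>\<kappa>\<close> as a function of \<open>u\<^sup>2\<close> and \<open>r\<close>, and then give an algebraic equation for
  \<open>u\<^sup>2\<close> (\<open>planar_elimination\<close>). Hence \<open>u\<close> is constant, which the differential equation forbids.

  So \<open>u = 0\<close> everywhere and the surface is a tube. Then \<open>H\<close> is a function of \<open>A\<close> alone, and the Jacobi
  function reduces to a term with the factor \<open>\<kappa> \<kappa>'\<close> (\<open>jacobi_Z_tube_imp\<close>), plus one with \<open>\<tau> \<tau>'\<close> of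
  different degree if \<open>\<Omega> = W\<close> (\<open>jacobi_W_tube_imp\<close>). This gives \<open>\<kappa>' = 0\<close>.
\<close>

section \<open>Leading coefficients of trigonometric polynomials\<close>

text \<open>The function \<open>f\<close> is a trigonometric polynomial of degree at most \<open>n\<close>, and \<open>c\<close> is its
  coefficient at \<open>exp (- i n t)\<close>: after multiplication by \<open>z ^ n\<close>, \<open>z = exp (i t)\<close>, it is an entire
  function of \<open>z\<close> whose value at the origin is that coefficient. This encoding makes the coefficient
  multiplicative without any bookkeeping of the lower ones.\<close>
definition trig_lead :: "nat \<Rightarrow> complex \<Rightarrow> (real \<Rightarrow> real) \<Rightarrow> bool" where
  "trig_lead n c f \<longleftrightarrow>
     (\<exists>G. G holomorphic_on UNIV \<and> G 0 = c \<and> (\<forall>t. G (cis t) = cis t ^ n * of_real (f t)))"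

lemma trig_lead_const: "trig_lead 0 (of_real c) (\<lambda>t. c)"
  unfolding trig_lead_def by (intro exI[of _ "\<lambda>z. of_real c"]) auto

lemma trig_lead_cos: "trig_lead 1 (1/2) cos"
  unfolding trig_lead_def
proof (intro exI[of _ "\<lambda>z. (1 + z\<^sup>2) / 2"] conjI allI)
  show "(\<lambda>z::complex. (1 + z\<^sup>2) / 2) holomorphic_on UNIV" by (intro holomorphic_intros) auto
  fix t :: real
  have "(sin t)\<^sup>2 = 1 - (cos t)\<^sup>2" by (rule sin_squared_eq)
  then show "(1 + (cis t)\<^sup>2) / 2 = cis t ^ 1 * complex_of_real (cos t)"
    by (simp add: complex_eq_iff power2_eq_square algebra_simps)
qed simp

lemma trig_lead_sin: "trig_lead 1 (\<i>/2) sin"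
  unfolding trig_lead_def
proof (intro exI[of _ "\<lambda>z. \<i> * (1 - z\<^sup>2) / 2"] conjI allI)
  show "(\<lambda>z::complex. \<i> * (1 - z\<^sup>2) / 2) holomorphic_on UNIV" by (intro holomorphic_intros) auto
  fix t :: real
  have "(sin t)\<^sup>2 = 1 - (cos t)\<^sup>2" by (rule sin_squared_eq)
  then show "\<i> * (1 - (cis t)\<^sup>2) / 2 = cis t ^ 1 * complex_of_real (sin t)"
    by (simp add: complex_eq_iff power2_eq_square algebra_simps)
qed simp

lemma trig_lead_add:
  assumes "trig_lead n c f" "trig_lead n d g"
  shows "trig_lead n (c + d) (\<lambda>t. f t + g t)"
proof -
  obtain F G where "F holomorphic_on UNIV" "F 0 = c" "\<forall>t. F (cis t) = cis t ^ n * of_real (f t)"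
    "G holomorphic_on UNIV" "G 0 = d" "\<forall>t. G (cis t) = cis t ^ n * of_real (g t)"
    using assms unfolding trig_lead_def by auto
  then show ?thesis unfolding trig_lead_def
    by (intro exI[of _ "\<lambda>z. F z + G z"]) (auto intro!: holomorphic_intros simp: algebra_simps)
qed

lemma trig_lead_mult:
  assumes "trig_lead n c f" "trig_lead m d g"
  shows "trig_lead (n + m) (c * d) (\<lambda>t. f t * g t)"
proof -
  obtain F G where "F holomorphic_on UNIV" "F 0 = c" "\<forall>t. F (cis t) = cis t ^ n * of_real (f t)"
    "G holomorphic_on UNIV" "G 0 = d" "\<forall>t. G (cis t) = cis t ^ m * of_real (g t)"
    using assms unfolding trig_lead_def by auto
  then show ?thesis unfolding trig_lead_def
    by (intro exI[of _ "\<lambda>z. F z * G z"]) (auto intro!: holomorphic_intros simp: power_add algebra_simps)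
qed

lemma trig_lead_cmult:
  assumes "trig_lead n c f" shows "trig_lead n (of_real b * c) (\<lambda>t. b * f t)"
  using trig_lead_mult[OF trig_lead_const assms] by simp

lemma trig_lead_diff:
  assumes "trig_lead n c f" "trig_lead n d g"
  shows "trig_lead n (c - d) (\<lambda>t. f t - g t)"
  using trig_lead_add[OF assms(1) trig_lead_cmult[OF assms(2), of "-1"]] by simp

lemma trig_lead_lower:
  assumes "trig_lead n c f" "n < m" shows "trig_lead m 0 f"
proof -
  obtain F where "F holomorphic_on UNIV" "F 0 = c" "\<forall>t. F (cis t) = cis t ^ n * of_real (f t)"
    using assms unfolding trig_lead_def by auto
  then show ?thesis unfolding trig_lead_def using assms(2)
    by (intro exI[of _ "\<lambda>z. z ^ (m - n) * F z"])
       (auto intro!: holomorphic_intros simp flip: power_add mult.assoc)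
qed

lemma trig_lead_power:
  assumes "trig_lead n c f" shows "trig_lead (j * n) (c ^ j) (\<lambda>t. f t ^ j)"
proof (induction j)
  case 0 show ?case using trig_lead_const[of 1] by simp
next
  case (Suc j) show ?case using trig_lead_mult[OF assms Suc] by simp
qed

lemma trig_lead_cong:
  assumes "trig_lead n c f" "n = m" "c = d" "\<And>t. f t = g t"
  shows "trig_lead m d g"
  using assms unfolding trig_lead_def by simp

text \<open>The entire function that represents \<open>f\<close> vanishes on an arc of the unit circle, hence
  everywhere, in particular at the origin.\<close>
lemma trig_lead_zero:
  assumes lead: "trig_lead n c f" and zero: "\<And>t. t1 < t \<Longrightarrow> t < t2 \<Longrightarrow> f t = 0" and "t1 < t2"
  shows "c = 0"
proof -
  obtain G where G: "G holomorphic_on UNIV" "G 0 = c" "\<forall>t. G (cis t) = cis t ^ n * of_real (f t)"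
    using lead unfolding trig_lead_def by auto
  define t0 where "t0 = (t1 + t2) / 2"
  have t0: "t1 < t0" "t0 < t2" using \<open>t1 < t2\<close> by (auto simp: t0_def)
  define S where "S = cis ` {t1<..<t2}"
  have lim: "cis t0 islimpt S"
    unfolding islimpt_sequential
  proof (intro exI[of _ "\<lambda>n. cis (t0 + min 1 (t2 - t0) / (real n + 2))"] conjI allI)
    fix n :: nat
    define d where "d = min 1 (t2 - t0) / (real n + 2)"
    have d: "0 < d" "d < 1" "d < t2 - t0"
    proof -
      define m where "m = min 1 (t2 - t0)"
      have m: "0 < m" "m \<le> 1" "m \<le> t2 - t0" using t0 by (auto simp: m_def)
      have "d \<le> m / 2" unfolding d_def m_def[symmetric] using m(1) by (intro divide_left_mono) auto
      moreover have "0 < d" unfolding d_def m_def[symmetric] using m(1) by (intro divide_pos_pos) auto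
      ultimately show "0 < d" "d < 1" "d < t2 - t0" using m by auto
    qed
    have "cos d < 1" using cos_monotone_0_pi[of 0 d] d pi_gt3 by simp
    then have "cis d \<noteq> 1" by (auto simp: complex_eq_iff)
    then have "cis (t0 + d) \<noteq> cis t0" by (simp flip: cis_mult)
    then show "cis (t0 + min 1 (t2 - t0) / (real n + 2)) \<in> S - {cis t0}"
      using d t0 unfolding S_def d_def[symmetric] by auto
  next
    have "(\<lambda>n. t0 + min 1 (t2 - t0) * (1 / (real n + 2))) \<longlonglongrightarrow> t0 + min 1 (t2 - t0) * 0"
      using LIMSEQ_ignore_initial_segment[OF lim_1_over_n[where 'a=real], of 2] by (intro tendsto_intros) (simp add: add.commute)
    then show "(\<lambda>n. cis (t0 + min 1 (t2 - t0) / (real n + 2))) \<longlonglongrightarrow> cis t0"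
      by (intro tendsto_intros) auto
  qed
  have "G 0 = 0"
    by (rule analytic_continuation[OF G(1) _ _ _ _ lim, of 0])
       (use G(3) zero t0 in \<open>auto simp: S_def\<close>)
  then show ?thesis using G by simp
qed

definition trig_deg where "trig_deg n f \<longleftrightarrow> (\<exists>c. trig_lead n c f)"

lemma trig_degI: "trig_lead n c f \<Longrightarrow> n \<le> m \<Longrightarrow> trig_deg m f"
  unfolding trig_deg_def by (cases "n = m") (auto dest: trig_lead_lower[of n _ _ m])

lemma trig_deg_mono: "trig_deg n f \<Longrightarrow> n \<le> m \<Longrightarrow> trig_deg m f"
  using trig_degI unfolding trig_deg_def by blast

lemma trig_deg_lower: "trig_deg n f \<Longrightarrow> n < m \<Longrightarrow> trig_lead m 0 f"
  unfolding trig_deg_def by (auto intro: trig_lead_lower)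

lemma trig_deg_const: "trig_deg n (\<lambda>t. c)"
  using trig_degI[OF trig_lead_const, of n c] by simp
lemma trig_deg_add: "trig_deg n f \<Longrightarrow> trig_deg n g \<Longrightarrow> trig_deg n (\<lambda>t. f t + g t)"
  unfolding trig_deg_def by (auto intro: trig_lead_add)
lemma trig_deg_diff: "trig_deg n f \<Longrightarrow> trig_deg n g \<Longrightarrow> trig_deg n (\<lambda>t. f t - g t)"
  unfolding trig_deg_def by (auto intro: trig_lead_diff)
lemma trig_deg_cmult: "trig_deg n f \<Longrightarrow> trig_deg n (\<lambda>t. b * f t)"
  unfolding trig_deg_def by (auto intro: trig_lead_cmult)
lemma trig_deg_mult: "trig_deg n f \<Longrightarrow> trig_deg m g \<Longrightarrow> n + m \<le> k \<Longrightarrow> trig_deg k (\<lambda>t. f t * g t)"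
  by (metis (full_types) trig_deg_def trig_lead_mult trig_deg_mono)
lemmas trig_deg_intros = trig_deg_add trig_deg_diff trig_deg_cmult trig_deg_const

section \<open>The polynomials in the curvatures of a canal surface\<close>

text \<open>The invariants of a canal surface with \<open>r' = u\<close>: the number \<open>p\<close> is \<open>\<plusminus> sqrt (1 - r'\<^sup>2)\<close>, so that
  \<open>Q = r p\<close>, and \<open>a = r'' / p\<close>. Writing \<open>(u, p) = (sin \<theta>, cos \<theta>)\<close> locally, \<open>a\<close> is \<open>\<theta>'\<close>; with this choice
  all derivatives are polynomials in the invariants.\<close>
locale canal_coefficients =
  fixes I :: "real set" and r u p a a' a'' \<kappa> \<kappa>' \<kappa>'' \<tau> \<tau>' :: "real \<Rightarrow> real"
  assumes open_I: "open I"
    and deriv_r: "s \<in> I \<Longrightarrow> (r has_real_derivative u s) (at s)"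
    and deriv_u: "s \<in> I \<Longrightarrow> (u has_real_derivative p s * a s) (at s)"
    and deriv_p: "s \<in> I \<Longrightarrow> (p has_real_derivative - u s * a s) (at s)"
    and deriv_a: "s \<in> I \<Longrightarrow> (a has_real_derivative a' s) (at s)"
    and deriv_a': "s \<in> I \<Longrightarrow> (a' has_real_derivative a'' s) (at s)"
    and deriv_\<kappa>: "s \<in> I \<Longrightarrow> (\<kappa> has_real_derivative \<kappa>' s) (at s)"
    and deriv_\<kappa>': "s \<in> I \<Longrightarrow> (\<kappa>' has_real_derivative \<kappa>'' s) (at s)"
    and deriv_\<tau>: "s \<in> I \<Longrightarrow> (\<tau> has_real_derivative \<tau>' s) (at s)"
    and r_pos: "s \<in> I \<Longrightarrow> r s > 0"
    and p_nonzero: "s \<in> I \<Longrightarrow> p s \<noteq> 0"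
    and \<kappa>_nonzero: "s \<in> I \<Longrightarrow> \<kappa> s \<noteq> 0"
    and u_p: "s \<in> I \<Longrightarrow> (u s)\<^sup>2 + (p s)\<^sup>2 = 1"
begin

lemmas deriv_coefficients [derivative_intros] =
  deriv_r[THEN DERIV_chain2] deriv_u[THEN DERIV_chain2] deriv_p[THEN DERIV_chain2]
  deriv_a[THEN DERIV_chain2] deriv_a'[THEN DERIV_chain2] deriv_\<kappa>[THEN DERIV_chain2]
  deriv_\<kappa>'[THEN DERIV_chain2] deriv_\<tau>[THEN DERIV_chain2]

text \<open>The function \<open>A\<close> is the component of the derivative of the sphere normal in \<open>s\<close> direction
  along the tangent vector orthogonal to the circles; the principal curvatures are \<open>1 / r\<close> and
  \<open>A / P\<close> up to a common sign. The numerators and denominators of all curvatures are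
  polynomials in \<open>A\<close> and its derivatives.\<close>
definition A where "A s t = \<kappa> s * cos t - a s"
definition A_t where "A_t s t = - \<kappa> s * sin t"
definition A_s where "A_s s t = \<kappa>' s * cos t - a' s"
definition A_st where "A_st s t = - \<kappa>' s * sin t"
definition A_ss where "A_ss s t = \<kappa>'' s * cos t - a'' s"
definition P where "P s t = p s + r s * A s t"
definition P_s where "P_s s t = - u s * a s + u s * A s t + r s * A_s s t"

lemma A_t_sq: "(A_t s t)\<^sup>2 = (\<kappa> s)\<^sup>2 - (A s t + a s)\<^sup>2"
  by (simp add: A_t_def A_def power_mult_distrib sin_squared_eq algebra_simps)

lemma deriv_A_s: "s \<in> I \<Longrightarrow> ((\<lambda>x. A x t) has_real_derivative A_s s t) (at s)"
  unfolding A_def A_s_def by (auto intro!: derivative_eq_intros)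
lemma deriv_A_t: "((\<lambda>x. A s x) has_real_derivative A_t s t) (at t)"
  unfolding A_def A_t_def by (auto intro!: derivative_eq_intros)
lemma deriv_A_ss: "s \<in> I \<Longrightarrow> ((\<lambda>x. A_s x t) has_real_derivative A_ss s t) (at s)"
  unfolding A_s_def A_ss_def by (auto intro!: derivative_eq_intros)
lemma deriv_A_st: "((\<lambda>x. A_s s x) has_real_derivative A_st s t) (at t)"
  unfolding A_s_def A_st_def by (auto intro!: derivative_eq_intros)
lemma deriv_A_ts: "s \<in> I \<Longrightarrow> ((\<lambda>x. A_t x t) has_real_derivative A_st s t) (at s)"
  unfolding A_t_def A_st_def by (auto intro!: derivative_eq_intros)
lemma deriv_A_tt: "((\<lambda>x. A_t s x) has_real_derivative - (A s t + a s)) (at t)"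
  unfolding A_t_def A_def by (auto intro!: derivative_eq_intros)
lemma deriv_P_s: "s \<in> I \<Longrightarrow> ((\<lambda>x. P x t) has_real_derivative P_s s t) (at s)"
  unfolding P_def P_s_def by (auto intro!: derivative_eq_intros deriv_A_s simp: algebra_simps)
lemma deriv_P_t: "((\<lambda>x. P s x) has_real_derivative r s * A_t s t) (at t)"
  unfolding P_def by (auto intro!: derivative_eq_intros deriv_A_t)

lemmas deriv_A [derivative_intros] =
  deriv_A_s[THEN DERIV_chain2] deriv_A_t[THEN DERIV_chain2] deriv_A_ss[THEN DERIV_chain2]
  deriv_A_st[THEN DERIV_chain2] deriv_A_ts[THEN DERIV_chain2] deriv_A_tt[THEN DERIV_chain2]
  deriv_P_s[THEN DERIV_chain2] deriv_P_t[THEN DERIV_chain2]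

text \<open>Up to the factor \<open>r p\<^sup>2\<close>, this is the determinant \<open>e g - f\<^sup>2\<close> of the second fundamental form.\<close>
definition L where "L s t = A s t * P s t"
definition L_t where "L_t s t = (p s + 2 * r s * A s t) * A_t s t"
definition L_s where "L_s s t = A_s s t * P s t + A s t * P_s s t"

lemma deriv_L_s: "s \<in> I \<Longrightarrow> ((\<lambda>x. L x t) has_real_derivative L_s s t) (at s)"
  unfolding L_def L_s_def by (auto intro!: derivative_eq_intros)
lemma deriv_L_t: "((\<lambda>x. L s x) has_real_derivative L_t s t) (at t)"
  unfolding L_def L_t_def P_def by (auto intro!: derivative_eq_intros simp: algebra_simps)

text \<open>Coefficients of the part of degree one of the numerator \<open>Y\<close> of the second Gaussian curvature,
  followed by their derivatives.\<close>
definition c1 where "c1 s = (u s)\<^sup>2 * p s - r s * a s * (2 * (p s)\<^sup>2 - (u s)\<^sup>2)"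
definition c2 where "c2 s = r s * u s * p s"
definition c0 where "c0 s = r s * (p s)\<^sup>2 * ((\<kappa> s)\<^sup>2 - (a s)\<^sup>2)"
definition c3 where "c3 s = r s * u s * p s * \<tau> s"
definition c1' where "c1' s = 2 * u s * (p s)\<^sup>2 * a s - (u s)^3 * a s
   - (u s * a s + r s * a' s) * (2 * (p s)\<^sup>2 - (u s)\<^sup>2) + 6 * r s * (a s)\<^sup>2 * u s * p s"
definition c2' where "c2' s = (u s)\<^sup>2 * p s + r s * a s * ((p s)\<^sup>2 - (u s)\<^sup>2)"
definition c0' where "c0' s = (u s * (p s)\<^sup>2 - 2 * r s * p s * u s * a s) * ((\<kappa> s)\<^sup>2 - (a s)\<^sup>2)
   + 2 * r s * (p s)\<^sup>2 * (\<kappa> s * \<kappa>' s - a s * a' s)"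
definition c3' where "c3' s = c2' s * \<tau> s + c2 s * \<tau>' s"

lemma deriv_c1: "s \<in> I \<Longrightarrow> (c1 has_real_derivative c1' s) (at s)"
  unfolding c1_def[abs_def] c1'_def 
  by (auto intro!: derivative_eq_intros simp: power2_eq_square power3_eq_cube algebra_simps)
lemma deriv_c2: "s \<in> I \<Longrightarrow> (c2 has_real_derivative c2' s) (at s)"
  unfolding c2_def[abs_def] c2'_def 
  by (auto intro!: derivative_eq_intros simp: power2_eq_square algebra_simps)
lemma deriv_c0: "s \<in> I \<Longrightarrow> (c0 has_real_derivative c0' s) (at s)"
  unfolding c0_def[abs_def] c0'_def 
  by (auto intro!: derivative_eq_intros simp: power2_eq_square algebra_simps)
lemma deriv_c3: "s \<in> I \<Longrightarrow> (c3 has_real_derivative c3' s) (at s)"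
  unfolding c3_def[abs_def] c3'_def c2'_def c2_def
  by (auto intro!: derivative_eq_intros simp: power2_eq_square algebra_simps)
lemmas deriv_c [derivative_intros] = deriv_c0[THEN DERIV_chain2] deriv_c1[THEN DERIV_chain2]
  deriv_c2[THEN DERIV_chain2] deriv_c3[THEN DERIV_chain2]

definition Y_low where "Y_low s t = c1 s * A s t + c2 s * A_s s t + c3 s * A_t s t + c0 s"
definition Y_low_t where "Y_low_t s t = c1 s * A_t s t + c2 s * A_st s t - c3 s * (A s t + a s)"
definition Y_low_s where "Y_low_s s t = c1' s * A s t + c1 s * A_s s t + c2' s * A_s s t
   + c2 s * A_ss s t + c3' s * A_t s t + c3 s * A_st s t + c0' s"

lemma deriv_Y_low_s: "s \<in> I \<Longrightarrow> ((\<lambda>x. Y_low x t) has_real_derivative Y_low_s s t) (at s)"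
  unfolding Y_low_def Y_low_s_def by (auto intro!: derivative_eq_intros)
lemma deriv_Y_low_t: "((\<lambda>x. Y_low s x) has_real_derivative Y_low_t s t) (at t)"
  unfolding Y_low_def Y_low_t_def by (auto intro!: derivative_eq_intros simp: algebra_simps)
lemmas deriv_Y_low [derivative_intros] =
  deriv_Y_low_s[THEN DERIV_chain2] deriv_Y_low_t[THEN DERIV_chain2]

text \<open>The numerator of the second Gaussian curvature, which is \<open>\<plusminus> Y / (4 r\<^sup>2 L\<^sup>2)\<close> where
  \<open>e g \<ge> 0\<close>.\<close>
definition Y where "Y s t = 4 * r s ^ 3 * A s t ^ 4 + 6 * (r s)\<^sup>2 * p s * A s t ^ 3
   + r s * (p s)\<^sup>2 * (A s t)\<^sup>2 + Y_low s t"
definition Y_t where "Y_t s t = (16 * r s ^ 3 * A s t ^ 3 + 18 * (r s)\<^sup>2 * p s * (A s t)\<^sup>2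
   + 2 * r s * (p s)\<^sup>2 * A s t) * A_t s t + Y_low_t s t"
definition Y_s where "Y_s s t = 12 * (r s)\<^sup>2 * u s * A s t ^ 4
   + (12 * r s * u s * p s - 6 * (r s)\<^sup>2 * u s * a s) * A s t ^ 3
   + (u s * (p s)\<^sup>2 - 2 * r s * p s * u s * a s) * (A s t)\<^sup>2
   + (16 * r s ^ 3 * A s t ^ 3 + 18 * (r s)\<^sup>2 * p s * (A s t)\<^sup>2
   + 2 * r s * (p s)\<^sup>2 * A s t) * A_s s t + Y_low_s s t"

lemma deriv_Y_s: "s \<in> I \<Longrightarrow> ((\<lambda>x. Y x t) has_real_derivative Y_s s t) (at s)"
  unfolding Y_def Y_s_def by (auto intro!: derivative_eq_intros simp: algebra_simps power2_eq_square)
lemma deriv_Y_t: "((\<lambda>x. Y s x) has_real_derivative Y_t s t) (at t)"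
  unfolding Y_def Y_t_def by (auto intro!: derivative_eq_intros simp: algebra_simps)

text \<open>The numerator of \<open>\<plusminus>K\<^sub>I\<^sub>I - H\<close>, with the same denominator. The terms of degree four and three
  of \<open>Y\<close> are those of \<open>4 r\<^sup>2 L\<^sup>2 H\<close>, and they cancel.\<close>
definition Z where "Z s t = Y_low s t - r s * (p s)\<^sup>2 * (A s t)\<^sup>2"
definition Z_t where "Z_t s t = Y_low_t s t - 2 * r s * (p s)\<^sup>2 * A s t * A_t s t"
definition Z_s where "Z_s s t = Y_low_s s t - (u s * (p s)\<^sup>2 - 2 * r s * p s * u s * a s) * (A s t)\<^sup>2
   - 2 * r s * (p s)\<^sup>2 * A s t * A_s s t"

lemma deriv_Z_s: "s \<in> I \<Longrightarrow> ((\<lambda>x. Z x t) has_real_derivative Z_s s t) (at s)"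
  unfolding Z_def Z_s_def by (auto intro!: derivative_eq_intros simp: algebra_simps power2_eq_square)
lemma deriv_Z_t: "((\<lambda>x. Z s x) has_real_derivative Z_t s t) (at t)"
  unfolding Z_def Z_t_def by (auto intro!: derivative_eq_intros simp: algebra_simps)

text \<open>Coefficients of \<open>W\<close>, the quantity that takes the place of \<open>L\<close> in the denominator where
  \<open>e g < 0\<close>; again with their derivatives.\<close>
definition w2 where "w2 s = r s * (1 - 2 * (u s)\<^sup>2)"
definition w1 where "w1 s = p s - 4 * a s * r s * (u s)\<^sup>2"
definition w3 where "w3 s = - 4 * c3 s"
definition w0 where "w0 s = 2 * r s * ((u s)\<^sup>2 * ((\<kappa> s)\<^sup>2 - (a s)\<^sup>2) + (p s)\<^sup>2 * (\<tau> s)\<^sup>2)"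
definition w2' where "w2' s = u s * (1 - 2 * (u s)\<^sup>2) - 4 * r s * u s * p s * a s"
definition w1' where "w1' s = - u s * a s - 4 * (a' s * r s * (u s)\<^sup>2 + a s * (u s)^3
   + 2 * (a s)\<^sup>2 * r s * u s * p s)"
definition w3' where "w3' s = - 4 * c3' s"
definition w0' where "w0' s = 2 * u s * ((u s)\<^sup>2 * ((\<kappa> s)\<^sup>2 - (a s)\<^sup>2) + (p s)\<^sup>2 * (\<tau> s)\<^sup>2)
   + 4 * r s * (u s * p s * a s * ((\<kappa> s)\<^sup>2 - (a s)\<^sup>2) + (u s)\<^sup>2 * (\<kappa> s * \<kappa>' s - a s * a' s)
     - p s * u s * a s * (\<tau> s)\<^sup>2 + (p s)\<^sup>2 * \<tau> s * \<tau>' s)"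

lemma deriv_w2: "s \<in> I \<Longrightarrow> (w2 has_real_derivative w2' s) (at s)"
  unfolding w2_def[abs_def] w2'_def 
  by (auto intro!: derivative_eq_intros simp: power2_eq_square algebra_simps)
lemma deriv_w1: "s \<in> I \<Longrightarrow> (w1 has_real_derivative w1' s) (at s)"
  unfolding w1_def[abs_def] w1'_def 
  by (auto intro!: derivative_eq_intros simp: power2_eq_square power3_eq_cube algebra_simps)
lemma deriv_w3: "s \<in> I \<Longrightarrow> (w3 has_real_derivative w3' s) (at s)"
  unfolding w3_def[abs_def] w3'_def by (auto intro!: derivative_eq_intros)
lemma deriv_w0: "s \<in> I \<Longrightarrow> (w0 has_real_derivative w0' s) (at s)"
  unfolding w0_def[abs_def] w0'_def 
  by (auto intro!: derivative_eq_intros simp: power2_eq_square algebra_simps)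
lemmas deriv_w [derivative_intros] = deriv_w0[THEN DERIV_chain2] deriv_w1[THEN DERIV_chain2]
  deriv_w2[THEN DERIV_chain2] deriv_w3[THEN DERIV_chain2]

definition V where "V s t = w1 s * A s t + w3 s * A_t s t + w0 s"
definition V_t where "V_t s t = w1 s * A_t s t - w3 s * (A s t + a s)"
definition W where "W s t = w2 s * (A s t)\<^sup>2 + V s t"
definition W_t where "W_t s t = 2 * w2 s * A s t * A_t s t + V_t s t"
definition W_s where "W_s s t = w2' s * (A s t)\<^sup>2 + 2 * w2 s * A s t * A_s s t
   + w1' s * A s t + w1 s * A_s s t + w3' s * A_t s t + w3 s * A_st s t + w0' s"

lemma deriv_W_s: "s \<in> I \<Longrightarrow> ((\<lambda>x. W x t) has_real_derivative W_s s t) (at s)"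
  unfolding W_def V_def W_s_def by (auto intro!: derivative_eq_intros)
lemma deriv_W_t: "((\<lambda>x. W s x) has_real_derivative W_t s t) (at t)"
  unfolding W_def V_def W_t_def V_t_def by (auto intro!: derivative_eq_intros simp: algebra_simps)

text \<open>The mean curvature \<open>(p + 2 r A) / (2 r P)\<close> up to sign, in the form that is easiest to differentiate.\<close>
definition H where "H s t = 1 / r s - p s / (2 * r s * P s t)"

definition h where
  "h s t = 2 * u s * (P s t)\<^sup>2 - u s * (r s * a s + p s) * P s t - r s * p s * P_s s t"

lemma deriv_H_s:
  assumes "s \<in> I" "P s t \<noteq> 0"
  shows "((\<lambda>x. H x t) has_real_derivative - h s t / (2 * (r s)\<^sup>2 * (P s t)\<^sup>2)) (at s)"
  using r_pos[OF assms(1)] assms unfolding H_def h_def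
  by (auto intro!: derivative_eq_intros simp: field_simps power2_eq_square)

lemma deriv_H_t:
  assumes "s \<in> I" "P s t \<noteq> 0"
  shows "((\<lambda>x. H s x) has_real_derivative p s * A_t s t / (2 * (P s t)\<^sup>2)) (at t)"
  using r_pos[OF assms(1)] assms unfolding H_def h_def
  by (auto intro!: derivative_eq_intros simp: field_simps power2_eq_square)

text \<open>The Jacobi function of \<open>H\<close> and \<open>X / (4 r\<^sup>2 Om\<^sup>2)\<close> times the common denominator
  \<open>- 8 r\<^sup>4 P\<^sup>2 Om\<^sup>3\<close>. The function \<open>h\<close> is the numerator of \<open>- H\<^sub>s\<close>.\<close>
definition jacobi where
  "jacobi X X_s X_t Om Om_s Om_t s t =
    h s t * (X_t s t * Om s t - 2 * X s t * Om_t s t) + r s * p s * A_t s t *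
    (r s * X_s s t * Om s t - 2 * r s * X s t * Om_s s t - 2 * u s * X s t * Om s t)"

end

section \<open>The highest coefficient of the Jacobi function\<close>

context canal_coefficients
begin

lemma lead_A: "trig_lead 1 (\<kappa> s / 2) (A s)"
  unfolding A_def
  by (rule trig_lead_cong[OF trig_lead_diff[OF trig_lead_cmult[OF trig_lead_cos, of "\<kappa> s"]
        trig_lead_lower[OF trig_lead_const, of 1 "a s"]]]) auto
lemma lead_A_t: "trig_lead 1 (- \<i> * \<kappa> s / 2) (A_t s)"
  unfolding A_t_def
  by (rule trig_lead_cong[OF trig_lead_cmult[OF trig_lead_sin, of "- \<kappa> s"]]) auto
lemma lead_A_s: "trig_lead 1 (\<kappa>' s / 2) (A_s s)"
  unfolding A_s_def
  by (rule trig_lead_cong[OF trig_lead_diff[OF trig_lead_cmult[OF trig_lead_cos, of "\<kappa>' s"]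
        trig_lead_lower[OF trig_lead_const, of 1 "a' s"]]]) auto
lemma deg_A_st: "trig_deg 1 (A_st s)"
  unfolding A_st_def by (intro trig_deg_cmult trig_degI[OF trig_lead_sin]) auto
lemma deg_A_ss: "trig_deg 1 (A_ss s)"
  unfolding A_ss_def by (intro trig_deg_intros trig_degI[OF trig_lead_cos]) auto
lemma deg_P_s: "trig_deg 1 (P_s s)"
  unfolding P_s_def by (intro trig_deg_intros trig_degI[OF lead_A] trig_degI[OF lead_A_s]) auto
lemma lead_P: "trig_lead 1 (r s * \<kappa> s / 2) (P s)"
  unfolding P_def
  by (rule trig_lead_cong[OF trig_lead_add[OF 
        trig_lead_lower[OF trig_lead_const, of 1 "p s"] trig_lead_cmult[OF lead_A, of "r s"]]]) auto

lemmas deg_intros = trig_deg_intros deg_A_st deg_A_ss deg_P_s trig_degI[OF lead_A]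
  trig_degI[OF lead_A_s] trig_degI[OF lead_A_t] trig_degI[OF lead_P]

lemma lead_L: "trig_lead 2 (r s * (\<kappa> s / 2)\<^sup>2) (L s)"
  unfolding L_def
  by (rule trig_lead_cong[OF trig_lead_mult[OF lead_A lead_P]]) (auto simp: power2_eq_square)
lemma lead_L_t: "trig_lead 2 (- 2 * \<i> * r s * (\<kappa> s / 2)\<^sup>2) (L_t s)"
proof -
  have "trig_lead 1 (r s * \<kappa> s) (\<lambda>t. p s + 2 * r s * A s t)"
    by (rule trig_lead_cong[OF trig_lead_add[OF 
        trig_lead_lower[OF trig_lead_const, of 1 "p s"] trig_lead_cmult[OF lead_A, of "2 * r s"]]]) auto
  from trig_lead_mult[OF this lead_A_t] show ?thesis
    unfolding L_t_def by (rule trig_lead_cong) (auto simp: power2_eq_square)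
qed
lemma deg_L_s: "trig_deg 2 (L_s s)"
  unfolding L_s_def by (intro deg_intros trig_deg_mult[where n = 1 and m = 1]) auto

lemma deg_Y_low: "trig_deg 1 (Y_low s)"
  unfolding Y_low_def by (intro deg_intros) auto
lemma deg_Y_low_t: "trig_deg 1 (Y_low_t s)"
  unfolding Y_low_t_def by (intro deg_intros) auto
lemma deg_Y_low_s: "trig_deg 1 (Y_low_s s)"
  unfolding Y_low_s_def by (intro deg_intros) auto

lemma lead_h: "trig_lead 2 (2 * u s * (r s * \<kappa> s / 2)\<^sup>2) (h s)"
proof -
  have "trig_deg 1 (\<lambda>t. u s * (r s * a s + p s) * P s t + r s * p s * P_s s t)"
    by (intro deg_intros) auto
  from trig_lead_diff[OF trig_lead_cmult[OF trig_lead_power[OF lead_P, of 2], of "2 * u s"]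
     trig_deg_lower[OF this, of "2 * 1"]] show ?thesis
    unfolding h_def by (rule trig_lead_cong) auto
qed

lemma lead_Z: "trig_lead 2 (- r s * (p s)\<^sup>2 * (\<kappa> s / 2)\<^sup>2) (Z s)"
  using trig_lead_diff[OF trig_deg_lower[OF deg_Y_low, of "2 * 1"]
    trig_lead_cmult[OF trig_lead_power[OF lead_A, of 2], of "r s * (p s)\<^sup>2"]]
  unfolding Z_def by (rule trig_lead_cong) auto
lemma lead_Z_t: "trig_lead 2 (2 * \<i> * r s * (p s)\<^sup>2 * (\<kappa> s / 2)\<^sup>2) (Z_t s)"
  using trig_lead_diff[OF trig_deg_lower[OF deg_Y_low_t, of "1 + 1"]
    trig_lead_cmult[OF trig_lead_mult[OF lead_A lead_A_t], of "2 * r s * (p s)\<^sup>2"]]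
  unfolding Z_t_def by (rule trig_lead_cong) (auto simp: power2_eq_square)
lemma deg_Z_s: "trig_deg 2 (Z_s s)"
proof -
  have "trig_deg 2 (\<lambda>t. (A s t)\<^sup>2)" using trig_degI[OF trig_lead_power[OF lead_A, of 2]] by simp
  moreover have "trig_deg 2 (\<lambda>t. A s t * A_s s t)"
    by (intro deg_intros trig_deg_mult[where n = 1 and m = 1]) auto
  ultimately show ?thesis
    unfolding Z_s_def mult.assoc[of _ "A s _" "A_s s _"]
    by (intro deg_intros trig_deg_mono[OF deg_Y_low_s]) auto
qed

text \<open>In the product \<open>h (Z\<^sub>t L - 2 Z L\<^sub>t)\<close> nothing cancels in degree six, while the other summand of the
  Jacobi function has degree five. Hence the coefficient of degree six is a nonzero multiple of
  \<open>u\<close>.\<close>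
lemma jacobi_Z_imp_u_zero:
  assumes s: "s \<in> I" and "t1 < t2"
    and zero: "\<And>t. t1 < t \<Longrightarrow> t < t2 \<Longrightarrow> jacobi Z Z_s Z_t L L_s L_t s t = 0"
  shows "u s = 0"
proof -
  have 1: "trig_deg 5 (\<lambda>t. r s * p s * A_t s t *
    (r s * Z_s s t * L s t - 2 * r s * Z s t * L_s s t - 2 * u s * Z s t * L s t))"
    unfolding mult.assoc
    by (intro trig_deg_cmult trig_deg_diff trig_deg_mult[OF trig_degI[OF lead_A_t order.refl], where m = 4]
        trig_deg_mult[OF deg_Z_s trig_degI[OF lead_L order.refl]]
        trig_deg_mult[OF trig_degI[OF lead_Z order.refl] deg_L_s]
        trig_deg_mult[OF trig_degI[OF lead_Z order.refl] trig_degI[OF lead_L order.refl]]) auto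
  define c where "c = complex_of_real (\<kappa> s) / 2"
  have c: "c \<noteq> 0" using \<kappa>_nonzero[OF s] by (simp add: c_def)
  have "trig_lead 6 (4 * \<i> * r s ^ 4 * (p s)\<^sup>2 * u s * c^6 * (-1)) (jacobi Z Z_s Z_t L L_s L_t s)"
    unfolding jacobi_def
    by (rule trig_lead_cong[OF trig_lead_add[OF trig_lead_mult[OF lead_h
      trig_lead_diff[OF trig_lead_mult[OF lead_Z_t lead_L]
        trig_lead_cmult[OF trig_lead_mult[OF lead_Z lead_L_t], of 2]]] 
      trig_deg_lower[OF 1, of "2+(2+2)"]]])
     (auto simp: c_def field_simps power2_eq_square power3_eq_cube eval_nat_numeral)
  from trig_lead_zero[OF this zero \<open>t1 < t2\<close>] show ?thesis
    using r_pos[OF s] p_nonzero[OF s] c by auto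
qed

lemma lead_V: "trig_lead 1 ((w1 s - \<i> * w3 s) * \<kappa> s / 2) (V s)"
  using trig_lead_add[OF trig_lead_add[OF trig_lead_cmult[OF lead_A, of "w1 s"]
     trig_lead_cmult[OF lead_A_t, of "w3 s"]]  trig_lead_lower[OF trig_lead_const, of 1 "w0 s"]]
  unfolding V_def by (rule trig_lead_cong) (auto simp: field_simps)
lemma lead_V_t: "trig_lead 1 (- (\<i> * w1 s + w3 s) * \<kappa> s / 2) (V_t s)"
  using trig_lead_diff[OF trig_lead_cmult[OF lead_A_t, of "w1 s"]
     trig_lead_cmult[OF trig_lead_add[OF lead_A trig_lead_lower[OF trig_lead_const, of 1 "a s"]], of "w3 s"]]
  unfolding V_t_def by (rule trig_lead_cong) (auto simp: field_simps)
lemma lead_W: "trig_lead 2 (w2 s * (\<kappa> s / 2)\<^sup>2) (W s)"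
  using trig_lead_add[OF trig_lead_cmult[OF trig_lead_power[OF lead_A, of 2], of "w2 s"]
    trig_lead_lower[OF lead_V]]
  unfolding W_def by (rule trig_lead_cong) auto
lemma deg_W_t: "trig_deg 2 (W_t s)"
  unfolding W_t_def mult.assoc
  by (intro deg_intros trig_deg_mult[where n = 1 and m = 1] trig_degI[OF lead_V_t]) auto
lemma lead_W_s: "trig_lead 2 (w2' s * (\<kappa> s / 2)\<^sup>2 + w2 s * \<kappa> s * \<kappa>' s / 2) (W_s s)"
proof -
  have "trig_deg 1 (\<lambda>t. w1' s * A s t + w1 s * A_s s t + w3' s * A_t s t + w3 s * A_st s t + w0' s)"
    by (intro deg_intros) auto
  from trig_lead_add[OF trig_lead_add[OF trig_lead_cmult[OF trig_lead_mult[OF lead_A[of s] lead_A[of s]], of "w2' s"]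
     trig_lead_cmult[OF trig_lead_mult[OF lead_A[of s] lead_A_s[of s]], of "2 * w2 s"]]
     trig_deg_lower[OF this, of "1 + 1"]]
  show ?thesis unfolding W_s_def by (rule trig_lead_cong) (auto simp: power2_eq_square)
qed

text \<open>The formula for \<open>K\<^sub>I\<^sub>I\<close> with denominator \<open>W\<^sup>2\<close> carries no information where \<open>W\<close> vanishes; the
  leading coefficients of \<open>W\<close> serve to exclude this on open sets.\<close>
lemma W_zero_imp:
  assumes s: "s \<in> I" and "t1 < t2" and zero: "\<And>t. t1 < t \<Longrightarrow> t < t2 \<Longrightarrow> W s t = 0"
  shows "2 * (u s)\<^sup>2 = 1" "w1 s = 0"
proof -
  have w2: "w2 s = 0" using trig_lead_zero[OF lead_W zero \<open>t1 < t2\<close>] \<kappa>_nonzero[OF s] by auto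
  then show "2 * (u s)\<^sup>2 = 1" using r_pos[OF s] by (simp add: w2_def)
  have "V s t = 0" if "t1 < t" "t < t2" for t using zero[OF that] w2 by (simp add: W_def)
  from trig_lead_zero[OF lead_V this \<open>t1 < t2\<close>] \<kappa>_nonzero[OF s] show "w1 s = 0"
    by (auto simp: complex_eq_iff)
qed

lemma lead_Y: "trig_lead 4 (4 * r s ^ 3 * (\<kappa> s / 2)^4) (Y s)"
proof -
  have "trig_deg 3 (\<lambda>t. 6 * (r s)\<^sup>2 * p s * A s t ^ 3 + r s * (p s)\<^sup>2 * (A s t)\<^sup>2 + Y_low s t)"
    by (intro trig_deg_intros trig_degI[OF trig_lead_power[OF lead_A]] trig_deg_mono[OF deg_Y_low]) auto
  from trig_lead_add[OF trig_lead_cmult[OF trig_lead_power[OF lead_A, of 4], of "4 * r s ^ 3"]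
    trig_deg_lower[OF this, of "4 * 1"]] show ?thesis
    unfolding Y_def by (rule trig_lead_cong) auto
qed
lemma lead_Y_s: "trig_lead 4 (12 * (r s)\<^sup>2 * u s * (\<kappa> s / 2)^4 + 16 * r s ^ 3 * (\<kappa> s / 2)^3 * (\<kappa>' s / 2)) (Y_s s)"
proof -
  define q3 q2 where "q3 = 12 * r s * u s * p s - 6 * (r s)\<^sup>2 * u s * a s"
    and "q2 = u s * (p s)\<^sup>2 - 2 * r s * p s * u s * a s"
  have "trig_deg 3 (\<lambda>t. q3 * A s t ^ 3 + q2 * (A s t)\<^sup>2
    + 18 * (r s)\<^sup>2 * p s * ((A s t)\<^sup>2 * A_s s t) + 2 * r s * (p s)\<^sup>2 * (A s t * A_s s t) + Y_low_s s t)"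
    by (intro trig_deg_intros trig_degI[OF trig_lead_power[OF lead_A]] trig_deg_mono[OF deg_Y_low_s]
      trig_degI[OF trig_lead_mult[OF trig_lead_power[OF lead_A] lead_A_s]]
      trig_degI[OF trig_lead_mult[OF lead_A lead_A_s]]) auto
  from trig_lead_add[OF trig_lead_add[OF trig_lead_cmult[OF trig_lead_power[OF lead_A, of 4], of "12 * (r s)\<^sup>2 * u s"]
    trig_lead_cong[OF trig_lead_cmult[OF trig_lead_mult[OF trig_lead_power[OF lead_A, of 3] lead_A_s], of "16 * r s ^ 3"],
      of "4 * 1", OF _ refl refl]]
    trig_deg_lower[OF this, of "4 * 1"]] show ?thesis
    unfolding Y_s_def q3_def q2_def by (rule trig_lead_cong) (auto simp: algebra_simps)
qed

text \<open>The terms of degree six cancel, since \<open>Y\<close> and \<open>W\<^sup>2\<close> both have degree four; the second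
  coefficients of \<open>Y\<close> and \<open>W\<close> decide the degree five.\<close>
lemma lead_Y_W:
  "trig_lead 5 ((6 * \<i> * (r s)\<^sup>2 * p s * w2 s - 8 * r s ^ 3 * (\<i> * w1 s + w3 s)) * (\<kappa> s / 2) ^ 5)
     (\<lambda>t. Y_t s t * W s t - 2 * Y s t * W_t s t)"
proof -
  \<comment> \<open>Everything but the two highest terms of \<open>Y\<close> and the highest term of \<open>W\<close> is of low degree.\<close>
  define R R_t where "R = (\<lambda>t. r s * (p s)\<^sup>2 * (A s t)\<^sup>2 + Y_low s t)"
    and "R_t = (\<lambda>t. 2 * r s * (p s)\<^sup>2 * (A s t * A_t s t) + Y_low_t s t)"
  define c where "c = complex_of_real (\<kappa> s) / 2"
  have R: "trig_deg 2 R" unfolding R_def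
    by (intro trig_deg_intros trig_degI[OF trig_lead_power[OF lead_A]] trig_deg_mono[OF deg_Y_low]) auto
  have R_t: "trig_deg 2 R_t" unfolding R_t_def
    by (intro trig_deg_intros trig_degI[OF trig_lead_mult[OF lead_A lead_A_t]] trig_deg_mono[OF deg_Y_low_t]) auto
  have low: "trig_deg 4 (\<lambda>t. 18 * (r s)\<^sup>2 * p s * ((A s t)\<^sup>2 * A_t s t * V s t)
     - 12 * (r s)\<^sup>2 * p s * (A s t ^ 3 * V_t s t) + (R_t t * W s t - 2 * (R t * W_t s t)))"
    by (intro trig_deg_intros trig_degI[OF trig_lead_mult[OF trig_lead_mult[OF trig_lead_power[OF lead_A] lead_A_t] lead_V]]
      trig_degI[OF trig_lead_mult[OF trig_lead_power[OF lead_A] lead_V_t]]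
      trig_deg_mult[OF R_t trig_degI[OF lead_W order.refl]] trig_deg_mult[OF R deg_W_t]) auto
  have 1: "trig_lead 5 (c^3 * (- \<i> * c) * ((w1 s - \<i> * w3 s) * c)) (\<lambda>t. A s t ^ 3 * A_t s t * V s t)"
    by (rule trig_lead_cong[OF trig_lead_mult[OF trig_lead_mult[OF trig_lead_power[OF lead_A] lead_A_t] lead_V]])
      (auto simp: c_def)
  have 2: "trig_lead 5 (c^4 * (- (\<i> * w1 s + w3 s) * c)) (\<lambda>t. A s t ^ 4 * V_t s t)"
    by (rule trig_lead_cong[OF trig_lead_mult[OF trig_lead_power[OF lead_A] lead_V_t]]) (auto simp: c_def)
  have 3: "trig_lead 5 (c^4 * (- \<i> * c)) (\<lambda>t. A s t ^ 4 * A_t s t)"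
    by (rule trig_lead_cong[OF trig_lead_mult[OF trig_lead_power[OF lead_A] lead_A_t]]) (auto simp: c_def)
  show ?thesis
    by (rule trig_lead_cong[OF trig_lead_add[OF trig_lead_diff[OF trig_lead_diff[OF trig_lead_cmult[OF 1, of "16 * r s ^ 3"] 
       trig_lead_cmult[OF 2, of "8 * r s ^ 3"]] trig_lead_cmult[OF 3, of "6 * (r s)\<^sup>2 * p s * w2 s"]] trig_deg_lower[OF low, of 5]]])
      (auto simp: R_def R_t_def Y_def Y_t_def W_def W_t_def c_def algebra_simps eval_nat_numeral)
qed

text \<open>Both summands of the Jacobi function now reach degree seven. The real part of the coefficient is
  a multiple of \<open>\<tau>\<close>, which comes from the sine terms; the imaginary part is a differential equation of
  second order for the radius.\<close>
lemma jacobi_W_imp: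
  assumes s: "s \<in> I" and "t1 < t2" and u: "u s \<noteq> 0"
    and zero: "\<And>t. t1 < t \<Longrightarrow> t < t2 \<Longrightarrow> jacobi Y Y_s Y_t W W_s W_t s t = 0"
  shows "\<tau> s = 0" "r s * a s * (3 * (u s)\<^sup>2 - 1) = p s * (u s)\<^sup>2"
proof -
  define c where "c = complex_of_real (\<kappa> s) / 2"
  have c: "c \<noteq> 0" using \<kappa>_nonzero[OF s] by (simp add: c_def)
  note r = r_pos[OF s] and p = p_nonzero[OF s]
  define d where "d = complex_of_real (\<kappa>' s) / 2"
  have 1: "trig_lead 6 ((4 * r s ^ 3 * u s * w2 s - 8 * r s ^ 4 * w2' s) * c ^ 6) (\<lambda>t. r s * (Y_s s t * W s t) - 2 * r s * (Y s t * W_s s t) - 2 * u s * (Y s t * W s t))"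
    by (rule trig_lead_cong[OF trig_lead_diff[OF trig_lead_diff[OF
        trig_lead_cmult[OF trig_lead_mult[OF lead_Y_s lead_W], of "r s"] 
        trig_lead_cmult[OF trig_lead_mult[OF lead_Y lead_W_s], of "2 * r s"]]
        trig_lead_cmult[OF trig_lead_mult[OF lead_Y lead_W], of "2 * u s"]]])
      (auto simp: c_def field_simps eval_nat_numeral)
  have "trig_lead 7 ((2 * u s * (r s)\<^sup>2 * (6 * \<i> * (r s)\<^sup>2 * p s * w2 s - 8 * r s ^ 3 * (\<i> * w1 s + w3 s))
      - \<i> * r s * p s * (4 * r s ^ 3 * u s * w2 s - 8 * r s ^ 4 * w2' s)) * c ^ 7) (jacobi Y Y_s Y_t W W_s W_t s)"
    unfolding jacobi_def
    by (rule trig_lead_cong[OF trig_lead_add[OF 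
       trig_lead_cong[OF trig_lead_mult[OF lead_h lead_Y_W], of 7, OF _ refl refl]
       trig_lead_cong[OF trig_lead_cmult[OF trig_lead_mult[OF lead_A_t 1], of "r s * p s"], of 7, OF _ refl refl]]])
      (auto simp: c_def field_simps eval_nat_numeral)
  from trig_lead_zero[OF this zero \<open>t1 < t2\<close>] c
  have eq: "2 * u s * (r s)\<^sup>2 * (6 * \<i> * (r s)\<^sup>2 * p s * w2 s - 8 * r s ^ 3 * (\<i> * w1 s + w3 s))
      - \<i> * r s * p s * (4 * r s ^ 3 * u s * w2 s - 8 * r s ^ 4 * w2' s) = 0" by simp
  have "Re (2 * u s * (r s)\<^sup>2 * (6 * \<i> * (r s)\<^sup>2 * p s * w2 s - 8 * r s ^ 3 * (\<i> * w1 s + w3 s))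
      - \<i> * r s * p s * (4 * r s ^ 3 * u s * w2 s - 8 * r s ^ 4 * w2' s)) = - 16 * u s * r s ^ 5 * w3 s"
    by (simp flip: of_real_power add: eval_nat_numeral)
  then have "w3 s = 0" unfolding eq using u r by simp
  then show "\<tau> s = 0" using u r p by (simp add: w3_def c3_def)
  have "Im (2 * u s * (r s)\<^sup>2 * (6 * \<i> * (r s)\<^sup>2 * p s * w2 s - 8 * r s ^ 3 * (\<i> * w1 s + w3 s))
      - \<i> * r s * p s * (4 * r s ^ 3 * u s * w2 s - 8 * r s ^ 4 * w2' s))
     = 16 * r s ^ 5 * u s * (p s * (1 - 2 * (u s)\<^sup>2) - 2 * r s * (p s)\<^sup>2 * a s - w1 s)"
    by (simp flip: of_real_power add: w2_def w2'_def algebra_simps eval_nat_numeral)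
  then have "p s * (1 - 2 * (u s)\<^sup>2) - 2 * r s * (p s)\<^sup>2 * a s - w1 s = 0"
    unfolding eq using u r by simp
  moreover have "(p s)\<^sup>2 = 1 - (u s)\<^sup>2" using u_p[OF s] by simp
  ultimately show "r s * a s * (3 * (u s)\<^sup>2 - 1) = p s * (u s)\<^sup>2"
    by (simp add: w1_def algebra_simps)
qed

end

section \<open>Planar center curves\<close>

lemma infinite_cos_interval:
  fixes t1 t2 :: real
  assumes "t1 < t2"
  shows "infinite {cos t |t. t1 < t \<and> t < t2 \<and> sin t \<noteq> 0}"
proof
  assume fin: "finite {cos t |t. t1 < t \<and> t < t2 \<and> sin t \<noteq> 0}"
  have "finite (cos ` {t1<..<t2})"
  proof (rule finite_subset)
    show "cos ` {t1<..<t2} \<subseteq> {cos t |t. t1 < t \<and> t < t2 \<and> sin t \<noteq> 0} \<union> {1, -1}"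
    proof
      fix x assume "x \<in> cos ` {t1<..<t2}"
      then obtain t where "t1 < t" "t < t2" "x = cos t" by auto
      then show "x \<in> {cos t |t. t1 < t \<and> t < t2 \<and> sin t \<noteq> 0} \<union> {1, -1}"
        using sin_zero_abs_cos_one[of t] by (cases "sin t = 0") (auto simp: abs_if split: if_splits)
    qed
  qed (use fin in auto)
  then have "cos constant_on {t1<..<t2}"
    by (intro continuous_finite_range_constant) (auto intro: continuous_intros)
  then obtain c :: real where c: "\<And>t. t \<in> {t1<..<t2} \<Longrightarrow> cos t = c" unfolding constant_on_def by blast
  have sin0: "sin t = 0" if "t \<in> {t1<..<t2}" for t :: real
  proof -
    have "(cos has_real_derivative 0) (at t)"
      by (rule has_field_derivative_transform_within_open[OF DERIV_const[of c], where S = "{t1<..<t2}"])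
        (use that c in auto)
    then show ?thesis using DERIV_cos[of t] DERIV_unique by fastforce
  qed
  define t where "t = (t1 + t2) / 2"
  have "t \<in> {t1<..<t2}" using assms by (auto simp: t_def)
  have "(sin has_real_derivative 0) (at t)"
    by (rule has_field_derivative_transform_within_open[OF DERIV_const[of 0], where S = "{t1<..<t2}"])
      (use \<open>t \<in> _\<close> sin0 in auto)
  then have "cos t = 0" using DERIV_sin[of t] DERIV_unique by fastforce
  then show False using sin0[OF \<open>t \<in> _\<close>] sin_cos_squared_add[of t] by simp
qed

context canal_coefficients
begin

lemma infinite_A:
  assumes s: "s \<in> I" and "t1 < t2"
  shows "infinite {A s t |t. t1 < t \<and> t < t2 \<and> A_t s t \<noteq> 0}"
proof -
  have "{A s t |t. t1 < t \<and> t < t2 \<and> A_t s t \<noteq> 0} =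
     (\<lambda>x. \<kappa> s * x - a s) ` {cos t |t. t1 < t \<and> t < t2 \<and> sin t \<noteq> 0}"
    using \<kappa>_nonzero[OF s] by (auto simp: A_def A_t_def)
  moreover have "inj_on (\<lambda>x. \<kappa> s * x - a s) S" for S using \<kappa>_nonzero[OF s] by (auto simp: inj_on_def)
  ultimately show ?thesis using infinite_cos_interval[OF \<open>t1 < t2\<close>] by (simp add: finite_image_iff)
qed

text \<open>For \<open>\<tau> = 0\<close> the Jacobi function is \<open>A\<^sub>t\<close> times a polynomial \<open>G\<close> of degree six in \<open>A\<close>, and \<open>A\<close> takes
  infinitely many values. The coefficient of degree six restates the equation for the radius that is
  assumed here; those of degree five and four are the two conclusions, the first one modulo that
  equation and the second one modulo both.\<close>
lemma jacobi_W_planar_imp: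
  assumes s: "s \<in> I" and "t1 < t2" and u: "u s \<noteq> 0"
    and \<tau>: "\<tau> s = 0" "\<tau>' s = 0" and b: "r s * a s * (3 * (u s)\<^sup>2 - 1) = p s * (u s)\<^sup>2"
    and zero: "\<And>t. t1 < t \<Longrightarrow> t < t2 \<Longrightarrow> jacobi Y Y_s Y_t W W_s W_t s t = 0"
  shows "r s * (w1' s * p s + w1 s * u s * a s) = u s * (4 * w0 s * r s + w1 s * p s
           - (p s)\<^sup>2 * (1 - 2 * (u s)\<^sup>2) / 2)" (is ?th1)
    and "2 * r s * ((w0' s * r s + w0 s * u s) * p s + 2 * w0 s * r s * u s * a s) =
      u s * (8 * w0 s * r s * p s + w1 s * (p s)\<^sup>2 - 3/4 * (1 - 2 * (u s)\<^sup>2) * (p s)^3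
        - 3/2 * (c1 s + c2 s * \<kappa>' s / \<kappa> s) * (1 - 2 * (u s)\<^sup>2))" (is ?th2)
proof -
  note r = r_pos[OF s] and p = p_nonzero[OF s] and \<kappa> = \<kappa>_nonzero[OF s]
  have p2: "(p s)\<^sup>2 = 1 - (u s)\<^sup>2" using u_p[OF s] by simp
  define q where "q = \<kappa>' s / \<kappa> s"
  define q2 where "q2 = \<kappa>'' s / \<kappa> s"
  have \<kappa>': "\<kappa>' s = q * \<kappa> s" "\<kappa>'' s = q2 * \<kappa> s" using \<kappa> by (auto simp: q_def q2_def)
  define y4 y3 y2 y1 y0 where "y4 = 4 * r s ^ 3" and "y3 = 6 * (r s)\<^sup>2 * p s" and "y2 = r s * (p s)\<^sup>2"
    and "y1 = c1 s + c2 s * q" and "y0 = c0 s + c2 s * (q * a s - a' s)"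
  define y4' y3' y2' y1' y0' where "y4' = 12 * (r s)\<^sup>2 * u s"
    and "y3' = 12 * r s * u s * p s - 6 * (r s)\<^sup>2 * u s * a s"
    and "y2' = u s * (p s)\<^sup>2 - 2 * r s * p s * u s * a s"
    and "y1' = c1' s + c2' s * q + c2 s * q2 - c2 s * q * q"
    and "y0' = c0' s + c2' s * (q * a s - a' s) + c2 s * (q2 * a s - a'' s) - c2 s * q * (q * a s - a' s)"
  define h2 h1 h0 where "h2 = 2 * u s * (r s)\<^sup>2" and "h1 = u s * (2 * p s * r s - (r s)\<^sup>2 * a s)"
    and "h0 = u s * (p s)\<^sup>2"
  define Yp Yd Wp Wd hp where "Yp = [:y0, y1, y2, y3, y4:]" and "Yd = [:y0', y1', y2', y3', y4':]"
    and "Wp = [:w0 s, w1 s, w2 s:]" and "Wd = [:w0' s, w1' s, w2' s:]" and "hp = [:h0, h1, h2:]"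
  define G where "G = hp * (pderiv Yp * Wp - smult 2 (Yp * pderiv Wp)) +
     smult (r s * p s) (smult (r s) (Yd * Wp) - smult (2 * r s) (Yp * Wd) - smult (2 * u s) (Yp * Wp))"
  have c3: "c3 s = 0" "c3' s = 0" "w3 s = 0" "w3' s = 0"
    using \<tau> by (auto simp: c3_def c3'_def w3_def w3'_def)
  have "poly G x = 0" if "x \<in> {A s t |t. t1 < t \<and> t < t2 \<and> A_t s t \<noteq> 0}" for x
  proof -
    obtain t where t: "t1 < t" "t < t2" "A_t s t \<noteq> 0" and x: "x = A s t" using \<open>x \<in> _\<close> by blast
    have As: "A_s s t = q * (A s t + a s) - a' s" and Ass: "A_ss s t = q2 * (A s t + a s) - a'' s"
      and Ast: "A_st s t = q * A_t s t"
      by (simp_all add: A_s_def A_def A_ss_def A_st_def A_t_def \<kappa>')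
    have Yl: "Y_low s t = y1 * A s t + y0" "Y_low_t s t = y1 * A_t s t"
      "Y_low_s s t = y1' * A s t + y0' + y1 * A_s s t"
      unfolding Y_low_def Y_low_t_def Y_low_s_def y1_def y0_def y1'_def y0'_def c3 As Ass Ast
      by (simp_all add: algebra_simps)
    have Ws: "W s t = poly Wp x" "W_t s t = poly (pderiv Wp) x * A_t s t"
      "W_s s t = poly Wd x + poly (pderiv Wp) x * A_s s t"
      unfolding W_def V_def W_t_def V_t_def W_s_def c3 x Wp_def Wd_def
      by (simp_all add: pderiv_pCons algebra_simps power2_eq_square)
    have Ys: "Y s t = poly Yp x" "Y_t s t = poly (pderiv Yp) x * A_t s t"
      "Y_s s t = poly Yd x + poly (pderiv Yp) x * A_s s t"
      unfolding Y_def Y_t_def Y_s_def Yl x Yp_def Yd_def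
      by (simp_all add: pderiv_pCons y4_def y3_def y2_def y4'_def y3'_def y2'_def algebra_simps eval_nat_numeral)
    have h: "h s t = poly hp x - (r s)^2*p s*A_s s t"
      unfolding h_def P_def P_s_def hp_def h2_def h1_def h0_def x by (simp add: algebra_simps power2_eq_square)
    have "A_t s t * poly G x = jacobi Y Y_s Y_t W W_s W_t s t"
      unfolding jacobi_def Ys Ws h G_def by (simp add: algebra_simps power2_eq_square)
    then show ?thesis using zero[OF t(1,2)] t(3) by simp
  qed
  then have "{A s t |t. t1 < t \<and> t < t2 \<and> A_t s t \<noteq> 0} \<subseteq> {x. poly G x = 0}" by blast
  then have "G = 0" using infinite_A[OF s \<open>t1 < t2\<close>] poly_roots_finite finite_subset by blast
  define E5 where "E5 = h2*(4*y4*w0 s + y3*w1 s - 2*y2*w2 s) + h1*(2*y4*w1 s - y3*w2 s)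
         + r s*p s*(r s*(y4'*w1 s + y3'*w2 s) - 2*r s*(y4*w1' s + y3*w2' s) - 2*u s*(y4*w1 s + y3*w2 s))"
  define E4 where "E4 = h2*(3*y3*w0 s - 3*y1*w2 s) + h1*(4*y4*w0 s + y3*w1 s - 2*y2*w2 s) + h0*(2*y4*w1 s - y3*w2 s)
         + r s*p s*(r s*(y4'*w0 s + y3'*w1 s + y2'*w2 s) - 2*r s*(y4*w0' s + y3*w1' s + y2*w2' s) 
           - 2*u s*(y4*w0 s + y3*w1 s + y2*w2 s))"
  have "coeff G 5 = E5" "coeff G 4 = E4"
    unfolding G_def Yp_def Yd_def Wp_def Wd_def hp_def E5_def E4_def
    by (simp_all add: pderiv_pCons eval_nat_numeral algebra_simps)
  then have E54: "E5 = 0" "E4 = 0" using \<open>G = 0\<close> by auto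
  define bb where "bb = r s * a s * (3 * (u s)\<^sup>2 - 1) - p s * (u s)\<^sup>2"
  define G5 where "G5 = r s * (w1' s * p s + w1 s * u s * a s) - u s * (4 * w0 s * r s + w1 s * p s
           - (p s)\<^sup>2 * (1 - 2 * (u s)\<^sup>2) / 2)"
  define G4 where "G4 = 2 * r s * ((w0' s * r s + w0 s * u s) * p s + 2 * w0 s * r s * u s * a s) -
      u s * (8 * w0 s * r s * p s + w1 s * (p s)\<^sup>2 - 3/4 * (1 - 2 * (u s)\<^sup>2) * (p s)^3
        - 3/2 * (c1 s + c2 s * q) * (1 - 2 * (u s)\<^sup>2))"
  have bb0: "bb = 0" using b by (simp add: bb_def)
  note defs = y4_def y3_def y2_def y4'_def y3'_def y2'_def h2_def h1_def h0_def
    w0_def w1_def w2_def w0'_def w1'_def w2'_def \<tau>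
  have p2': "p s * p s = 1 - u s * u s" "\<And>x. p s * (p s * x) = (1 - u s * u s) * x"
    using p2 by (simp_all add: power2_eq_square flip: mult.assoc)
  \<comment> \<open>The difference to the claim is a multiple of the equation \<open>b\<close> for the radius.\<close>
  have "E5 = - 8 * r s ^ 4 * G5 - 48 * r s ^ 4 * u s * p s * bb"
    unfolding E5_def G5_def bb_def defs
    by (simp add: field_simps eval_nat_numeral p2')
  then have G5: "G5 = 0" using E54 bb0 r by simp
  then show ?th1 by (simp add: G5_def)
  have "r s * E4 = 3/2 * p s * E5 - 4 * r s ^ 4 * G4 + 64 * r s ^ 4 * u s * (p s)\<^sup>2 * bb"
    unfolding E4_def E5_def G4_def bb_def defs y1_def \<kappa>'
    by (simp add: field_simps eval_nat_numeral p2')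
  then have "G4 = 0" using E54 bb0 r by simp
  then show ?th2 by (simp add: G4_def q_def)
qed

end

text \<open>The first conclusion of \<open>jacobi_W_planar_imp\<close>, solved for \<open>w0\<close>: the equations for \<open>a\<close> and \<open>w1\<close> and
  the derivative of the latter make it an explicit function of \<open>u\<^sup>2\<close>.\<close>
lemma planar_w0:
  fixes u r p a w0 w1 w1' :: real
  assumes nz: "r \<noteq> 0" "p \<noteq> 0" "u \<noteq> 0" and p2: "p\<^sup>2 = 1 - u\<^sup>2"
    and b: "r * a * (3 * u\<^sup>2 - 1) = p * u\<^sup>2"
    and w1: "w1 * (3 * u\<^sup>2 - 1) = p * (3 * u\<^sup>2 - 1 - 4 * u^4)"
    and w1': "w1' * (3 * u\<^sup>2 - 1) + w1 * (6 * u * p * a) =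
      - u * a * (3 * u\<^sup>2 - 1 - 4 * u^4) + p * (6 * u * p * a - 16 * u^3 * p * a)"
    and th: "r * (w1' * p + w1 * u * a) = u * (4 * w0 * r + w1 * p - p\<^sup>2 * (1 - 2 * u\<^sup>2) / 2)"
  shows "w0 * r * (8 * (3 * u\<^sup>2 - 1)^3) = p\<^sup>2 * (66*u^8 - 101*u^6 + 49*u^4 - 7*u^2 + 1)"
proof -
  define B N where "B = 3 * u\<^sup>2 - 1" and "N = B - 4 * u^4"
  have B: "B \<noteq> 0" using b nz by (auto simp: B_def)
  have w1p: "w1 * p * B = p\<^sup>2 * N" using w1 by (simp add: B_def N_def power2_eq_square)
  have \<theta>: "r * p * a * B = p\<^sup>2 * u\<^sup>2"
  proof -
    have "r * p * a * B = p * (r * a * (3 * u\<^sup>2 - 1))" by (simp add: B_def)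
    then show ?thesis unfolding b by (simp add: power2_eq_square)
  qed
  have w1'': "w1' * B = - u * a * N + p * (6 * u * p * a - 16 * u^3 * p * a) - w1 * (6 * u * p * a)"
    using w1' by (simp add: B_def N_def)
  have "u * (B * (4 * w0 * r + w1 * p - p\<^sup>2 * (1 - 2 * u\<^sup>2) / 2)) = B * (r * (w1' * p + w1 * u * a))"
    unfolding th by simp
  also have "\<dots> = r * p * (w1' * B) + r * u * a * (w1 * p * B) / p"
    using nz by (simp add: field_simps)
  also have "\<dots> = u * (r * p * a * (6 * p\<^sup>2 - 16 * u\<^sup>2 * p\<^sup>2 - 6 * (w1 * p)))"
    unfolding w1'' w1p using nz by (simp add: field_simps eval_nat_numeral)
  finally have "B * (4 * w0 * r + w1 * p - p\<^sup>2 * (1 - 2 * u\<^sup>2) / 2) = r * p * a * (6 * p\<^sup>2 - 16 * u\<^sup>2 * p\<^sup>2 - 6 * (w1 * p))"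
    using nz by simp
  then have "B * B * (B * (4 * w0 * r + w1 * p - p\<^sup>2 * (1 - 2 * u\<^sup>2) / 2)) =
     B * B * (r * p * a * (6 * p\<^sup>2 - 16 * u\<^sup>2 * p\<^sup>2 - 6 * (w1 * p)))" by simp
  then have "4 * w0 * r * B^3 + (w1 * p * B) * B^2 - p\<^sup>2 * (1 - 2 * u\<^sup>2) / 2 * B^3 =
     (r * p * a * B) * (6 * p\<^sup>2 * B - 16 * u\<^sup>2 * p\<^sup>2 * B - 6 * (w1 * p * B))"
    by (simp add: algebra_simps eval_nat_numeral)
  then have "8 * w0 * r * B^3 = p\<^sup>2 * (2 * u\<^sup>2 * p\<^sup>2 * (6 * B - 16 * u\<^sup>2 * B - 6 * N) - 2 * B^2 * N + B^3 * (1 - 2 * u\<^sup>2))"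
    unfolding w1p \<theta> by (simp add: field_simps)
  also have "2 * u\<^sup>2 * p\<^sup>2 * (6 * B - 16 * u\<^sup>2 * B - 6 * N) - 2 * B^2 * N + B^3 * (1 - 2 * u\<^sup>2)
     = 66*u^8 - 101*u^6 + 49*u^4 - 7*u^2 + 1"
    unfolding p2 B_def N_def by algebra
  finally show ?thesis by (simp add: B_def algebra_simps)
qed

text \<open>With \<open>U = u\<^sup>2\<close>, all quantities are functions of \<open>U\<close>: \<open>r a p\<close>, \<open>w0 r / p\<^sup>2\<close> and \<open>r\<^sup>2 \<kappa>\<^sup>2 / p\<^sup>2\<close> by the
  first equations, their derivatives by differentiating these. The last hypothesis then becomes an
  algebraic equation for \<open>U\<close>. The constant term of this equation is nonzero, so \<open>U\<close> takes finitely
  many values only.\<close>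
lemma planar_elimination:
  fixes u r p a \<kappa> w0 w0' w1 q :: real
  defines "U \<equiv> u\<^sup>2"
  assumes nz: "r \<noteq> 0" "p \<noteq> 0" "u \<noteq> 0" "\<kappa> \<noteq> 0" and p2: "p\<^sup>2 = 1 - U"
    and b: "r * a * (3 * U - 1) = p * U"
    and w1: "w1 * (3 * U - 1) = p * (3 * U - 1 - 4 * U\<^sup>2)"
    and w0: "w0 * r * (8 * (3 * U - 1)^3) = p\<^sup>2 * (66*U^4 - 101*U^3 + 49*U^2 - 7*U + 1)"
    and w0': "(w0' * r + w0 * u) * (8 * (3 * U - 1)^3) + w0 * r * (144 * u * p * a * (3 * U - 1)^2) =
       - 2 * p * u * a * (66*U^4 - 101*U^3 + 49*U^2 - 7*U + 1)
       + p\<^sup>2 * (264*U^3 - 303*U^2 + 98*U - 7) * (2 * u * p * a)"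
    and \<kappa>: "16 * U * (3 * U - 1)^3 * (r\<^sup>2 * \<kappa>\<^sup>2) = p\<^sup>2 * (114*U^4 - 117*U^3 + 49*U^2 - 7*U + 1)"
    and \<kappa>': "(32 * u * p * a * (3 * U - 1)^3 + 288 * U * (3 * U - 1)^2 * u * p * a) * (r\<^sup>2 * \<kappa>\<^sup>2)
       + 16 * U * (3 * U - 1)^3 * (2 * r * u * \<kappa>\<^sup>2 + 2 * r\<^sup>2 * \<kappa>\<^sup>2 * q) =
       - 2 * p * u * a * (114*U^4 - 117*U^3 + 49*U^2 - 7*U + 1)
       + p\<^sup>2 * (456*U^3 - 351*U^2 + 98*U - 7) * (2 * u * p * a)"
    and th: "2 * r * ((w0' * r + w0 * u) * p + 2 * w0 * r * u * a) =
      u * (8 * w0 * r * p + w1 * p\<^sup>2 - 3/4 * (1 - 2 * U) * p^3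
        - 3/2 * (U * p - r * a * (2 * p\<^sup>2 - U) + r * u * p * q) * (1 - 2 * U))"
  shows "112860*U^10 - 459360*U^9 + 728073*U^8 - 636054*U^7 + 344778*U^6 - 119934*U^5 + 27204*U^4
    - 4194*U^3 + 522*U^2 - 42*U + 3 = 0"
proof -
  define B \<Gamma> \<Gamma>' \<Psi> \<Psi>' where "B = 3 * U - 1" and "\<Gamma> = 66*U^4 - 101*U^3 + 49*U^2 - 7*U + 1"
    and "\<Gamma>' = 264*U^3 - 303*U^2 + 98*U - 7" and "\<Psi> = 114*U^4 - 117*U^3 + 49*U^2 - 7*U + 1"
    and "\<Psi>' = 456*U^3 - 351*U^2 + 98*U - 7"
  note fold = B_def[symmetric] \<Gamma>_def[symmetric] \<Gamma>'_def[symmetric] \<Psi>_def[symmetric] \<Psi>'_def[symmetric]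
  have U: "U \<noteq> 0" "U = u\<^sup>2" "u * u = U" using nz by (auto simp: U_def power2_eq_square)
  have B: "B \<noteq> 0" using b U nz by (auto simp: B_def)
  \<comment> \<open>Half the derivative of \<open>U\<close> with respect to \<open>ln r\<close>, the natural variable here.\<close>
  define \<theta> where "\<theta> = r * p * a"
  have \<theta>: "\<theta> = U * p\<^sup>2 / B"
  proof -
    have "\<theta> * B = p * (r * a * (3 * U - 1))" by (simp add: \<theta>_def B_def)
    also have "\<dots> = U * p\<^sup>2" unfolding b by (simp add: power2_eq_square)
    finally show ?thesis using B by (simp add: field_simps)
  qed
  have ra: "r * a = p * U / B" using b B by (simp add: B_def field_simps)
  \<comment> \<open>The derivative of \<open>w0 r\<close> with respect to \<open>ln r\<close>.\<close>
  define M where "M = r * (w0' * r + w0 * u) / u"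
  define m where "m = w0 * r"
  have m: "m = p\<^sup>2 * \<Gamma> / (8 * B^3)" using w0 B unfolding fold m_def by (simp add: field_simps)
  have "8 * B^3 * M + 144 * B\<^sup>2 * \<theta> * m = 2 * \<theta> * (p\<^sup>2 * \<Gamma>' - \<Gamma>)"
  proof -
    have "u * (8 * B^3 * M + 144 * B\<^sup>2 * \<theta> * m) =
      r * ((w0' * r + w0 * u) * (8 * B^3) + w0 * r * (144 * u * p * a * B\<^sup>2))"
      using nz by (simp add: M_def m_def \<theta>_def field_simps)
    also have "\<dots> = u * (2 * \<theta> * (p\<^sup>2 * \<Gamma>' - \<Gamma>))"
      unfolding w0'[unfolded fold] \<theta>_def by (simp add: algebra_simps)
    finally show ?thesis using nz by simp
  qed
  then have M: "M = (2 * \<theta> * (p\<^sup>2 * \<Gamma>' - \<Gamma>) - 18 * \<theta> * p\<^sup>2 * \<Gamma> / B) / (8 * B^3)"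
    using B unfolding m by (simp add: field_simps power2_eq_square power3_eq_cube)
  define X where "X = r\<^sup>2 * \<kappa>\<^sup>2"
  \<comment> \<open>The derivative of \<open>ln \<kappa>\<close> with respect to \<open>ln r\<close>.\<close>
  define \<xi> where "\<xi> = r * q / u"
  have X: "16 * U * B^3 * X = p\<^sup>2 * \<Psi>" using \<kappa> unfolding fold X_def .
  have \<Psi>: "\<Psi> \<noteq> 0" using X U B nz by (auto simp: X_def)
  have "(32 * \<theta> * B^3 + 288 * U * B\<^sup>2 * \<theta>) * X + 32 * U * B^3 * X * (1 + \<xi>) =
     2 * \<theta> * (p\<^sup>2 * \<Psi>' - \<Psi>)"
  proof -
    have "u * ((32 * \<theta> * B^3 + 288 * U * B\<^sup>2 * \<theta>) * X + 32 * U * B^3 * X * (1 + \<xi>)) =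
      r * ((32 * u * p * a * B^3 + 288 * U * B\<^sup>2 * u * p * a) * (r\<^sup>2 * \<kappa>\<^sup>2)
        + 16 * U * B^3 * (2 * r * u * \<kappa>\<^sup>2 + 2 * r\<^sup>2 * \<kappa>\<^sup>2 * q))"
      using nz by (simp add: X_def \<xi>_def \<theta>_def field_simps power2_eq_square)
    also have "\<dots> = u * (2 * \<theta> * (p\<^sup>2 * \<Psi>' - \<Psi>))"
      unfolding \<kappa>'[unfolded fold] \<theta>_def by (simp add: algebra_simps)
    finally show ?thesis using nz by simp
  qed
  moreover have "(32 * \<theta> * B^3 + 288 * U * B\<^sup>2 * \<theta>) * X + 32 * U * B^3 * X * (1 + \<xi>) =
      16 * U * B^3 * X * (2 * \<theta> / U + 18 * \<theta> / B + 2 * (1 + \<xi>))"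
    using U(1) B by (simp add: field_simps power2_eq_square power3_eq_cube)
  ultimately have "p\<^sup>2 * \<Psi> * (2 * \<theta> / U + 18 * \<theta> / B + 2 * (1 + \<xi>)) = 2 * \<theta> * (p\<^sup>2 * \<Psi>' - \<Psi>)"
    unfolding X by simp
  then have "\<Psi> * (p\<^sup>2 / B + 9 * U * p\<^sup>2 / B\<^sup>2 + 1 + \<xi>) = U / B * (p\<^sup>2 * \<Psi>' - \<Psi>)"
  proof -
    assume asm: "p\<^sup>2 * \<Psi> * (2 * \<theta> / U + 18 * \<theta> / B + 2 * (1 + \<xi>)) = 2 * \<theta> * (p\<^sup>2 * \<Psi>' - \<Psi>)"
    have "2 * p\<^sup>2 * (\<Psi> * (p\<^sup>2 / B + 9 * U * p\<^sup>2 / B\<^sup>2 + 1 + \<xi>)) =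
        p\<^sup>2 * \<Psi> * (2 * \<theta> / U + 18 * \<theta> / B + 2 * (1 + \<xi>))"
      unfolding \<theta> using U(1) B by (simp add: field_simps power2_eq_square)
    also note asm
    also have "2 * \<theta> * (p\<^sup>2 * \<Psi>' - \<Psi>) = 2 * p\<^sup>2 * (U / B * (p\<^sup>2 * \<Psi>' - \<Psi>))"
      unfolding \<theta> by simp
    finally show ?thesis using nz by (simp del: times_divide_eq_left times_divide_eq_right)
  qed
  then have "p\<^sup>2 / B + 9 * U * p\<^sup>2 / B\<^sup>2 + 1 + \<xi> = U / B * (p\<^sup>2 * \<Psi>' - \<Psi>) / \<Psi>"
    using \<Psi> by (metis nonzero_mult_div_cancel_left)
  then have \<xi>: "\<xi> = U / B * (p\<^sup>2 * \<Psi>' - \<Psi>) / \<Psi> - (1 + p\<^sup>2 / B + 9 * U * p\<^sup>2 / B\<^sup>2)"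
    by simp
  have w1': "w1 = p * (B - 4 * U\<^sup>2) / B" using w1 B by (simp add: B_def field_simps)
  have "p * (2 * M + 4 * m * U / B) = p * (8 * m + p\<^sup>2 * (B - 4 * U\<^sup>2) / B - 3/4 * (1 - 2 * U) * p\<^sup>2
     - 3/2 * (U - U / B * (2 * p\<^sup>2 - U) + U * \<xi>) * (1 - 2 * U))"
  proof -
    have "u * (p * (2 * M + 4 * m * U / B)) = 2 * r * (w0' * r + w0 * u) * p + 4 * m * u * (p * U / B)"
      using nz by (simp add: M_def m_def field_simps)
    also have "\<dots> = 2 * r * ((w0' * r + w0 * u) * p + 2 * w0 * r * u * a)"
      unfolding ra[symmetric] m_def by (simp add: algebra_simps)
    also have "\<dots> = u * (8 * m * p + w1 * p\<^sup>2 - 3/4 * (1 - 2 * U) * p^3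
        - 3/2 * (U * p - p * U / B * (2 * p\<^sup>2 - U) + p * (U * \<xi>)) * (1 - 2 * U))"
    proof -
      have "r * u * p * q = p * (U * \<xi>)" using nz by (simp add: \<xi>_def U_def power2_eq_square field_simps)
      then show ?thesis unfolding th ra m_def by simp
    qed
    also have "\<dots> = u * (p * (8 * m + p\<^sup>2 * (B - 4 * U\<^sup>2) / B - 3/4 * (1 - 2 * U) * p\<^sup>2
     - 3/2 * (U - U / B * (2 * p\<^sup>2 - U) + U * \<xi>) * (1 - 2 * U)))"
      unfolding w1' using B by (simp add: field_simps power2_eq_square power3_eq_cube)
    finally show ?thesis by (rule mult_left_cancel[OF nz(3), THEN iffD1])
  qed
  then have "2 * M + 4 * m * U / B = 8 * m + p\<^sup>2 * (B - 4 * U\<^sup>2) / B - 3/4 * (1 - 2 * U) * p\<^sup>2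
     - 3/2 * (U - U / B * (2 * p\<^sup>2 - U) + U * \<xi>) * (1 - 2 * U)"
    by (rule mult_left_cancel[OF nz(2), THEN iffD1])
  then have eq: "8 * m + p\<^sup>2 * (B - 4 * U\<^sup>2) / B - 3/4 * (1 - 2 * U) * p\<^sup>2
     - 3/2 * (U - U / B * (2 * p\<^sup>2 - U) + U * \<xi>) * (1 - 2 * U) - (2 * M + 4 * m * U / B) = 0" by simp
  define Q where "Q = 112860*U^10 - 459360*U^9 + 728073*U^8 - 636054*U^7 + 344778*U^6 - 119934*U^5 + 27204*U^4
    - 4194*U^3 + 522*U^2 - 42*U + 3"
  have "4 * B^5 * \<Psi> * (8 * m + p\<^sup>2 * (B - 4 * U\<^sup>2) / B - 3/4 * (1 - 2 * U) * p\<^sup>2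
     - 3/2 * (U - U / B * (2 * p\<^sup>2 - U) + U * \<xi>) * (1 - 2 * U) - (2 * M + 4 * m * U / B)) =
     4 * (\<Psi> * (B\<^sup>2 * p\<^sup>2 * \<Gamma> + B^4 * p\<^sup>2 * (B - 4 * U\<^sup>2) - 3/4 * (1 - 2 * U) * p\<^sup>2 * B^5
       - U * p\<^sup>2 * (p\<^sup>2 * \<Gamma>' - \<Gamma>) / 2 * B + 9/2 * U * p\<^sup>2 * p\<^sup>2 * \<Gamma> - B * p\<^sup>2 * \<Gamma> * U / 2)
      - 3/2 * (1 - 2 * U) * (\<Psi> * (U * B^5 - U * B^4 * (2 * p\<^sup>2 - U))
        + U * (U * B^4 * (p\<^sup>2 * \<Psi>' - \<Psi>) - \<Psi> * (B^5 + p\<^sup>2 * B^4 + 9 * U * p\<^sup>2 * B^3))))"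
    unfolding m M \<xi> \<theta> using B \<Psi> by (simp add: field_simps eval_nat_numeral)
  also have "\<dots> = (1 - U) * Q"
    unfolding p2 B_def \<Gamma>_def \<Gamma>'_def \<Psi>_def \<Psi>'_def Q_def by algebra
  finally have "(1 - U) * Q = 0" unfolding eq by simp
  moreover have "1 - U \<noteq> 0" using p2 nz by auto
  ultimately show ?thesis by (simp add: Q_def)
qed


context canal_coefficients
begin

text \<open>The equations of the preceding lemmas hold on an interval and may be differentiated. They
  confine \<open>u\<^sup>2\<close> to the roots of a fixed polynomial, so \<open>u\<close> is constant and \<open>a = 0\<close>; but then the
  equation for the radius gives \<open>u = 0\<close>.\<close>
lemma jacobi_W_imp_False:
  assumes S: "open S" "S \<subseteq> I" "connected S" "s0 \<in> S" and u: "\<And>s. s \<in> S \<Longrightarrow> u s \<noteq> 0"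
    and "t1 < t2"
    and zero: "\<And>s t. s \<in> S \<Longrightarrow> t1 < t \<Longrightarrow> t < t2 \<Longrightarrow> jacobi Y Y_s Y_t W W_s W_t s t = 0"
  shows False
proof -
  have I: "s \<in> I" if "s \<in> S" for s using that S by auto
  have uniq: "d = d'" if "s \<in> S" "(f has_real_derivative d) (at s)" "(g has_real_derivative d') (at s)"
    "\<And>x. x \<in> S \<Longrightarrow> f x = g x" for f g :: "real \<Rightarrow> real" and d d' s
    using has_field_derivative_transform_within_open[OF that(2) S(1) that(1,4)] that(3) DERIV_unique by blast
  have \<tau>: "\<tau> s = 0" and b: "r s * a s * (3 * (u s)\<^sup>2 - 1) = p s * (u s)\<^sup>2" if "s \<in> S" for s
    using jacobi_W_imp[OF I[OF that] \<open>t1 < t2\<close> u[OF that] zero[OF that]] by auto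
  have \<tau>': "\<tau>' s = 0" if "s \<in> S" for s
    by (rule uniq[OF that deriv_\<tau>[OF I[OF that]] DERIV_const[of 0]]) (use \<tau> in auto)
  have p2: "(p s)\<^sup>2 = 1 - (u s)\<^sup>2" if "s \<in> S" for s using u_p[OF I[OF that]] by simp
  define B where "B = (\<lambda>s. 3 * (u s)\<^sup>2 - 1)"
  have B: "B s \<noteq> 0" if "s \<in> S" for s
    using b[OF that] p_nonzero[OF I[OF that]] u[OF that] by (auto simp: B_def)
  \<comment> \<open>The next facts are polynomial identities on \<open>S\<close>; each primed one is the derivative of its predecessor.\<close>
  have w1: "w1 s * B s = p s * (B s - 4 * (u s)^4)" if "s \<in> S" for s
  proof -
    have "w1 s * B s = p s * B s - 4 * (u s)\<^sup>2 * (r s * a s * B s)" by (simp add: w1_def algebra_simps)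
    also have "r s * a s * B s = p s * (u s)\<^sup>2" using b[OF that] by (simp add: B_def)
    finally show ?thesis by (simp add: algebra_simps eval_nat_numeral)
  qed
  have w1': "w1' s * B s + w1 s * (6 * u s * p s * a s) = - u s * a s * (B s - 4 * (u s)^4)
      + p s * (6 * u s * p s * a s - 16 * (u s)^3 * p s * a s)" if "s \<in> S" for s
    by (rule uniq[OF that _ _ w1]) (use I[OF that] in \<open>auto intro!: derivative_eq_intros simp: B_def algebra_simps\<close>)
  define \<Gamma> where "\<Gamma> = (\<lambda>s. 66*(u s)^8 - 101*(u s)^6 + 49*(u s)^4 - 7*(u s)^2 + 1)"
  define \<Gamma>' where "\<Gamma>' = (\<lambda>s. 264*(u s)^6 - 303*(u s)^4 + 98*(u s)^2 - 7)"
  have w0: "w0 s * r s * (8 * B s^3) = (p s)\<^sup>2 * \<Gamma> s" if "s \<in> S" for s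
  proof -
    note nz = r_pos[OF I[OF that]] p_nonzero[OF I[OF that]] u[OF that] B[OF that]
    have "r s * (w1' s * p s + w1 s * u s * a s) = u s * (4 * w0 s * r s + w1 s * p s
           - (p s)\<^sup>2 * (1 - 2 * (u s)\<^sup>2) / 2)"
      by (rule jacobi_W_planar_imp[OF I[OF that] \<open>t1 < t2\<close> u[OF that] \<tau>[OF that] \<tau>'[OF that] b[OF that] zero[OF that]])
    from planar_w0[OF _ nz(2,3) p2[OF that] b[OF that] _ _ this] nz w1[OF that] w1'[OF that]
    show ?thesis unfolding B_def \<Gamma>_def by simp
  qed
  have w0': "(w0' s * r s + w0 s * u s) * (8 * B s^3) + w0 s * r s * (144 * u s * p s * a s * (B s)^2) =
       - 2 * p s * u s * a s * \<Gamma> s + (p s)\<^sup>2 * \<Gamma>' s * (2 * u s * p s * a s)" if "s \<in> S" for s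
    by (rule uniq[OF that _ _ w0]) 
       (use I[OF that] in \<open>auto intro!: derivative_eq_intros simp: B_def \<Gamma>_def \<Gamma>'_def algebra_simps eval_nat_numeral\<close>)
  define \<Psi> where "\<Psi> = (\<lambda>s. 114*(u s)^8 - 117*(u s)^6 + 49*(u s)^4 - 7*(u s)^2 + 1)"
  define \<Psi>' where "\<Psi>' = (\<lambda>s. 456*(u s)^6 - 351*(u s)^4 + 98*(u s)^2 - 7)"
  have X: "16 * (u s)\<^sup>2 * (B s)^3 * ((r s)\<^sup>2 * (\<kappa> s)\<^sup>2) = (p s)\<^sup>2 * \<Psi> s" if "s \<in> S" for s
  proof -
    have "16 * (u s)\<^sup>2 * (B s)^3 * ((r s)\<^sup>2 * (\<kappa> s)\<^sup>2) =
        w0 s * r s * (8 * B s^3) + 16 * (u s)\<^sup>2 * B s * (r s * a s * B s)^2"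
      unfolding w0_def \<tau>[OF that] by (simp add: algebra_simps power2_eq_square power3_eq_cube)
    also have "r s * a s * B s = p s * (u s)\<^sup>2" using b[OF that] by (simp add: B_def)
    finally show ?thesis unfolding w0[OF that]
      by (simp add: \<Gamma>_def \<Psi>_def B_def algebra_simps eval_nat_numeral)
  qed
  have X': "(32 * u s * p s * a s * (B s)^3 + 288 * (u s)\<^sup>2 * (B s)^2 * u s * p s * a s) * ((r s)\<^sup>2 * (\<kappa> s)\<^sup>2)
       + 16 * (u s)\<^sup>2 * (B s)^3 * (2 * r s * u s * (\<kappa> s)\<^sup>2 + 2 * (r s)\<^sup>2 * (\<kappa> s)\<^sup>2 * (\<kappa>' s / \<kappa> s)) =
       - 2 * p s * u s * a s * \<Psi> s + (p s)\<^sup>2 * \<Psi>' s * (2 * u s * p s * a s)" if "s \<in> S" for s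
    by (rule uniq[OF that _ _ X]) 
       (use I[OF that] \<kappa>_nonzero[OF I[OF that]] in \<open>auto intro!: derivative_eq_intros simp: B_def \<Psi>_def \<Psi>'_def field_simps eval_nat_numeral\<close>)
  define Q where "Q = [:3, -42, 522, -4194, 27204, -119934, 344778, -636054, 728073, -459360, 112860::real:]"
  have Q: "poly Q ((u s)\<^sup>2) = 0" if "s \<in> S" for s
  proof -
    note nz = r_pos[OF I[OF that]] p_nonzero[OF I[OF that]] u[OF that] \<kappa>_nonzero[OF I[OF that]]
    have pow: "((u s)\<^sup>2)\<^sup>2 = (u s)^4" "((u s)\<^sup>2)^3 = (u s)^6" "((u s)\<^sup>2)^4 = (u s)^8"
      by (simp_all flip: power_mult)
    have "2 * r s * ((w0' s * r s + w0 s * u s) * p s + 2 * w0 s * r s * u s * a s) =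
      u s * (8 * w0 s * r s * p s + w1 s * (p s)\<^sup>2 - 3/4 * (1 - 2 * (u s)\<^sup>2) * (p s)^3
        - 3/2 * (c1 s + c2 s * \<kappa>' s / \<kappa> s) * (1 - 2 * (u s)\<^sup>2))"
      by (rule jacobi_W_planar_imp[OF I[OF that] \<open>t1 < t2\<close> u[OF that] \<tau>[OF that] \<tau>'[OF that] b[OF that] zero[OF that]])
    then have "112860*((u s)\<^sup>2)^10 - 459360*((u s)\<^sup>2)^9 + 728073*((u s)\<^sup>2)^8 - 636054*((u s)\<^sup>2)^7
       + 344778*((u s)\<^sup>2)^6 - 119934*((u s)\<^sup>2)^5 + 27204*((u s)\<^sup>2)^4 - 4194*((u s)\<^sup>2)^3 + 522*((u s)\<^sup>2)^2
       - 42*((u s)\<^sup>2) + 3 = 0"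
      by (intro planar_elimination[of "r s" "p s" "u s" "\<kappa> s" "a s" "w1 s" "w0 s" "w0' s" "\<kappa>' s / \<kappa> s"])
         (use nz p2[OF that] b[OF that] w1[OF that] w0[OF that] w0'[OF that] X[OF that] X'[OF that] in
            \<open>simp_all add: B_def \<Gamma>_def \<Gamma>'_def \<Psi>_def \<Psi>'_def c1_def c2_def pow\<close>)
    then show ?thesis by (simp add: Q_def algebra_simps eval_nat_numeral)
  qed
  have "finite ((\<lambda>s. (u s)\<^sup>2) ` S)"
    by (rule finite_subset[OF _ poly_roots_finite[of Q]]) (use Q in \<open>auto simp: Q_def\<close>)
  moreover have "continuous_on S (\<lambda>s. (u s)\<^sup>2)"
    by (intro continuous_at_imp_continuous_on ballI)
       (auto intro!: continuous_intros DERIV_isCont[OF deriv_u] I)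
  ultimately have "(\<lambda>s. (u s)\<^sup>2) constant_on S" using S(3) by (intro continuous_finite_range_constant) auto
  then obtain c where c: "\<And>s. s \<in> S \<Longrightarrow> (u s)\<^sup>2 = c" unfolding constant_on_def by blast
  have "2 * u s0 * (p s0 * a s0) = 0"
    by (rule uniq[OF S(4) _ DERIV_const[of c] c]) (use I[OF S(4)] in \<open>auto intro!: derivative_eq_intros\<close>)
  then have "a s0 = 0" using u[OF S(4)] p_nonzero[OF I[OF S(4)]] by simp
  then show False using b[OF S(4)] u[OF S(4)] p_nonzero[OF I[OF S(4)]] by simp
qed

end

section \<open>Tubes\<close>

context canal_coefficients
begin

text \<open>For a tube \<open>H\<close> depends on \<open>A\<close> only, and the derivatives along \<open>A\<close> drop out of the Jacobi function.
  What remains is the dependence of \<open>K\<^sub>I\<^sub>I\<close> on \<open>\<kappa>\<^sup>2\<close>.\<close>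
lemma jacobi_Z_tube_imp:
  assumes s: "s \<in> I" and "t1 < t2" and flat: "u s = 0" "a s = 0" "a' s = 0"
    and zero: "\<And>t. t1 < t \<Longrightarrow> t < t2 \<Longrightarrow> jacobi Z Z_s Z_t L L_s L_t s t = 0"
    and nz: "\<And>t. t1 < t \<Longrightarrow> t < t2 \<Longrightarrow> L s t \<noteq> 0"
  shows "\<kappa>' s = 0"
proof -
  have "{A s t |t. t1 < t \<and> t < t2 \<and> A_t s t \<noteq> 0} \<noteq> {}"
    using infinite_A[OF s \<open>t1 < t2\<close>] by (metis finite.emptyI)
  then obtain t where t: "t1 < t" "t < t2" "A_t s t \<noteq> 0" by blast
  have "jacobi Z Z_s Z_t L L_s L_t s t = 2 * r s ^ 3 * (p s)^3 * A_t s t * (\<kappa> s * \<kappa>' s) * L s t"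
    unfolding jacobi_def h_def P_s_def Z_def Z_s_def Z_t_def Y_low_def Y_low_s_def Y_low_t_def L_s_def L_t_def
      c0_def c0'_def c1_def c1'_def c2_def c2'_def c3_def c3'_def flat
    by (simp add: P_s_def P_def L_def flat algebra_simps eval_nat_numeral)
  then show ?thesis using zero[OF t(1,2)] nz[OF t(1,2)] t(3) r_pos[OF s] p_nonzero[OF s] \<kappa>_nonzero[OF s]
    by auto
qed

text \<open>With the denominator \<open>W\<close> there is an additional dependence on \<open>\<tau>\<^sup>2\<close>. The two contributions are
  separated by their degrees: \<open>\<alpha> W\<close> has degree two and \<open>\<beta> Y\<close> has degree four.\<close>
lemma jacobi_W_tube_imp:
  assumes s: "s \<in> I" and "t1 < t2" and flat: "u s = 0" "a s = 0" "a' s = 0"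
    and zero: "\<And>t. t1 < t \<Longrightarrow> t < t2 \<Longrightarrow> jacobi Y Y_s Y_t W W_s W_t s t = 0"
  shows "\<kappa>' s = 0"
proof -
  define \<beta> where "\<beta> = 8 * r s ^ 3 * (p s)^3 * \<tau> s * \<tau>' s"
  define \<alpha> where "\<alpha> = 2 * r s ^ 3 * (p s)^3 * (\<kappa> s * \<kappa>' s)"
  have eq: "jacobi Y Y_s Y_t W W_s W_t s t = A_t s t * (\<alpha> * W s t - \<beta> * Y s t)" for t
  proof -
    have 1: "Y_s s t = (16 * r s ^ 3 * A s t ^ 3 + 18 * (r s)\<^sup>2 * p s * (A s t)\<^sup>2
         + 2 * r s * (p s)\<^sup>2 * A s t) * A_s s t + 2 * r s * (p s)\<^sup>2 * (\<kappa> s * \<kappa>' s)"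
      "Y_t s t = (16 * r s ^ 3 * A s t ^ 3 + 18 * (r s)\<^sup>2 * p s * (A s t)\<^sup>2
         + 2 * r s * (p s)\<^sup>2 * A s t) * A_t s t"
      "W_s s t = (2 * w2 s * A s t + w1 s) * A_s s t + 4 * r s * (p s)\<^sup>2 * \<tau> s * \<tau>' s"
      "W_t s t = (2 * w2 s * A s t + w1 s) * A_t s t"
      by (simp_all add: Y_s_def Y_t_def Y_low_s_def Y_low_t_def W_s_def W_t_def V_t_def 
        c0_def c0'_def c1_def c1'_def c2_def c2'_def c3_def c3'_def w2'_def w1'_def w3'_def w0'_def w3_def flat algebra_simps)
    show ?thesis unfolding jacobi_def h_def P_s_def 1 flat \<alpha>_def \<beta>_def
      by (simp add: algebra_simps eval_nat_numeral)
  qed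
  have lead0: "\<kappa> s \<noteq> 0" "r s \<noteq> 0" using \<kappa>_nonzero[OF s] r_pos[OF s] by auto
  have "trig_lead 5 (\<i> * \<beta> * \<kappa> s / 2 * (4 * r s ^ 3 * (\<kappa> s / 2)^4)) (\<lambda>t. A_t s t * (\<alpha> * W s t - \<beta> * Y s t))"
    by (rule trig_lead_cong[OF trig_lead_mult[OF lead_A_t trig_lead_diff[OF
       trig_deg_lower[OF trig_deg_cmult[OF trig_degI[OF lead_W order.refl]], of 4] trig_lead_cmult[OF lead_Y]]]]) auto
  then have "\<beta> = 0" using trig_lead_zero[OF _ _ \<open>t1 < t2\<close>] zero lead0 unfolding eq by fastforce
  have "trig_lead 3 (- \<i> * \<alpha> * \<kappa> s / 2 * (w2 s * (\<kappa> s / 2)\<^sup>2)) (\<lambda>t. A_t s t * (\<alpha> * W s t - \<beta> * Y s t))"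
    unfolding \<open>\<beta> = 0\<close>
    by (rule trig_lead_cong[OF trig_lead_mult[OF lead_A_t trig_lead_cmult[OF lead_W, of \<alpha>]]]) auto
  moreover have "w2 s = r s" using flat by (simp add: w2_def)
  ultimately have "\<alpha> = 0" using trig_lead_zero[OF _ _ \<open>t1 < t2\<close>] zero lead0 unfolding eq by fastforce
  then show ?thesis using lead0 p_nonzero[OF s] by (simp add: \<alpha>_def)
qed

end

section \<open>The curvatures of a canal surface\<close>

lemma mult_mult_eq: "a * a = b \<Longrightarrow> a * (a * x) = b * x" for a b x :: real
  by (simp flip: mult.assoc)

lemma pd_s_eqI:
  assumes "open R" "(s, t) \<in> R" "\<And>x y. (x, y) \<in> R \<Longrightarrow> F x y = G x y"
    and "((\<lambda>x. G x t) has_vector_derivative d) (at s)"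
  shows "pd_s F s t = d"
proof -
  have "open ((\<lambda>x. (x, t)) -` R)" by (intro open_vimage assms continuous_intros)
  then have "((\<lambda>x. F x t) has_vector_derivative d) (at s)"
    by (rule has_vector_derivative_transform_within_open[OF assms(4)]) (use assms in auto)
  then show ?thesis by (simp add: pd_s_def vector_derivative_at)
qed

lemma pd_t_eqI:
  assumes "open R" "(s, t) \<in> R" "\<And>x y. (x, y) \<in> R \<Longrightarrow> F x y = G x y"
    and "((\<lambda>y. G s y) has_vector_derivative d) (at t)"
  shows "pd_t F s t = d"
proof -
  have "open ((\<lambda>y. (s, y)) -` R)" by (intro open_vimage assms continuous_intros)
  then have "((\<lambda>y. F s y) has_vector_derivative d) (at t)"
    by (rule has_vector_derivative_transform_within_open[OF assms(4)]) (use assms in auto)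
  then show ?thesis by (simp add: pd_t_def vector_derivative_at)
qed

lemmas pd_s_real_eqI = pd_s_eqI[OF _ _ _ has_real_derivative_iff_has_vector_derivative[THEN iffD1]]
lemmas pd_t_real_eqI = pd_t_eqI[OF _ _ _ has_real_derivative_iff_has_vector_derivative[THEN iffD1]]

context canal_coefficients
begin

text \<open>The component of the derivative of the sphere normal in \<open>s\<close> direction along the circles.\<close>
definition D where "D s t = u s * A_t s t - p s * \<tau> s"
definition D_t where "D_t s t = - u s * (A s t + a s)"
definition D_s where "D_s s t = p s * a s * A_t s t + u s * A_st s t + u s * a s * \<tau> s - p s * \<tau>' s"
definition D_st where "D_st s t = - p s * a s * (A s t + a s) - u s * (A_s s t + a' s)"

lemma deriv_D_s: "s \<in> I \<Longrightarrow> ((\<lambda>x. D x t) has_real_derivative D_s s t) (at s)"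
  unfolding D_def D_s_def by (auto intro!: derivative_eq_intros simp: algebra_simps)
lemma deriv_D_t: "((\<lambda>x. D s x) has_real_derivative D_t s t) (at t)"
  unfolding D_def D_t_def by (auto intro!: derivative_eq_intros simp: algebra_simps)
lemma deriv_D_tt: "((\<lambda>x. D_t s x) has_real_derivative - u s * A_t s t) (at t)"
  unfolding D_t_def by (auto intro!: derivative_eq_intros simp: algebra_simps)
lemma deriv_D_st: "((\<lambda>x. D_s s x) has_real_derivative D_st s t) (at t)"
  unfolding D_s_def D_st_def by (auto intro!: derivative_eq_intros simp: A_st_def A_s_def algebra_simps)

lemma deriv_L_tt:
  "((\<lambda>x. L_t s x) has_real_derivative 2 * r s * (A_t s t)\<^sup>2 - (p s + 2 * r s * A s t) * (A s t + a s)) (at t)"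
  unfolding L_t_def by (auto intro!: derivative_eq_intros simp: algebra_simps power2_eq_square)

lemmas deriv_L_D [derivative_intros] =
  deriv_D_s[THEN DERIV_chain2] deriv_D_t[THEN DERIV_chain2] deriv_D_tt[THEN DERIV_chain2]
  deriv_D_st[THEN DERIV_chain2] deriv_L_s[THEN DERIV_chain2] deriv_L_t[THEN DERIV_chain2]
  deriv_L_tt[THEN DERIV_chain2]

lemma L_D_W: "L s t + 2 * r s * (D s t)\<^sup>2 = W s t"
proof -
  have D2: "(D s t)\<^sup>2 = (u s)\<^sup>2 * (A_t s t)\<^sup>2 - 2 * u s * p s * \<tau> s * A_t s t + (p s)\<^sup>2 * (\<tau> s)\<^sup>2"
    by (simp add: D_def power2_eq_square algebra_simps)
  show ?thesis unfolding D2 A_t_sq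
    by (simp add: W_def V_def L_def P_def w0_def w1_def w2_def w3_def c3_def algebra_simps power2_eq_square)
qed

text \<open>Derivatives of \<open>e = L + r D\<^sup>2\<close>, \<open>g = r p\<^sup>2\<close> and \<open>f = r p D\<close>, the coefficients of the second
  fundamental form up to a common sign.\<close>
definition e_s where "e_s s t = L_s s t + u s * (D s t)\<^sup>2 + 2 * r s * D s t * D_s s t"
definition e_t where "e_t s t = L_t s t + 2 * r s * D s t * D_t s t"
definition e_tt where "e_tt s t = 2 * r s * (A_t s t)\<^sup>2 - (p s + 2 * r s * A s t) * (A s t + a s)
   + 2 * r s * (D_t s t)\<^sup>2 - 2 * r s * D s t * u s * A_t s t"
definition g_s where "g_s s = u s * (p s)\<^sup>2 - 2 * r s * p s * u s * a s"
definition g_ss where "g_ss s = p s * a s * (p s)\<^sup>2 - 4 * (u s)\<^sup>2 * p s * a s + 2 * r s * (u s)\<^sup>2 * (a s)\<^sup>2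
   - 2 * r s * (p s)\<^sup>2 * (a s)\<^sup>2 - 2 * r s * p s * u s * a' s"
definition f_s where "f_s s t = (u s * p s - r s * u s * a s) * D s t + r s * p s * D_s s t"
definition f_st where "f_st s t = (u s * p s - r s * u s * a s) * D_t s t + r s * p s * D_st s t"

lemma deriv_e_s: "s \<in> I \<Longrightarrow> ((\<lambda>x. L x t + r x * (D x t)\<^sup>2) has_real_derivative e_s s t) (at s)"
  unfolding e_s_def by (auto intro!: derivative_eq_intros simp: algebra_simps power2_eq_square)
lemma deriv_e_t: "((\<lambda>x. L s x + r s * (D s x)\<^sup>2) has_real_derivative e_t s t) (at t)"
  unfolding e_t_def by (auto intro!: derivative_eq_intros simp: algebra_simps power2_eq_square)
lemma deriv_e_tt: "((\<lambda>x. e_t s x) has_real_derivative e_tt s t) (at t)"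
  unfolding e_t_def e_tt_def by (auto intro!: derivative_eq_intros simp: algebra_simps power2_eq_square)
lemma deriv_f_s: "s \<in> I \<Longrightarrow> ((\<lambda>x. r x * p x * D x t) has_real_derivative f_s s t) (at s)"
  unfolding f_s_def by (auto intro!: derivative_eq_intros simp: algebra_simps power2_eq_square)
lemma deriv_f_t: "((\<lambda>x. r s * p s * D s x) has_real_derivative r s * p s * D_t s t) (at t)"
  by (auto intro!: derivative_eq_intros)
lemma deriv_f_st: "((\<lambda>x. f_s s x) has_real_derivative f_st s t) (at t)"
  unfolding f_s_def f_st_def by (auto intro!: derivative_eq_intros)
lemma deriv_g_s: "s \<in> I \<Longrightarrow> ((\<lambda>x. r x * (p x)\<^sup>2) has_real_derivative g_s s) (at s)"
  unfolding g_s_def by (auto intro!: derivative_eq_intros simp: algebra_simps power2_eq_square)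
lemma deriv_g_ss: "s \<in> I \<Longrightarrow> (g_s has_real_derivative g_ss s) (at s)"
  unfolding g_s_def[abs_def] g_ss_def by (auto intro!: derivative_eq_intros simp: algebra_simps power2_eq_square)

text \<open>At least formally, the second fundamental form is diagonal in the coframe
  \<open>sqrt L ds\<close>, \<open>sqrt r (D ds + p dt)\<close>. This expresses its curvature by \<open>L\<close>, \<open>D\<close> and the
  coefficient \<open>m / sqrt r\<close> of the exterior derivative of the second form, which is the first step of the
  computation; \<open>L\<close> is still an arbitrary function there.\<close>
lemma brioschi_determinants:
  fixes s t :: real
  assumes "s \<in> I"
  defines "e \<equiv> L s t + r s * (D s t)\<^sup>2" and "f \<equiv> r s * p s * D s t" and "g \<equiv> r s * (p s)\<^sup>2"
    and "f_t \<equiv> r s * p s * D_t s t"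
  shows "4 * ((- (1/2) * e_tt s t + f_st s t - (1/2) * g_ss s) * (e * g - f\<^sup>2)
     - (1/2) * e_s s t * (f_t - (1/2) * g_s s) * g
     + (f_s s t - (1/2) * e_t s t) * (f_t - (1/2) * g_s s) * f
     - ((1/2) * e_t s t * ((1/2) * g_s s) * f * 2 - ((1/2) * e_t s t)\<^sup>2 * g - ((1/2) * g_s s)\<^sup>2 * e))
   = (p s)^4 * Y s t"
proof -
  define m m_t m_s where "m = u s * p s / 2 + r s * u s * A s t" and "m_t = r s * u s * A_t s t"
    and "m_s = ((p s)\<^sup>2 * a s - (u s)\<^sup>2 * a s) / 2 + (u s)\<^sup>2 * A s t + r s * p s * a s * A s t + r s * u s * A_s s t"
  define L_tt where "L_tt = 2 * r s * (A_t s t)\<^sup>2 - (p s + 2 * r s * A s t) * (A s t + a s)"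
  have "4 * ((- (1/2) * e_tt s t + f_st s t - (1/2) * g_ss s) * (e * g - f\<^sup>2)
     - (1/2) * e_s s t * (f_t - (1/2) * g_s s) * g
     + (f_s s t - (1/2) * e_t s t) * (f_t - (1/2) * g_s s) * f
     - ((1/2) * e_t s t * ((1/2) * g_s s) * f * 2 - ((1/2) * e_t s t)\<^sup>2 * g - ((1/2) * g_s s)\<^sup>2 * e))
   = (p s)\<^sup>2 * (- 4 * p s * ((r s * m_s - u s * m / 2) * L s t - r s * m * L_s s t / 2)
      - 4 * r s * (L s t * L_tt / 2 - (L_t s t)\<^sup>2 / 4 - (m_t * D s t + m * D_t s t) * L s t + m * D s t * L_t s t / 2))"
    unfolding e_def f_def g_def f_t_def e_s_def e_t_def e_tt_def g_s_def g_ss_def f_s_def f_st_def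
      D_t_def D_st_def m_def m_t_def m_s_def L_tt_def[symmetric]
    by (simp add: field_simps eval_nat_numeral)
  also have "- 4 * p s * ((r s * m_s - u s * m / 2) * L s t - r s * m * L_s s t / 2)
      - 4 * r s * (L s t * L_tt / 2 - (L_t s t)\<^sup>2 / 4 - (m_t * D s t + m * D_t s t) * L s t + m * D s t * L_t s t / 2)
    = (p s)\<^sup>2 * Y s t"
  proof -
    have p2: "p s * p s = 1 - u s * u s"
      using u_p[OF assms(1)] by (simp add: power2_eq_square algebra_simps)
    have At2: "A_t s t * A_t s t = \<kappa> s * \<kappa> s - (A s t + a s) * (A s t + a s)"
      using A_t_sq[of s t] by (simp add: power2_eq_square)
    show ?thesis
      unfolding m_def m_t_def m_s_def L_tt_def
        L_def L_s_def L_t_def P_def P_s_def D_def D_t_def Y_def Y_low_def c0_def c1_def c2_def c3_def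
      by (simp add: field_simps eval_nat_numeral p2 mult_mult_eq[OF p2] At2 mult_mult_eq[OF At2])
  qed
  finally show ?thesis by (simp add: eval_nat_numeral)
qed

end

lemma cross3_orthonormal_basis:
  fixes T N :: "real^3"
  assumes "T \<bullet> T = 1" "N \<bullet> N = 1" "T \<bullet> N = 0" "B = cross3 T N"
  shows "B \<bullet> B = 1" "T \<bullet> B = 0" "N \<bullet> B = 0" "cross3 N B = T" "cross3 B T = N"
    "x = (x \<bullet> T) *\<^sub>R T + (x \<bullet> N) *\<^sub>R N + (x \<bullet> B) *\<^sub>R B"
proof -
  have lag: "cross3 x (cross3 y z) = (x \<bullet> z) *\<^sub>R y - (x \<bullet> y) *\<^sub>R z" for x y z by (rule Lagrange)
  show B: "T \<bullet> B = 0" "N \<bullet> B = 0" using assms(4) dot_cross_self by auto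
  show "cross3 N B = T" using assms lag by (simp add: inner_commute)
  have TB: "cross3 T B = - N" using assms lag by simp
  then show BT: "cross3 B T = N" by (metis cross_skew minus_minus)
  have "(norm B)\<^sup>2 = 1"
    using norm_cross_dot[of T N] assms by (simp add: power_mult_distrib power2_norm_eq_inner)
  then show BB: "B \<bullet> B = 1" by (simp add: power2_norm_eq_inner)
  have "cross3 B (cross3 x B) = x - (B \<bullet> x) *\<^sub>R B" using lag[of B x B] BB by simp
  moreover have "cross3 x B = (x \<bullet> N) *\<^sub>R T - (x \<bullet> T) *\<^sub>R N" using lag[of x T N] assms(4) by simp
  moreover have "cross3 B N = - T" using \<open>cross3 N B = T\<close> cross_skew[of B N] by simp
  ultimately show "x = (x \<bullet> T) *\<^sub>R T + (x \<bullet> N) *\<^sub>R N + (x \<bullet> B) *\<^sub>R B"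
    using BT by (simp add: Cross3.right_diff_distrib cross_mult_right inner_commute algebra_simps)
qed

text \<open>A Weingarten canal surface over a center curve with nonvanishing curvature.\<close>
locale canal_frame = canal_coefficients +
  fixes \<alpha> T N B :: "real \<Rightarrow> real^3" and C :: "real \<Rightarrow> real \<Rightarrow> real^3" and U :: "(real \<times> real) set"
  assumes deriv_\<alpha>: "s \<in> I \<Longrightarrow> (\<alpha> has_vector_derivative T s) (at s)"
    and deriv_T: "s \<in> I \<Longrightarrow> (T has_vector_derivative \<kappa> s *\<^sub>R N s) (at s)"
    and deriv_N: "s \<in> I \<Longrightarrow> (N has_vector_derivative - \<kappa> s *\<^sub>R T s + \<tau> s *\<^sub>R B s) (at s)"
    and deriv_B: "s \<in> I \<Longrightarrow> (B has_vector_derivative - \<tau> s *\<^sub>R N s) (at s)"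
    and orthonormal: "s \<in> I \<Longrightarrow> T s \<bullet> T s = 1" "s \<in> I \<Longrightarrow> N s \<bullet> N s = 1" "s \<in> I \<Longrightarrow> T s \<bullet> N s = 0"
    and B_eq: "s \<in> I \<Longrightarrow> B s = cross3 (T s) (N s)"
    and open_U: "open U" and U_I: "(s, t) \<in> U \<Longrightarrow> s \<in> I"
    and C_eq: "s \<in> I \<Longrightarrow> C s t = \<alpha> s - (r s * u s) *\<^sub>R T s - (r s * p s * cos t) *\<^sub>R N s
      + (r s * p s * sin t) *\<^sub>R B s"
    and regular: "regular_on U C"
    and nondegenerate: "II_nondegenerate_on U C"
    and Weingarten: "Weingarten_on U (mean_curvature C) (second_gaussian_curvature C)"
begin

definition frame where "frame v1 v2 v3 s = v1 *\<^sub>R T s + v2 *\<^sub>R N s + v3 *\<^sub>R B s" for s :: real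

lemma inner_frame:
  assumes "s \<in> I"
  shows "frame v1 v2 v3 s \<bullet> frame d1 d2 d3 s = v1 * d1 + v2 * d2 + v3 * d3"
  using orthonormal[OF assms] cross3_orthonormal_basis(1-3)[OF orthonormal[OF assms] B_eq[OF assms]]
  unfolding frame_def by (simp add: inner_simps inner_commute)

lemma cross3_frame:
  assumes "s \<in> I"
  shows "cross3 (frame v1 v2 v3 s) (frame d1 d2 d3 s) =
     frame (v2 * d3 - v3 * d2) (v3 * d1 - v1 * d3) (v1 * d2 - v2 * d1) s"
proof -
  note * = cross3_orthonormal_basis(4,5)[OF orthonormal[OF assms] B_eq[OF assms]]
  have "cross3 (T s) (N s) = B s" "cross3 (N s) (B s) = T s" "cross3 (B s) (T s) = N s"
    "cross3 (N s) (T s) = - B s" "cross3 (B s) (N s) = - T s" "cross3 (T s) (B s) = - N s"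
    using * B_eq[OF assms] by (simp_all, (metis cross_skew)+)
  then show ?thesis unfolding frame_def
    by (simp add: cross_add_left cross_add_right cross_mult_left cross_mult_right algebra_simps)
qed

lemma deriv_frame_s:
  assumes "s \<in> I" "(v1 has_real_derivative d1) (at s)" "(v2 has_real_derivative d2) (at s)"
    "(v3 has_real_derivative d3) (at s)"
  shows "((\<lambda>x. frame (v1 x) (v2 x) (v3 x) x) has_vector_derivative
    frame (d1 - \<kappa> s * v2 s) (d2 + \<kappa> s * v1 s - \<tau> s * v3 s) (d3 + \<tau> s * v2 s) s) (at s)"
  unfolding frame_def
  by (rule has_vector_derivative_eq_rhs[OF has_vector_derivative_add[OF has_vector_derivative_add[OF
      has_vector_derivative_scaleR[OF assms(2) deriv_T[OF assms(1)]]
      has_vector_derivative_scaleR[OF assms(3) deriv_N[OF assms(1)]]]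
      has_vector_derivative_scaleR[OF assms(4) deriv_B[OF assms(1)]]]])
    (simp add: algebra_simps)

lemma deriv_frame_t:
  assumes "(v1 has_real_derivative d1) (at t)" "(v2 has_real_derivative d2) (at t)"
    "(v3 has_real_derivative d3) (at t)"
  shows "((\<lambda>x. frame (v1 x) (v2 x) (v3 x) s) has_vector_derivative frame d1 d2 d3 s) (at t)"
  unfolding frame_def
  by (rule has_vector_derivative_eq_rhs[OF has_vector_derivative_add[OF has_vector_derivative_add[OF
      has_vector_derivative_scaleR[OF assms(1) has_vector_derivative_const]
      has_vector_derivative_scaleR[OF assms(2) has_vector_derivative_const]]
      has_vector_derivative_scaleR[OF assms(3) has_vector_derivative_const]]])
    simp

lemma sin_sq: "sin t * sin t = 1 - cos t * cos t" for t :: real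
  using sin_cos_squared_add[of t] by (simp add: power2_eq_square algebra_simps)

lemma T_add_frame: "T s + frame x y z s = frame (1 + x) y z s"
  by (simp add: frame_def algebra_simps)

lemma arg_cong3: "x = x' \<Longrightarrow> y = y' \<Longrightarrow> z = z' \<Longrightarrow> f x y z = f x' y' z'"
  by simp

lemma pd_s_C:
  assumes "(s, t) \<in> U"
  shows "pd_s C s t = frame (p s * P s t) (- u s * cos t * P s t + r s * D s t * sin t)
     (u s * sin t * P s t + r s * D s t * cos t) s"
proof (rule pd_s_eqI[OF open_U assms])
  have s: "s \<in> I" using U_I assms by blast
  show "C x y = \<alpha> x + frame (- (r x * u x)) (- (r x * p x * cos y)) (r x * p x * sin y) x" if "(x, y) \<in> U" for x y
    using C_eq[OF U_I[OF that]] by (simp add: frame_def algebra_simps)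
  have "((\<lambda>x. \<alpha> x + frame (- (r x * u x)) (- (r x * p x * cos t)) (r x * p x * sin t) x) has_vector_derivative
     T s + frame (- (u s * u s + r s * (p s * a s)) - \<kappa> s * (- (r s * p s * cos t))) 
       (- ((u s * p s - r s * (u s * a s)) * cos t) + \<kappa> s * (- (r s * u s)) - \<tau> s * (r s * p s * sin t))
       ((u s * p s - r s * (u s * a s)) * sin t + \<tau> s * (- (r s * p s * cos t))) s) (at s)"
    by (intro has_vector_derivative_add deriv_\<alpha> deriv_frame_s s)
       (auto intro!: derivative_eq_intros s simp: algebra_simps)
  moreover have "p s * p s = 1 - u s * u s" using u_p[OF s] by (simp add: power2_eq_square)
  ultimately show "((\<lambda>x. \<alpha> x + frame (- (r x * u x)) (- (r x * p x * cos t)) (r x * p x * sin t) x) has_vector_derivative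
     frame (p s * P s t) (- u s * cos t * P s t + r s * D s t * sin t)
     (u s * sin t * P s t + r s * D s t * cos t) s) (at s)"
    unfolding T_add_frame
    by (elim has_vector_derivative_eq_rhs, intro arg_cong3[where f = "\<lambda>x y z. frame x y z s"])
       (simp_all add: P_def D_def A_def A_t_def sin_sq mult_mult_eq[OF sin_sq] algebra_simps)
qed

lemma pd_t_C:
  assumes "(s, t) \<in> U"
  shows "pd_t C s t = frame 0 (r s * p s * sin t) (r s * p s * cos t) s"
proof (rule pd_t_eqI[OF open_U assms])
  show "C x y = \<alpha> x + frame (- (r x * u x)) (- (r x * p x * cos y)) (r x * p x * sin y) x" if "(x, y) \<in> U" for x y
    using C_eq[OF U_I[OF that]] by (simp add: frame_def algebra_simps)
  show "((\<lambda>y. \<alpha> s + frame (- (r s * u s)) (- (r s * p s * cos y)) (r s * p s * sin y) s) has_vector_derivative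
    frame 0 (r s * p s * sin t) (r s * p s * cos t) s) (at t)"
    by (rule has_vector_derivative_eq_rhs[OF has_vector_derivative_add[OF has_vector_derivative_const deriv_frame_t]])
      (auto intro!: derivative_eq_intros)
qed

end

context canal_frame
begin

text \<open>The orientation: \<open>C\<^sub>s \<times> C\<^sub>t\<close> is \<open>r p P\<close> times the normal that points out of the spheres.\<close>
definition \<epsilon> where "\<epsilon> s t = sgn (p s * P s t)"

lemma ffE_eq: "(s, t) \<in> U \<Longrightarrow> ffE C s t = (P s t)\<^sup>2 + (r s)\<^sup>2 * (D s t)\<^sup>2"
proof -
  assume st: "(s, t) \<in> U"
  then have s: "s \<in> I" using U_I by blast
  have p2: "p s * p s = 1 - u s * u s" using u_p[OF s] by (simp add: power2_eq_square)
  show ?thesis unfolding ffE_def pd_s_C[OF st] inner_frame[OF s]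
    by (simp add: algebra_simps power2_eq_square p2 mult_mult_eq[OF p2] sin_sq mult_mult_eq[OF sin_sq])
qed

lemma ffF_eq: "(s, t) \<in> U \<Longrightarrow> ffF C s t = (r s)\<^sup>2 * p s * D s t"
proof -
  assume st: "(s, t) \<in> U"
  then have s: "s \<in> I" using U_I by blast
  show ?thesis unfolding ffF_def pd_s_C[OF st] pd_t_C[OF st] inner_frame[OF s]
    by (simp add: algebra_simps power2_eq_square sin_sq mult_mult_eq[OF sin_sq])
qed

lemma ffG_eq: "(s, t) \<in> U \<Longrightarrow> ffG C s t = (r s)\<^sup>2 * (p s)\<^sup>2"
proof -
  assume st: "(s, t) \<in> U"
  then have s: "s \<in> I" using U_I by blast
  show ?thesis unfolding ffG_def pd_t_C[OF st] inner_frame[OF s]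
    by (simp add: algebra_simps power2_eq_square sin_sq mult_mult_eq[OF sin_sq])
qed

lemma ff_det: "(s, t) \<in> U \<Longrightarrow> ffE C s t * ffG C s t - (ffF C s t)\<^sup>2 = (r s * p s * P s t)\<^sup>2"
  by (simp add: ffE_eq ffF_eq ffG_eq algebra_simps power2_eq_square)

lemma P_nonzero: "(s, t) \<in> U \<Longrightarrow> P s t \<noteq> 0"
  using regular ff_det unfolding regular_on_def by fastforce

lemma unit_normal_eq:
  assumes st: "(s, t) \<in> U"
  shows "unit_normal C s t = \<epsilon> s t *\<^sub>R frame (- u s) (- p s * cos t) (p s * sin t) s"
proof -
  have s: "s \<in> I" using U_I st by blast
  note r = r_pos[OF s] and p = p_nonzero[OF s] and P = P_nonzero[OF st]
  have p2: "p s * p s = 1 - u s * u s" using u_p[OF s] by (simp add: power2_eq_square)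
  define n where "n = frame (- u s) (- p s * cos t) (p s * sin t) s"
  have cr: "cross3 (pd_s C s t) (pd_t C s t) = (r s * p s * P s t) *\<^sub>R n"
  proof -
    have sc: "k *\<^sub>R frame x y z s = frame (k * x) (k * y) (k * z) s" for k x y z
      by (simp add: frame_def algebra_simps)
    show ?thesis unfolding pd_s_C[OF st] pd_t_C[OF st] cross3_frame[OF s] n_def sc
      by (intro arg_cong3[where f = "\<lambda>x y z. frame x y z s"])
        (simp_all add: algebra_simps sin_sq mult_mult_eq[OF sin_sq])
  qed
  have "n \<bullet> n = 1" unfolding n_def inner_frame[OF s]
    by (simp add: algebra_simps sin_sq mult_mult_eq[OF sin_sq] p2 mult_mult_eq[OF p2])
  then have "norm n = 1" by (simp add: norm_eq_sqrt_inner)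
  then show ?thesis unfolding unit_normal_def cr n_def[symmetric] \<epsilon>_def using r p P
    by (auto simp: sgn_real_def abs_mult zero_less_mult_iff mult_less_0_iff abs_if divide_simps split: if_splits)
qed

lemma sfe_eq:
  assumes st: "(s, t) \<in> U"
  shows "sfe C s t = - \<epsilon> s t * (L s t + r s * (D s t)\<^sup>2)"
proof -
  have s: "s \<in> I" using U_I st by blast
  have p2: "p s * p s = 1 - u s * u s" using u_p[OF s] by (simp add: power2_eq_square)
  have pd: "pd_s (pd_s C) s t = frame (- u s * a s * P s t + p s * P_s s t
        - \<kappa> s * (- u s * cos t * P s t + r s * D s t * sin t))
     (- p s * a s * cos t * P s t - u s * cos t * P_s s t + (u s * D s t + r s * D_s s t) * sin t
        + \<kappa> s * (p s * P s t) - \<tau> s * (u s * sin t * P s t + r s * D s t * cos t))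
     (p s * a s * sin t * P s t + u s * sin t * P_s s t + (u s * D s t + r s * D_s s t) * cos t
        + \<tau> s * (- u s * cos t * P s t + r s * D s t * sin t)) s"
    by (rule pd_s_eqI[OF open_U st pd_s_C deriv_frame_s[OF s]])
       (auto intro!: derivative_eq_intros s simp: algebra_simps)
  have "sfe C s t = \<epsilon> s t * (u s * u s * a s * P s t + p s * p s * a s * P s t
     - \<kappa> s * cos t * P s t * (u s * u s + p s * p s) + r s * D s t * (u s * \<kappa> s * sin t + p s * \<tau> s))"
    unfolding sfe_def pd unit_normal_eq[OF st] inner_scaleR_right inner_frame[OF s]
    by (simp add: algebra_simps sin_sq mult_mult_eq[OF sin_sq])
  also have "\<dots> = - \<epsilon> s t * (L s t + r s * (D s t)\<^sup>2)"
    unfolding p2 by (simp add: L_def A_def D_def A_t_def algebra_simps power2_eq_square)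
  finally show ?thesis .
qed

lemma sff_eq:
  assumes st: "(s, t) \<in> U"
  shows "sff C s t = - \<epsilon> s t * (r s * p s * D s t)"
proof -
  have s: "s \<in> I" using U_I st by blast
  have pd: "pd_t (pd_s C) s t = frame (p s * (r s * A_t s t))
     (u s * sin t * P s t - u s * cos t * (r s * A_t s t) + r s * D_t s t * sin t + r s * D s t * cos t)
     (u s * cos t * P s t + u s * sin t * (r s * A_t s t) + r s * D_t s t * cos t - r s * D s t * sin t) s"
    by (rule pd_t_eqI[OF open_U st pd_s_C deriv_frame_t])
       (auto intro!: derivative_eq_intros simp: algebra_simps)
  show ?thesis
    unfolding sff_def pd unit_normal_eq[OF st] inner_scaleR_right inner_frame[OF s]
    by (simp add: algebra_simps sin_sq mult_mult_eq[OF sin_sq])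
qed

lemma sfg_eq:
  assumes st: "(s, t) \<in> U"
  shows "sfg C s t = - \<epsilon> s t * (r s * (p s)\<^sup>2)"
proof -
  have s: "s \<in> I" using U_I st by blast
  have pd: "pd_t (pd_t C) s t = frame 0 (r s * p s * cos t) (- (r s * p s * sin t)) s"
    by (rule pd_t_eqI[OF open_U st pd_t_C deriv_frame_t])
       (auto intro!: derivative_eq_intros simp: algebra_simps)
  show ?thesis
    unfolding sfg_def pd unit_normal_eq[OF st] inner_scaleR_right inner_frame[OF s]
    by (simp add: algebra_simps sin_sq mult_mult_eq[OF sin_sq] power2_eq_square)
qed

lemma \<epsilon>_sq: "(s, t) \<in> U \<Longrightarrow> \<epsilon> s t * \<epsilon> s t = 1"
  using P_nonzero[of s t] p_nonzero[OF U_I, of s t] unfolding \<epsilon>_def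
  by (auto simp: sgn_real_def)

lemma L_nonzero:
  assumes st: "(s, t) \<in> U" shows "L s t \<noteq> 0"
proof
  assume "L s t = 0"
  then have "sfe C s t * sfg C s t - (sff C s t)\<^sup>2 = 0"
    by (simp add: sfe_eq[OF st] sff_eq[OF st] sfg_eq[OF st] power2_eq_square algebra_simps)
  then show False using nondegenerate st unfolding II_nondegenerate_on_def by auto
qed

lemma mean_curvature_eq:
  assumes st: "(s, t) \<in> U"
  shows "mean_curvature C s t = - \<epsilon> s t * H s t"
proof -
  have s: "s \<in> I" using U_I st by blast
  note r = r_pos[OF s] and p = p_nonzero[OF s] and P = P_nonzero[OF st]
  have A: "r s * A s t = P s t - p s" by (simp add: P_def)
  have num: "ffE C s t * sfg C s t - 2 * ffF C s t * sff C s t + ffG C s t * sfe C s t =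
     - \<epsilon> s t * r s * (p s)\<^sup>2 * P s t * (P s t + r s * A s t)"
    by (simp add: ffE_eq[OF st] ffF_eq[OF st] ffG_eq[OF st] sfe_eq[OF st] sff_eq[OF st] sfg_eq[OF st] L_def
       power2_eq_square algebra_simps)
  show ?thesis unfolding mean_curvature_def ff_det[OF st] num H_def A using r p P
    by (simp add: field_simps power2_eq_square)
qed

text \<open>With \<open>E\<close>, \<open>F\<close>, \<open>G\<close> for the coefficients of the second fundamental form up to sign, the
  determinant is \<open>E G - F\<^sup>2 = r p\<^sup>2 L\<close>; for \<open>E < 0\<close> the denominator contains
  \<open>\<bar>E\<bar> G - F\<^sup>2 = - r p\<^sup>2 W\<close> instead.\<close>
lemma second_gaussian_curvature_eq:
  assumes R: "open R" "R \<subseteq> U" "(s, t) \<in> R" and const: "\<And>x y. (x, y) \<in> R \<Longrightarrow> \<epsilon> x y = c"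
  shows "L s t + r s * (D s t)\<^sup>2 \<ge> 0 \<Longrightarrow>
      second_gaussian_curvature C s t = - c * (Y s t / (4 * (r s)\<^sup>2 * (L s t)\<^sup>2))"
    and "L s t + r s * (D s t)\<^sup>2 < 0 \<Longrightarrow>
      second_gaussian_curvature C s t = - c * (Y s t / (4 * (r s)\<^sup>2 * (W s t)\<^sup>2))"
proof -
  have RU: "(x, y) \<in> U" if "(x, y) \<in> R" for x y using that R by auto
  have RI: "x \<in> I" if "(x, y) \<in> R" for x y using U_I RU that by blast
  have s: "s \<in> I" using RI R by blast
  note r = r_pos[OF s] and p = p_nonzero[OF s]
  have cc: "c * c = 1" using \<epsilon>_sq[OF RU[OF R(3)]] const[OF R(3)] by simp
  have e: "sfe C x y = - c * (L x y + r x * (D x y)\<^sup>2)" if "(x, y) \<in> R" for x y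
    using sfe_eq[OF RU[OF that]] const[OF that] by simp
  have f: "sff C x y = - c * (r x * p x * D x y)" if "(x, y) \<in> R" for x y
    using sff_eq[OF RU[OF that]] const[OF that] by simp
  have g: "sfg C x y = - c * (r x * (p x)\<^sup>2)" if "(x, y) \<in> R" for x y
    using sfg_eq[OF RU[OF that]] const[OF that] by simp
  have e_s: "pd_s (sfe C) x y = - c * e_s x y" if "(x, y) \<in> R" for x y
    by (rule pd_s_real_eqI[OF R(1) that e DERIV_cmult[OF deriv_e_s[OF RI[OF that]]]])
  have e_t: "pd_t (sfe C) x y = - c * e_t x y" if "(x, y) \<in> R" for x y
    by (rule pd_t_real_eqI[OF R(1) that e DERIV_cmult[OF deriv_e_t]])
  have e_tt: "pd_t (pd_t (sfe C)) x y = - c * e_tt x y" if "(x, y) \<in> R" for x y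
    by (rule pd_t_real_eqI[OF R(1) that e_t DERIV_cmult[OF deriv_e_tt]])
  have f_s: "pd_s (sff C) x y = - c * f_s x y" if "(x, y) \<in> R" for x y
    by (rule pd_s_real_eqI[OF R(1) that f DERIV_cmult[OF deriv_f_s[OF RI[OF that]]]])
  have f_t: "pd_t (sff C) x y = - c * (r x * p x * D_t x y)" if "(x, y) \<in> R" for x y
    by (rule pd_t_real_eqI[OF R(1) that f DERIV_cmult[OF deriv_f_t]])
  have f_st: "pd_t (pd_s (sff C)) x y = - c * f_st x y" if "(x, y) \<in> R" for x y
    by (rule pd_t_real_eqI[OF R(1) that f_s DERIV_cmult[OF deriv_f_st]])
  have g_s: "pd_s (sfg C) x y = - c * g_s x" if "(x, y) \<in> R" for x y
    by (rule pd_s_real_eqI[OF R(1) that g DERIV_cmult[OF deriv_g_s[OF RI[OF that]]]])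
  have g_ss: "pd_s (pd_s (sfg C)) x y = - c * g_ss x" if "(x, y) \<in> R" for x y
    by (rule pd_s_real_eqI[OF R(1) that g_s DERIV_cmult[OF deriv_g_ss[OF RI[OF that]]]])
  have g_t: "pd_t (sfg C) x y = 0" if "(x, y) \<in> R" for x y
    by (rule pd_t_real_eqI[OF R(1) that g DERIV_const])
  define X where "X = (\<bar>sfe C s t * sfg C s t\<bar> - (sff C s t)\<^sup>2)\<^sup>2"
  define E F G where "E = L s t + r s * (D s t)\<^sup>2" and "F = r s * p s * D s t" and "G = r s * (p s)\<^sup>2"
  define S where "S = (- (1/2) * e_tt s t + f_st s t - (1/2) * g_ss s) * (E * G - F\<^sup>2)
     - (1/2) * e_s s t * (r s * p s * D_t s t - (1/2) * g_s s) * G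
     + (f_s s t - (1/2) * e_t s t) * (r s * p s * D_t s t - (1/2) * g_s s) * F
     - ((1/2) * e_t s t * ((1/2) * g_s s) * F * 2 - ((1/2) * e_t s t)\<^sup>2 * G - ((1/2) * g_s s)\<^sup>2 * E)"
  have S: "4 * S = (p s)^4 * Y s t"
    unfolding S_def E_def F_def G_def by (rule brioschi_determinants[OF s])
  have "second_gaussian_curvature C s t = 1 / X * (- (c * c * c) * S)"
    unfolding second_gaussian_curvature_def Let_def X_def[symmetric]
    unfolding det_3 vector_3 e_s[OF R(3)] e_t[OF R(3)] e_tt[OF R(3)] f_s[OF R(3)] f_t[OF R(3)] f_st[OF R(3)] g_s[OF R(3)]
      g_ss[OF R(3)] g_t[OF R(3)] e[OF R(3)] f[OF R(3)] g[OF R(3)]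
      E_def[symmetric] F_def[symmetric] G_def[symmetric] S_def
    by (intro arg_cong[where f = "(*) (1 / X)"]) (simp add: field_simps power2_eq_square)
  also have "\<dots> = - c * ((p s)^4 * Y s t / (4 * X))"
    unfolding S[symmetric] cc by simp
  finally have K: "second_gaussian_curvature C s t = - c * ((p s)^4 * Y s t / (4 * X))" .
  have "sfe C s t * sfg C s t = E * G" "(sff C s t)\<^sup>2 = F\<^sup>2"
    using cc unfolding e[OF R(3)] f[OF R(3)] g[OF R(3)] E_def F_def G_def
    by (simp_all add: power_mult_distrib power2_eq_square algebra_simps mult_mult_eq[OF cc])
  then have X: "X = (\<bar>E\<bar> * G - F\<^sup>2)\<^sup>2" using r p by (simp add: X_def abs_mult G_def)
  {
    assume "L s t + r s * (D s t)\<^sup>2 \<ge> 0"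
    then have "X = (r s * (p s)\<^sup>2 * L s t)\<^sup>2"
      unfolding X E_def F_def G_def by (simp add: power2_eq_square algebra_simps)
    then show "second_gaussian_curvature C s t = - c * (Y s t / (4 * (r s)\<^sup>2 * (L s t)\<^sup>2))"
      unfolding K using r p by (simp add: eval_nat_numeral)
  }
  {
    assume "L s t + r s * (D s t)\<^sup>2 < 0"
    then have "X = (r s * (p s)\<^sup>2 * W s t)\<^sup>2"
      unfolding X E_def F_def G_def L_D_W[symmetric] by (simp add: power2_eq_square algebra_simps)
    then show "second_gaussian_curvature C s t = - c * (Y s t / (4 * (r s)\<^sup>2 * (W s t)\<^sup>2))"
      unfolding K using r p by (simp add: eval_nat_numeral)
  }
qed

end

section \<open>Rectangles in the parameter domain\<close>

lemma open_contains_rectangle: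
  fixes R :: "(real \<times> real) set"
  assumes "open R" "R \<noteq> {}"
  obtains s1 s2 t1 t2 where "s1 < s2" "t1 < t2" "{s1<..<s2} \<times> {t1<..<t2} \<subseteq> R"
proof -
  obtain s t where "(s, t) \<in> R" using assms by auto
  then obtain S T where ST: "open S" "open T" "(s, t) \<in> S \<times> T" "S \<times> T \<subseteq> R"
    using open_prod_elim[OF assms(1)] by metis
  then obtain d e where "d > 0" "ball s d \<subseteq> S" "e > 0" "ball t e \<subseteq> T" 
    by (auto elim!: openE)
  then show ?thesis using ST
    by (intro that[of "s - d" "s + d" "t - e" "t + e"]) (auto simp: ball_eq_greaterThanLessThan)
qed

context canal_frame
begin

text \<open>Adding a multiple of \<open>H\<close> to \<open>K\<^sub>I\<^sub>I\<close> does not change their Jacobi function.\<close>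
lemma Weingarten_imp_jacobi:
  fixes X X_s X_t Om Om_s Om_t :: "real \<Rightarrow> real \<Rightarrow> real"
  assumes R: "open R" "R \<subseteq> U" "(s, t) \<in> R" and const: "\<And>x y. (x, y) \<in> R \<Longrightarrow> \<epsilon> x y = c"
    and X: "\<And>s t. s \<in> I \<Longrightarrow> ((\<lambda>x. X x t) has_real_derivative X_s s t) (at s)"
      "\<And>s t. ((\<lambda>x. X s x) has_real_derivative X_t s t) (at t)"
    and Om: "\<And>s t. s \<in> I \<Longrightarrow> ((\<lambda>x. Om x t) has_real_derivative Om_s s t) (at s)"
      "\<And>s t. ((\<lambda>x. Om s x) has_real_derivative Om_t s t) (at t)"
    and nz: "\<And>x y. (x, y) \<in> R \<Longrightarrow> Om x y \<noteq> 0"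
    and K: "\<And>x y. (x, y) \<in> R \<Longrightarrow>
      second_gaussian_curvature C x y = - c * (X x y / (4 * (r x)\<^sup>2 * (Om x y)\<^sup>2) + d * H x y)"
  shows "jacobi X X_s X_t Om Om_s Om_t s t = 0"
proof -
  have RU: "(x, y) \<in> U" if "(x, y) \<in> R" for x y using that R by auto
  note st = RU[OF R(3)]
  have s: "s \<in> I" using U_I st by blast
  have r: "r s \<noteq> 0" using r_pos[OF s] by simp
  note P = P_nonzero[OF st] and Om0 = nz[OF R(3)]
  have cc: "c * c = 1" using \<epsilon>_sq[OF st] const[OF R(3)] by simp
  define H_s H_t K_s K_t where "H_s = - h s t / (2 * (r s)\<^sup>2 * (P s t)\<^sup>2)"
    and "H_t = p s * A_t s t / (2 * (P s t)\<^sup>2)"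
    and "K_s = (r s * X_s s t * Om s t - 2 * r s * X s t * Om_s s t - 2 * u s * X s t * Om s t) /
      (4 * r s ^ 3 * Om s t ^ 3)"
    and "K_t = (X_t s t * Om s t - 2 * X s t * Om_t s t) / (4 * (r s)\<^sup>2 * Om s t ^ 3)"
  have H: "((\<lambda>x. H x t) has_real_derivative H_s) (at s)" "((\<lambda>x. H s x) has_real_derivative H_t) (at t)"
    unfolding H_s_def H_t_def by (rule deriv_H_s[OF s P] deriv_H_t[OF s P])+
  have K_s: "((\<lambda>x. X x t / (4 * (r x)\<^sup>2 * (Om x t)\<^sup>2)) has_real_derivative K_s) (at s)"
    unfolding K_s_def using s r Om0
    by (auto intro!: derivative_eq_intros X Om simp: field_simps power2_eq_square power3_eq_cube)
  have K_t: "((\<lambda>x. X s x / (4 * (r s)\<^sup>2 * (Om s x)\<^sup>2)) has_real_derivative K_t) (at t)"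
    unfolding K_t_def using r Om0
    by (auto intro!: derivative_eq_intros X Om simp: field_simps power2_eq_square power3_eq_cube)
  have mean: "mean_curvature C x y = - c * H x y" if "(x, y) \<in> R" for x y
    using mean_curvature_eq[OF RU[OF that]] const[OF that] by simp
  have "pd_s (mean_curvature C) s t = - c * H_s" 
    by (rule pd_s_real_eqI[where G = "\<lambda>x y. - c * H x y", OF R(1,3) mean DERIV_cmult[OF H(1)]])
  moreover have "pd_t (mean_curvature C) s t = - c * H_t" 
    by (rule pd_t_real_eqI[where G = "\<lambda>x y. - c * H x y", OF R(1,3) mean DERIV_cmult[OF H(2)]])
  moreover have "pd_s (second_gaussian_curvature C) s t = - c * (K_s + d * H_s)" 
    by (rule pd_s_real_eqI[where G = "\<lambda>x y. - c * (X x y / (4 * (r x)\<^sup>2 * (Om x y)\<^sup>2) + d * H x y)", OF R(1,3) K DERIV_cmult[OF DERIV_add[OF K_s DERIV_cmult[OF H(1)]]]])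
  moreover have "pd_t (second_gaussian_curvature C) s t = - c * (K_t + d * H_t)" 
    by (rule pd_t_real_eqI[where G = "\<lambda>x y. - c * (X x y / (4 * (r x)\<^sup>2 * (Om x y)\<^sup>2) + d * H x y)", OF R(1,3) K DERIV_cmult[OF DERIV_add[OF K_t DERIV_cmult[OF H(2)]]]])
  moreover have "pd_s (mean_curvature C) s t * pd_t (second_gaussian_curvature C) s t
      - pd_t (mean_curvature C) s t * pd_s (second_gaussian_curvature C) s t = 0"
    using Weingarten st unfolding Weingarten_on_def by blast
  ultimately have "c * c * (H_s * K_t - H_t * K_s) = 0"
    by (simp only:) (simp add: algebra_simps)
  then have zero: "H_s * K_t - H_t * K_s = 0" using cc by simp
  have "jacobi X X_s X_t Om Om_s Om_t s t =
     - (H_s * K_t - H_t * K_s) * (8 * r s ^ 4 * (P s t)\<^sup>2 * Om s t ^ 3)"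
    unfolding jacobi_def H_s_def H_t_def K_s_def K_t_def using r P Om0
    by (simp add: field_simps power2_eq_square power3_eq_cube power4_eq_xxxx)
  then show ?thesis using zero by simp
qed

lemma continuous_on_U_fst:
  assumes "\<And>s. s \<in> I \<Longrightarrow> (f has_real_derivative f' s) (at s)"
  shows "continuous_on U (\<lambda>z. f (fst z))"
proof (rule continuous_on_compose2[where g = f and t = I])
  show "continuous_on I f"
    by (intro continuous_at_imp_continuous_on ballI) (rule DERIV_isCont[OF assms])
qed (use U_I in \<open>auto intro: continuous_intros\<close>)

lemma continuous_on_coefficients:
  "continuous_on U (\<lambda>z. r (fst z))" "continuous_on U (\<lambda>z. u (fst z))" "continuous_on U (\<lambda>z. p (fst z))"
  "continuous_on U (\<lambda>z. a (fst z))" "continuous_on U (\<lambda>z. \<kappa> (fst z))" "continuous_on U (\<lambda>z. \<kappa>' (fst z))"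
  "continuous_on U (\<lambda>z. \<tau> (fst z))"
  by (rule continuous_on_U_fst, erule deriv_r deriv_u deriv_p deriv_a deriv_\<kappa> deriv_\<kappa>' deriv_\<tau>)+

lemma continuous_on_U:
  "continuous_on U (\<lambda>z. p (fst z) * P (fst z) (snd z))"
  "continuous_on U (\<lambda>z. L (fst z) (snd z) + r (fst z) * (D (fst z) (snd z))\<^sup>2)"
  "continuous_on U (\<lambda>z. W (fst z) (snd z))"
  unfolding L_D_W[symmetric] L_def P_def D_def A_def A_t_def
  by (rule continuous_on_add continuous_on_mult continuous_on_diff continuous_on_minus continuous_on_power
      continuous_on_sin continuous_on_cos continuous_on_snd continuous_on_id continuous_on_const
      continuous_on_coefficients)+

lemma open_U_Collect:
  assumes "continuous_on U f" "open G" "G \<subseteq> U"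
  shows "open {z \<in> G. f z < (0::real)}" "open {z \<in> G. f z > 0}" "open {z \<in> G. f z \<noteq> 0}"
proof -
  have c: "continuous_on G f" using assms continuous_on_subset by blast
  have "open (G \<inter> f -` {..<0})" "open (G \<inter> f -` {0<..})" "open (G \<inter> f -` (- {0}))"
    by (intro continuous_open_preimage c assms open_lessThan open_greaterThan open_Compl closed_singleton)+
  moreover have "G \<inter> f -` {..<0} = {z \<in> G. f z < 0}" "G \<inter> f -` {0<..} = {z \<in> G. f z > 0}"
    "G \<inter> f -` (- {0}) = {z \<in> G. f z \<noteq> 0}" by auto
  ultimately show "open {z \<in> G. f z < 0}" "open {z \<in> G. f z > 0}" "open {z \<in> G. f z \<noteq> 0}" by simp_all
qed

text \<open>Otherwise \<open>u\<^sup>2 = 1/2\<close> on an interval, so that \<open>a = 0\<close>, and then \<open>w1 = p\<close> is not zero.\<close>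
lemma W_not_identically_zero:
  assumes "open G" "G \<subseteq> U" "G \<noteq> {}"
  shows "\<exists>(s, t)\<in>G. W s t \<noteq> 0"
proof (rule ccontr)
  assume "\<not> ?thesis"
  then have W: "W s t = 0" if "(s, t) \<in> G" for s t using that by auto
  obtain s1 s2 t1 t2 where R: "s1 < s2" "t1 < t2" "{s1<..<s2} \<times> {t1<..<t2} \<subseteq> G"
    using open_contains_rectangle assms by metis
  have I: "s \<in> I" if "s \<in> {s1<..<s2}" for s
  proof -
    have "(s, (t1 + t2) / 2) \<in> {s1<..<s2} \<times> {t1<..<t2}" using that R(2) by auto
    then show ?thesis using R(3) assms(2) U_I by blast
  qed
  have eq: "2 * (u s)\<^sup>2 = 1" "w1 s = 0" if "s \<in> {s1<..<s2}" for s
  proof -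
    have "W s t = 0" if "t1 < t" "t < t2" for t
    proof -
      have "(s, t) \<in> {s1<..<s2} \<times> {t1<..<t2}" using that \<open>s \<in> _\<close> by simp
      then show ?thesis using W R(3) by blast
    qed
    then show "2 * (u s)\<^sup>2 = 1" "w1 s = 0" using W_zero_imp[OF I[OF that] R(2)] by auto
  qed
  define s where "s = (s1 + s2) / 2"
  have s: "s \<in> {s1<..<s2}" using R by (auto simp: s_def)
  have "((\<lambda>x. 2 * (u x)\<^sup>2) has_real_derivative 4 * u s * p s * a s) (at s)"
    using I[OF s] by (auto intro!: derivative_eq_intros)
  moreover have "((\<lambda>x. 2 * (u x)\<^sup>2) has_real_derivative 0) (at s)"
    by (rule has_field_derivative_transform_within_open[OF DERIV_const[of 1], where S = "{s1<..<s2}"])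
      (use s eq in auto)
  ultimately have "4 * u s * p s * a s = 0" using DERIV_unique by blast
  then have "a s = 0" using p_nonzero[OF I[OF s]] eq(1)[OF s] by auto
  then show False using eq(2)[OF s] p_nonzero[OF I[OF s]] by (simp add: w1_def)
qed

text \<open>The sign of \<open>e g\<close>, which decides between the two formulas for \<open>K\<^sub>I\<^sub>I\<close>, is constant on some
  rectangle: either it is negative somewhere, hence nearby, or nowhere.\<close>
lemma curvature_rectangle:
  assumes G: "open G" "G \<subseteq> U" "G \<noteq> {}"
  obtains s1 s2 t1 t2 c where "s1 < s2" "t1 < t2" "{s1<..<s2} \<times> {t1<..<t2} \<subseteq> G"
    "\<And>s t. (s, t) \<in> {s1<..<s2} \<times> {t1<..<t2} \<Longrightarrow> \<epsilon> s t = c"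
    "(\<forall>s t. (s, t) \<in> {s1<..<s2} \<times> {t1<..<t2} \<longrightarrow>
        second_gaussian_curvature C s t = - c * (Y s t / (4 * (r s)\<^sup>2 * (L s t)\<^sup>2))) \<or>
     (\<forall>s t. (s, t) \<in> {s1<..<s2} \<times> {t1<..<t2} \<longrightarrow> W s t \<noteq> 0 \<and>
        second_gaussian_curvature C s t = - c * (Y s t / (4 * (r s)\<^sup>2 * (W s t)\<^sup>2)))"
proof -
  define V1 where "V1 = {z \<in> G. p (fst z) * P (fst z) (snd z) > 0}"
  define V2 where "V2 = {z \<in> G. p (fst z) * P (fst z) (snd z) < 0}"
  obtain z where z: "z \<in> G" using G by auto
  have "p (fst z) * P (fst z) (snd z) \<noteq> 0"
    using P_nonzero[of "fst z" "snd z"] p_nonzero[OF U_I, of "fst z" "snd z"] z G by auto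
  then have "p (fst z) * P (fst z) (snd z) > 0 \<or> p (fst z) * P (fst z) (snd z) < 0" by linarith
  then have "V1 \<noteq> {} \<or> V2 \<noteq> {}" using z unfolding V1_def V2_def by blast
  moreover have "open V1" "open V2" unfolding V1_def V2_def
    by (intro open_U_Collect continuous_on_U G)+
  moreover have "\<epsilon> s t = 1" if "(s, t) \<in> V1" for s t using that by (auto simp: V1_def \<epsilon>_def)
  moreover have "\<epsilon> s t = - 1" if "(s, t) \<in> V2" for s t using that by (auto simp: V2_def \<epsilon>_def)
  moreover have "V1 \<subseteq> G" "V2 \<subseteq> G" unfolding V1_def V2_def by auto
  ultimately obtain V3 c where V3: "open V3" "V3 \<noteq> {}" "V3 \<subseteq> G" and c: "\<And>s t. (s, t) \<in> V3 \<Longrightarrow> \<epsilon> s t = c"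
    by metis
  have "V3 \<subseteq> U" using V3 G by auto
  define N where "N = {z \<in> V3. L (fst z) (snd z) + r (fst z) * (D (fst z) (snd z))\<^sup>2 < 0}"
  show ?thesis
  proof (cases "N = {}")
    case True
    obtain s1 s2 t1 t2 where R: "s1 < s2" "t1 < t2" "{s1<..<s2} \<times> {t1<..<t2} \<subseteq> V3"
      using open_contains_rectangle[OF V3(1,2)] by metis
    have "L s t + r s * (D s t)\<^sup>2 \<ge> 0" if "(s, t) \<in> V3" for s t
      using True that by (fastforce simp: N_def not_less)
    then have K: "second_gaussian_curvature C s t = - c * (Y s t / (4 * (r s)\<^sup>2 * (L s t)\<^sup>2))"
      if "(s, t) \<in> V3" for s t
      using second_gaussian_curvature_eq(1)[OF V3(1) \<open>V3 \<subseteq> U\<close> that c] that by blast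
    note RV = subsetD[OF R(3)]
    show ?thesis
    proof (rule that[OF R(1,2), of c])
      show "{s1<..<s2} \<times> {t1<..<t2} \<subseteq> G" using R(3) V3(3) by (rule subset_trans)
      show "\<epsilon> s t = c" if "(s, t) \<in> {s1<..<s2} \<times> {t1<..<t2}" for s t using c RV[OF that] .
    qed (use K RV in blast)
  next
    case False
    have "open N" unfolding N_def by (intro open_U_Collect continuous_on_U V3 \<open>V3 \<subseteq> U\<close>)
    have "N \<subseteq> V3" by (auto simp: N_def)
    then have "N \<subseteq> U" using \<open>V3 \<subseteq> U\<close> by auto
    define M where "M = {z \<in> N. W (fst z) (snd z) \<noteq> 0}"
    have "open M" unfolding M_def by (intro open_U_Collect continuous_on_U \<open>open N\<close> \<open>N \<subseteq> U\<close>)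
    moreover have "M \<noteq> {}" using W_not_identically_zero[OF \<open>open N\<close> \<open>N \<subseteq> U\<close> False] by (auto simp: M_def)
    ultimately obtain s1 s2 t1 t2 where R: "s1 < s2" "t1 < t2" "{s1<..<s2} \<times> {t1<..<t2} \<subseteq> M"
      using open_contains_rectangle by metis
    have "L s t + r s * (D s t)\<^sup>2 < 0" if "(s, t) \<in> M" for s t
      using that by (auto simp: N_def M_def)
    then have K: "second_gaussian_curvature C s t = - c * (Y s t / (4 * (r s)\<^sup>2 * (W s t)\<^sup>2))"
      if "(s, t) \<in> M" for s t
      using second_gaussian_curvature_eq(2)[OF V3(1) \<open>V3 \<subseteq> U\<close> _ c] that \<open>N \<subseteq> V3\<close> unfolding M_def by blast
    have MN: "M \<subseteq> V3" using \<open>N \<subseteq> V3\<close> by (auto simp: M_def)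
    have "W s t \<noteq> 0" if "(s, t) \<in> M" for s t using that by (auto simp: M_def)
    note W = this and RM = subsetD[OF R(3)]
    show ?thesis
    proof (rule that[OF R(1,2), of c])
      show "{s1<..<s2} \<times> {t1<..<t2} \<subseteq> G" using R(3) MN V3(3) by (meson subset_trans)
      show "\<epsilon> s t = c" if "(s, t) \<in> {s1<..<s2} \<times> {t1<..<t2}" for s t
        using c subsetD[OF MN RM[OF that]] .
    qed (use K W RM in blast)
  qed
qed

lemma curvature_minus_H:
  assumes "(s, t) \<in> U"
  shows "Y s t / (4 * (r s)\<^sup>2 * (L s t)\<^sup>2) = Z s t / (4 * (r s)\<^sup>2 * (L s t)\<^sup>2) + 1 * H s t"
proof -
  have nz: "P s t \<noteq> 0" "A s t \<noteq> 0" "r s \<noteq> 0"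
    using P_nonzero[OF assms] L_nonzero[OF assms] r_pos[OF U_I[OF assms]] by (auto simp: L_def)
  have "H s t = 2 * r s * (A s t)\<^sup>2 * P s t * (2 * P s t - p s) / (4 * (r s)\<^sup>2 * (L s t)\<^sup>2)"
    unfolding H_def L_def using nz by (simp add: field_simps power2_eq_square)
  moreover have "Y s t = Z s t + 2 * r s * (A s t)\<^sup>2 * P s t * (2 * P s t - p s)"
    unfolding Y_def Z_def P_def by (simp add: algebra_simps eval_nat_numeral)
  ultimately show ?thesis by (simp add: add_divide_distrib)
qed

lemma jacobi_rectangle:
  assumes G: "open G" "G \<subseteq> U" "G \<noteq> {}"
  obtains s1 s2 t1 t2 where "s1 < s2" "t1 < t2" "{s1<..<s2} \<times> {t1<..<t2} \<subseteq> G"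
    "(\<forall>s\<in>{s1<..<s2}. \<forall>t\<in>{t1<..<t2}. jacobi Z Z_s Z_t L L_s L_t s t = 0) \<or>
     (\<forall>s\<in>{s1<..<s2}. \<forall>t\<in>{t1<..<t2}. jacobi Y Y_s Y_t W W_s W_t s t = 0)"
proof -
  obtain s1 s2 t1 t2 c where R: "s1 < s2" "t1 < t2" "{s1<..<s2} \<times> {t1<..<t2} \<subseteq> G"
    and c: "\<And>s t. (s, t) \<in> {s1<..<s2} \<times> {t1<..<t2} \<Longrightarrow> \<epsilon> s t = c"
    and cases: "(\<forall>s t. (s, t) \<in> {s1<..<s2} \<times> {t1<..<t2} \<longrightarrow>
        second_gaussian_curvature C s t = - c * (Y s t / (4 * (r s)\<^sup>2 * (L s t)\<^sup>2))) \<or>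
     (\<forall>s t. (s, t) \<in> {s1<..<s2} \<times> {t1<..<t2} \<longrightarrow> W s t \<noteq> 0 \<and>
        second_gaussian_curvature C s t = - c * (Y s t / (4 * (r s)\<^sup>2 * (W s t)\<^sup>2)))"
    using curvature_rectangle[OF G] by blast
  define Q where "Q = {s1<..<s2} \<times> {t1<..<t2}"
  have Q: "open Q" "Q \<subseteq> U" unfolding Q_def using R G by (auto intro: open_Times)
  note c = c[folded Q_def] and cases = cases[folded Q_def]
  from cases have "(\<forall>s\<in>{s1<..<s2}. \<forall>t\<in>{t1<..<t2}. jacobi Z Z_s Z_t L L_s L_t s t = 0) \<or>
     (\<forall>s\<in>{s1<..<s2}. \<forall>t\<in>{t1<..<t2}. jacobi Y Y_s Y_t W W_s W_t s t = 0)"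
  proof
    assume K: "\<forall>s t. (s, t) \<in> Q \<longrightarrow>
        second_gaussian_curvature C s t = - c * (Y s t / (4 * (r s)\<^sup>2 * (L s t)\<^sup>2))"
    have "jacobi Z Z_s Z_t L L_s L_t s t = 0" if "(s, t) \<in> Q" for s t
    proof (rule Weingarten_imp_jacobi[OF Q that c deriv_Z_s deriv_Z_t deriv_L_s deriv_L_t])
      show "L x y \<noteq> 0" if "(x, y) \<in> Q" for x y using L_nonzero that Q by blast
      show "second_gaussian_curvature C x y = - c * (Z x y / (4 * (r x)\<^sup>2 * (L x y)\<^sup>2) + 1 * H x y)"
        if "(x, y) \<in> Q" for x y
      proof -
        have "(x, y) \<in> U" using that Q by blast
        then show ?thesis unfolding curvature_minus_H[OF \<open>(x, y) \<in> U\<close>, symmetric] using K that by blast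
      qed
    qed
    then show ?thesis by (auto simp: Q_def)
  next
    assume K: "\<forall>s t. (s, t) \<in> Q \<longrightarrow> W s t \<noteq> 0 \<and>
        second_gaussian_curvature C s t = - c * (Y s t / (4 * (r s)\<^sup>2 * (W s t)\<^sup>2))"
    have "jacobi Y Y_s Y_t W W_s W_t s t = 0" if "(s, t) \<in> Q" for s t
      by (rule Weingarten_imp_jacobi[OF Q that c deriv_Y_s deriv_Y_t deriv_W_s deriv_W_t, where d = 0])
        (use K in auto)
    then show ?thesis by (auto simp: Q_def)
  qed
  then show ?thesis using that R by blast
qed

text \<open>If \<open>u\<close> did not vanish at some point, it would not vanish on some rectangle of
  \<open>jacobi_rectangle\<close>, and both kinds of rectangles are excluded.\<close>
lemma u_zero:
  assumes "(s0, t0) \<in> U"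
  shows "u s0 = 0"
proof (rule ccontr)
  assume "u s0 \<noteq> 0"
  define G where "G = {z \<in> U. u (fst z) \<noteq> 0}"
  have G: "open G" "G \<subseteq> U" "G \<noteq> {}"
    unfolding G_def using assms \<open>u s0 \<noteq> 0\<close>
    by (auto intro!: open_U_Collect open_U continuous_on_coefficients)
  obtain s1 s2 t1 t2 where R: "s1 < s2" "t1 < t2" "{s1<..<s2} \<times> {t1<..<t2} \<subseteq> G"
    and cases: "(\<forall>s\<in>{s1<..<s2}. \<forall>t\<in>{t1<..<t2}. jacobi Z Z_s Z_t L L_s L_t s t = 0) \<or>
     (\<forall>s\<in>{s1<..<s2}. \<forall>t\<in>{t1<..<t2}. jacobi Y Y_s Y_t W W_s W_t s t = 0)"
    using jacobi_rectangle[OF G] by blast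
  define s t where "s = (s1 + s2) / 2" and "t = (t1 + t2) / 2"
  have st: "s \<in> {s1<..<s2}" "t \<in> {t1<..<t2}" using R by (auto simp: s_def t_def)
  have u: "u x \<noteq> 0" and I: "x \<in> I" if "x \<in> {s1<..<s2}" for x
  proof -
    have "(x, t) \<in> G" using that st(2) R(3) by blast
    then show "u x \<noteq> 0" "x \<in> I" using U_I unfolding G_def by auto
  qed
  from cases show False
  proof
    assume "\<forall>s\<in>{s1<..<s2}. \<forall>t\<in>{t1<..<t2}. jacobi Z Z_s Z_t L L_s L_t s t = 0"
    then show False using jacobi_Z_imp_u_zero[OF I[OF st(1)] R(2)] u[OF st(1)] st by auto
  next
    assume "\<forall>s\<in>{s1<..<s2}. \<forall>t\<in>{t1<..<t2}. jacobi Y Y_s Y_t W W_s W_t s t = 0"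
    then show False
      by (intro jacobi_W_imp_False[OF open_greaterThanLessThan subsetI connected_Ioo st(1) u R(2)] I) auto
  qed
qed

text \<open>The same argument for tubes: where \<open>u\<close> vanishes identically, so do \<open>a\<close> and its derivative.\<close>
lemma \<kappa>'_zero:
  assumes "(s0, t0) \<in> U"
  shows "\<kappa>' s0 = 0"
proof (rule ccontr)
  assume "\<kappa>' s0 \<noteq> 0"
  define G where "G = {z \<in> U. \<kappa>' (fst z) \<noteq> 0}"
  have G: "open G" "G \<subseteq> U" "G \<noteq> {}"
    unfolding G_def using assms \<open>\<kappa>' s0 \<noteq> 0\<close>
    by (auto intro!: open_U_Collect open_U continuous_on_coefficients)
  obtain s1 s2 t1 t2 where R: "s1 < s2" "t1 < t2" "{s1<..<s2} \<times> {t1<..<t2} \<subseteq> G"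
    and cases: "(\<forall>s\<in>{s1<..<s2}. \<forall>t\<in>{t1<..<t2}. jacobi Z Z_s Z_t L L_s L_t s t = 0) \<or>
     (\<forall>s\<in>{s1<..<s2}. \<forall>t\<in>{t1<..<t2}. jacobi Y Y_s Y_t W W_s W_t s t = 0)"
    using jacobi_rectangle[OF G] by blast
  define s t where "s = (s1 + s2) / 2" and "t = (t1 + t2) / 2"
  have st: "s \<in> {s1<..<s2}" "t \<in> {t1<..<t2}" using R by (auto simp: s_def t_def)
  have VU: "(x, y) \<in> U" if "x \<in> {s1<..<s2}" "y \<in> {t1<..<t2}" for x y using that R(3) G(2) by blast
  have I: "x \<in> I" if "x \<in> {s1<..<s2}" for x using U_I VU[OF that st(2)] by blast
  have "(s, t) \<in> G" using st R(3) by blast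
  then have \<kappa>': "\<kappa>' s \<noteq> 0" by (auto simp: G_def)
  have u: "u x = 0" if "x \<in> {s1<..<s2}" for x using u_zero VU[OF that st(2)] by blast
  have a: "a x = 0" if "x \<in> {s1<..<s2}" for x
  proof -
    have "(u has_real_derivative 0) (at x)"
      by (rule has_field_derivative_transform_within_open[OF DERIV_const[of 0], where S = "{s1<..<s2}"])
        (use that u in auto)
    then have "p x * a x = 0" using deriv_u[OF I[OF that]] DERIV_unique by blast
    then show ?thesis using p_nonzero[OF I[OF that]] by simp
  qed
  have a': "a' s = 0"
  proof -
    have "(a has_real_derivative 0) (at s)"
      by (rule has_field_derivative_transform_within_open[OF DERIV_const[of 0], where S = "{s1<..<s2}"])
        (use st a in auto)
    then show ?thesis using deriv_a[OF I[OF st(1)]] DERIV_unique by blast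
  qed
  from cases have "\<kappa>' s = 0"
  proof
    assume "\<forall>s\<in>{s1<..<s2}. \<forall>t\<in>{t1<..<t2}. jacobi Z Z_s Z_t L L_s L_t s t = 0"
    then show ?thesis
      using jacobi_Z_tube_imp[OF I[OF st(1)] R(2) u[OF st(1)] a[OF st(1)] a'] L_nonzero VU[OF st(1)] st by auto
  next
    assume "\<forall>s\<in>{s1<..<s2}. \<forall>t\<in>{t1<..<t2}. jacobi Y Y_s Y_t W W_s W_t s t = 0"
    then show ?thesis
      using jacobi_W_tube_imp[OF I[OF st(1)] R(2) u[OF st(1)] a[OF st(1)] a'] st by auto
  qed
  then show False using \<kappa>' by simp
qed

end

section \<open>The Frenet frame and the classification\<close>

lemma smooth_on_tower:
  fixes f :: "real \<Rightarrow> 'a::real_normed_vector"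
  assumes "smooth_on I f" "open I"
  obtains D where "\<And>s. s \<in> I \<Longrightarrow> (f has_vector_derivative D 1 s) (at s)"
    "\<And>n s. s \<in> I \<Longrightarrow> (D n has_vector_derivative D (Suc n) s) (at s)" "\<And>s. s \<in> I \<Longrightarrow> D 0 s = f s"
proof -
  obtain D where D: "\<forall>x\<in>I. D 0 x = f x"
    "\<forall>n::nat. \<forall>x\<in>I. (D n has_vector_derivative D (Suc n) x) (at x)"
    using assms(1) unfolding smooth_on_def by blast
  show ?thesis
  proof (rule that[of D])
    fix s assume s: "s \<in> I"
    have "(D 0 has_vector_derivative D (Suc 0) s) (at s)" using D s by blast
    then show "(f has_vector_derivative D 1 s) (at s)"
      using has_vector_derivative_transform_within_open[OF _ assms(2) s] D(1) by (metis One_nat_def)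
  qed (use D in auto)
qed

lemma has_vector_derivative_cross3:
  assumes "(f has_vector_derivative f') (at s)" "(g has_vector_derivative g') (at s)"
  shows "((\<lambda>x. cross3 (f x) (g x)) has_vector_derivative cross3 (f s) g' + cross3 f' (g s)) (at s)"
proof -
  have "bounded_bilinear cross3" using bilinear_cross bilinear_conv_bounded_bilinear by blast
  from bounded_bilinear.has_vector_derivative[OF this assms] show ?thesis .
qed

lemma has_real_derivative_inner:
  fixes f g :: "real \<Rightarrow> real^3"
  assumes "(f has_vector_derivative f') (at s)" "(g has_vector_derivative g') (at s)"
  shows "((\<lambda>x. f x \<bullet> g x) has_real_derivative f s \<bullet> g' + f' \<bullet> g s) (at s)"
  using bounded_bilinear.has_vector_derivative[OF bounded_bilinear_inner assms]
  by (simp add: has_real_derivative_iff_has_vector_derivative)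

lemma DERIV_unique_on_open:
  fixes f g :: "real \<Rightarrow> real"
  assumes "open S" "s \<in> S" "(f has_real_derivative d) (at s)" "(g has_real_derivative d') (at s)"
    and "\<And>x. x \<in> S \<Longrightarrow> f x = g x"
  shows "d = d'"
  using has_field_derivative_transform_within_open[OF assms(3,1,2,5)] assms(4) DERIV_unique by blast

text \<open>The torsion is the triple product of the first three derivatives over \<open>\<kappa>\<^sup>2\<close>, which shows that
  it is differentiable. The frame equations are read off in the orthonormal basis \<open>T\<close>, \<open>N\<close>, \<open>B\<close>.\<close>
lemma frenet_equations:
  fixes T V V' V'' :: "real \<Rightarrow> real^3"
  assumes I: "open I"
    and T: "\<And>s. s \<in> I \<Longrightarrow> (T has_vector_derivative V s) (at s)"
    and V: "\<And>s. s \<in> I \<Longrightarrow> (V has_vector_derivative V' s) (at s)"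
    and V': "\<And>s. s \<in> I \<Longrightarrow> (V' has_vector_derivative V'' s) (at s)"
    and unit: "\<And>s. s \<in> I \<Longrightarrow> T s \<bullet> T s = 1"
    and nz: "\<And>s. s \<in> I \<Longrightarrow> V s \<noteq> 0"
  defines "\<kappa> \<equiv> \<lambda>s. norm (V s)"
  defines "N \<equiv> \<lambda>s. V s /\<^sub>R \<kappa> s" 
  defines "B \<equiv> \<lambda>s. cross3 (T s) (N s)"
  obtains \<kappa>' \<kappa>'' \<tau> \<tau>' where
    "\<And>s. s \<in> I \<Longrightarrow> (\<kappa> has_real_derivative \<kappa>' s) (at s)"
    "\<And>s. s \<in> I \<Longrightarrow> (\<kappa>' has_real_derivative \<kappa>'' s) (at s)"
    "\<And>s. s \<in> I \<Longrightarrow> (\<tau> has_real_derivative \<tau>' s) (at s)"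
    "\<And>s. s \<in> I \<Longrightarrow> (N has_vector_derivative - \<kappa> s *\<^sub>R T s + \<tau> s *\<^sub>R B s) (at s)"
    "\<And>s. s \<in> I \<Longrightarrow> (B has_vector_derivative - \<tau> s *\<^sub>R N s) (at s)"
    "\<And>s. s \<in> I \<Longrightarrow> N s \<bullet> N s = 1" "\<And>s. s \<in> I \<Longrightarrow> T s \<bullet> N s = 0"
proof -
  have \<kappa>: "\<kappa> s > 0" and \<kappa>2: "V s \<bullet> V s = \<kappa> s * \<kappa> s" if "s \<in> I" for s
    using nz[OF that] by (simp_all add: \<kappa>_def flip: power2_norm_eq_inner power2_eq_square)
  define \<kappa>' where "\<kappa>' = (\<lambda>s. (V s \<bullet> V' s) / \<kappa> s)"
  define \<kappa>'' where "\<kappa>'' = (\<lambda>s. (V s \<bullet> V'' s + V' s \<bullet> V' s) / \<kappa> s - (V s \<bullet> V' s) * \<kappa>' s / (\<kappa> s)\<^sup>2)"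
  have d\<kappa>: "(\<kappa> has_real_derivative \<kappa>' s) (at s)" if "s \<in> I" for s
  proof -
    have eq: "\<kappa> = (\<lambda>s. sqrt (V s \<bullet> V s))" by (simp add: \<kappa>_def norm_eq_sqrt_inner)
    have "V s \<bullet> V s > 0" using \<kappa>[OF that] \<kappa>2[OF that] by simp
    from DERIV_chain2[where f = sqrt and g = "\<lambda>s. V s \<bullet> V s", OF DERIV_real_sqrt[OF this]
        has_real_derivative_inner[OF V[OF that] V[OF that]]]
    show ?thesis unfolding eq \<kappa>'_def by (simp add: inner_commute field_simps)
  qed
  have d\<kappa>': "(\<kappa>' has_real_derivative \<kappa>'' s) (at s)" if "s \<in> I" for s
    unfolding \<kappa>'_def \<kappa>''_def
    using \<kappa>[OF that]
    by (auto intro!: derivative_eq_intros d\<kappa>[OF that, unfolded \<kappa>'_def] has_real_derivative_inner V V' that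
       simp: field_simps power2_eq_square)
  define \<tau> where "\<tau> = (\<lambda>s. (cross3 (T s) (V s) \<bullet> V' s) / (\<kappa> s)\<^sup>2)"
  obtain \<tau>' where d\<tau>: "(\<tau> has_real_derivative \<tau>' s) (at s)" if "s \<in> I" for s
  proof -
    have "\<exists>d. (\<tau> has_real_derivative d) (at s)" if "s \<in> I" for s
    proof -
      note triple = has_real_derivative_inner[OF has_vector_derivative_cross3[OF T V] V', OF that that that]
      have "(\<kappa> s)\<^sup>2 \<noteq> 0" using \<kappa>[OF that] by simp
      from DERIV_divide[OF triple DERIV_power[OF d\<kappa>[OF that], of 2] this]
      show ?thesis unfolding \<tau>_def by blast
    qed
    then show ?thesis using that by metis
  qed
  have TV: "T s \<bullet> V s = 0" if "s \<in> I" for s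
  proof -
    have "T s \<bullet> V s + V s \<bullet> T s = 0"
      by (rule DERIV_unique_on_open[OF I that has_real_derivative_inner[OF T[OF that] T[OF that]] DERIV_const[of 1]])
        (use unit in auto)
    then show ?thesis by (simp add: inner_commute)
  qed
  have TV': "V' s \<bullet> T s = - (\<kappa> s * \<kappa> s)" if "s \<in> I" for s
  proof -
    have "T s \<bullet> V' s + V s \<bullet> V s = 0"
      by (rule DERIV_unique_on_open[OF I that has_real_derivative_inner[OF T[OF that] V[OF that]] DERIV_const[of 0]])
        (use TV in auto)
    then show ?thesis using \<kappa>2[OF that] by (simp add: inner_commute)
  qed
  have NN: "N s \<bullet> N s = 1" and TN: "T s \<bullet> N s = 0" if "s \<in> I" for s
    using \<kappa>[OF that] \<kappa>2[OF that] TV[OF that] by (auto simp: N_def field_simps)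
  have "B s = cross3 (T s) (N s)" for s by (simp add: B_def)
  note basis = cross3_orthonormal_basis[OF unit NN TN this]
  have dN: "(N has_vector_derivative - \<kappa> s *\<^sub>R T s + \<tau> s *\<^sub>R B s) (at s)" if "s \<in> I" for s
  proof -
    have "((\<lambda>s. inverse (\<kappa> s)) has_real_derivative - \<kappa>' s / (\<kappa> s)\<^sup>2) (at s)"
      using \<kappa>[OF that] by (auto intro!: derivative_eq_intros d\<kappa>[OF that] simp: power2_eq_square divide_inverse)
    from has_vector_derivative_scaleR[OF this V[OF that]]
    have "(N has_vector_derivative inverse (\<kappa> s) *\<^sub>R V' s + (- \<kappa>' s / (\<kappa> s)\<^sup>2) *\<^sub>R V s) (at s)"
      unfolding N_def .
    moreover have "inverse (\<kappa> s) *\<^sub>R V' s + (- \<kappa>' s / (\<kappa> s)\<^sup>2) *\<^sub>R V s = - \<kappa> s *\<^sub>R T s + \<tau> s *\<^sub>R B s" (is "?x = _")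
    proof -
      have "?x \<bullet> T s = - \<kappa> s" using TV[OF that] TV'[OF that] \<kappa>[OF that]
        by (simp add: inner_simps inner_commute)
      moreover have "?x \<bullet> N s = 0" using \<kappa>[OF that] \<kappa>2[OF that]
        by (simp add: inner_simps N_def \<kappa>'_def inner_commute power2_eq_square field_simps)
      moreover have "?x \<bullet> B s = \<tau> s"
      proof -
        have "V s = \<kappa> s *\<^sub>R N s" using \<kappa>[OF that] by (simp add: N_def)
        then have "V s \<bullet> B s = 0" using basis(3)[OF that that that] by simp
        moreover have "cross3 (T s) (V s) = \<kappa> s *\<^sub>R B s"
          unfolding \<open>V s = _\<close> B_def by (simp add: cross_mult_right)
        ultimately show ?thesis using \<kappa>[OF that]
          by (simp add: inner_simps \<tau>_def inner_commute power2_eq_square field_simps)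
      qed
      ultimately show ?thesis using basis(6)[OF that that that, of ?x] by simp
    qed
    ultimately show ?thesis by simp
  qed
  have dB: "(B has_vector_derivative - \<tau> s *\<^sub>R N s) (at s)" if "s \<in> I" for s
  proof -
    have "V s = \<kappa> s *\<^sub>R N s" using \<kappa>[OF that] by (simp add: N_def)
    moreover have "cross3 (T s) (B s) = - N s" using basis(5)[OF that that that] cross_skew by metis
    ultimately have "cross3 (T s) (- \<kappa> s *\<^sub>R T s + \<tau> s *\<^sub>R B s) + cross3 (V s) (N s) = - \<tau> s *\<^sub>R N s"
      by (simp add: Cross3.right_diff_distrib cross_mult_right cross_mult_left)
    then show ?thesis using has_vector_derivative_cross3[OF T[OF that] dN[OF that]] unfolding B_def by simp
  qed
  show ?thesis by (rule that[OF d\<kappa> d\<kappa>' d\<tau> dN dB NN TN])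
qed

theorem theorem2p2:
  fixes I :: "real set" and U :: "(real \<times> real) set"
    and \<alpha> N B :: "real \<Rightarrow> real^3" and r :: "real \<Rightarrow> real" and \<sigma> :: real
    and C :: "real \<Rightarrow> real \<Rightarrow> real^3"
  assumes interval: "open I" "is_interval I"
    and center: "smooth_on I \<alpha>" "\<And>s. s \<in> I \<Longrightarrow> norm (tangent \<alpha> s) = 1"
    and frame: "frenet_frame I \<alpha> N B"
    and radius: "smooth_on I r" "\<And>s. s \<in> I \<Longrightarrow> r s > 0" "\<And>s. s \<in> I \<Longrightarrow> (deriv r s)\<^sup>2 \<le> 1"
    and sign: "\<sigma> = 1 \<or> \<sigma> = -1"
    and C_def: "C = canal_surface \<alpha> N B r \<sigma>"
    and domain: "open U" "fst ` U = I"
    and regular: "regular_on U C"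
    and nondegenerate: "II_nondegenerate_on U C"
    and Weingarten: "Weingarten_on U (mean_curvature C) (second_gaussian_curvature C)"
  shows "surface_of_revolution I \<alpha> \<or>
    (\<exists>c1 c2 c3. c1 \<noteq> 1 \<and> c1 \<noteq> -1 \<and>
       (\<forall>s\<in>I. r s = c1 * s + c2 \<and> curvature \<alpha> s = c3 / r s powr (1/3))) \<or>
    (tubular_surface I r \<and> (\<exists>c. c \<noteq> 0 \<and> (\<forall>s\<in>I. curvature \<alpha> s = c)))"
proof (cases "surface_of_revolution I \<alpha>")
  case False
  then obtain s0 where s0: "s0 \<in> I" "curvature \<alpha> s0 \<noteq> 0" unfolding surface_of_revolution_def by blast
  then have "\<forall>s\<in>I. curvature \<alpha> s \<noteq> 0 \<and> N s = vector_derivative (tangent \<alpha>) (at s) /\<^sub>R curvature \<alpha> s \<and>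
      B s = cross3 (tangent \<alpha> s) (N s)"
    using frame unfolding frenet_frame_def by auto
  then have fr: "curvature \<alpha> s \<noteq> 0" "N s = vector_derivative (tangent \<alpha>) (at s) /\<^sub>R curvature \<alpha> s"
    "B s = cross3 (tangent \<alpha> s) (N s)" if "s \<in> I" for s
    using that by auto
  obtain D where D1: "\<And>s. s \<in> I \<Longrightarrow> (\<alpha> has_vector_derivative D 1 s) (at s)"
    and D: "\<And>n s. s \<in> I \<Longrightarrow> (D n has_vector_derivative D (Suc n) s) (at s)"
    using smooth_on_tower[OF center(1) interval(1)] by metis
  obtain R where R1: "\<And>s. s \<in> I \<Longrightarrow> (r has_vector_derivative R 1 s) (at s)"
    and R: "\<And>n s. s \<in> I \<Longrightarrow> (R n has_vector_derivative R (Suc n) s) (at s)"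
    using smooth_on_tower[OF radius(1) interval(1)] by metis
  note R1 = R1[folded has_real_derivative_iff_has_vector_derivative]
    and R = R[folded has_real_derivative_iff_has_vector_derivative]
  have tangent: "tangent \<alpha> s = D 1 s" if "s \<in> I" for s
    using D1[OF that] by (simp add: tangent_def vector_derivative_at)
  have accel: "vector_derivative (tangent \<alpha>) (at s) = D 2 s" if "s \<in> I" for s
  proof -
    have "(D 1 has_vector_derivative D 2 s) (at s)" using D[OF that, of 1] by (simp add: numeral_2_eq_2)
    from has_vector_derivative_transform_within_open[OF this interval(1) that] tangent
    show ?thesis by (metis vector_derivative_at)
  qed
  have curv: "curvature \<alpha> s = norm (D 2 s)" if "s \<in> I" for s
    using accel[OF that] by (simp add: curvature_def)
  have N: "N s = D 2 s /\<^sub>R norm (D 2 s)" if "s \<in> I" for s using fr(2)[OF that] accel curv that by simp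
  have B: "B s = cross3 (D 1 s) (D 2 s /\<^sub>R norm (D 2 s))" if "s \<in> I" for s
    using fr(3)[OF that] N tangent that by simp
  have D': "s \<in> I \<Longrightarrow> (D 1 has_vector_derivative D 2 s) (at s)"
    "s \<in> I \<Longrightarrow> (D 2 has_vector_derivative D 3 s) (at s)"
    "s \<in> I \<Longrightarrow> (D 3 has_vector_derivative D 4 s) (at s)" for s
    using D[of s 1] D[of s 2] D[of s 3] by (simp_all add: eval_nat_numeral)
  have unit: "D 1 s \<bullet> D 1 s = 1" if "s \<in> I" for s
    using center(2)[OF that] tangent[OF that] by (simp add: norm_eq_1)
  have nz: "D 2 s \<noteq> 0" if "s \<in> I" for s using fr(1)[OF that] curv[OF that] by auto
  define \<kappa> where "\<kappa> = (\<lambda>s. norm (D 2 s))"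
  obtain \<kappa>' \<kappa>'' \<tau> \<tau>' where
    d\<kappa>: "\<And>s. s \<in> I \<Longrightarrow> (\<kappa> has_real_derivative \<kappa>' s) (at s)"
    "\<And>s. s \<in> I \<Longrightarrow> (\<kappa>' has_real_derivative \<kappa>'' s) (at s)"
    and d\<tau>: "\<And>s. s \<in> I \<Longrightarrow> (\<tau> has_real_derivative \<tau>' s) (at s)"
    and dN: "\<And>s. s \<in> I \<Longrightarrow> ((\<lambda>s. D 2 s /\<^sub>R \<kappa> s) has_vector_derivative
       - \<kappa> s *\<^sub>R D 1 s + \<tau> s *\<^sub>R cross3 (D 1 s) (D 2 s /\<^sub>R \<kappa> s)) (at s)"
    and dB: "\<And>s. s \<in> I \<Longrightarrow> ((\<lambda>s. cross3 (D 1 s) (D 2 s /\<^sub>R \<kappa> s)) has_vector_derivative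
       - \<tau> s *\<^sub>R (D 2 s /\<^sub>R \<kappa> s)) (at s)"
    and NN: "\<And>s. s \<in> I \<Longrightarrow> (D 2 s /\<^sub>R \<kappa> s) \<bullet> (D 2 s /\<^sub>R \<kappa> s) = 1"
    and TN: "\<And>s. s \<in> I \<Longrightarrow> D 1 s \<bullet> (D 2 s /\<^sub>R \<kappa> s) = 0"
    unfolding \<kappa>_def
    by (rule frenet_equations[OF interval(1) D' unit nz]) blast+
  note N = N[folded \<kappa>_def[THEN fun_cong]] and B = B[folded \<kappa>_def[THEN fun_cong]]
  have R': "s \<in> I \<Longrightarrow> (R 1 has_real_derivative R 2 s) (at s)"
    "s \<in> I \<Longrightarrow> (R 2 has_real_derivative R 3 s) (at s)"
    "s \<in> I \<Longrightarrow> (R 3 has_real_derivative R 4 s) (at s)" for s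
    using R[of s 1] R[of s 2] R[of s 3] by (simp_all add: eval_nat_numeral)
  have r': "deriv r s = R 1 s" if "s \<in> I" for s using R1[OF that] by (rule DERIV_imp_deriv)
  define p where "p = (\<lambda>s. \<sigma> * sqrt (1 - (R 1 s)\<^sup>2))"
  have C: "C s t = \<alpha> s - (r s * R 1 s) *\<^sub>R D 1 s - (r s * p s * cos t) *\<^sub>R N s
      + (r s * p s * sin t) *\<^sub>R B s" if "s \<in> I" for s t
    unfolding C_def canal_surface_def Let_def r'[OF that] tangent[OF that] p_def by (simp add: algebra_simps)
  have up: "(R 1 s)\<^sup>2 + (p s)\<^sup>2 = 1" if "s \<in> I" for s
    using radius(3)[OF that] sign unfolding r'[OF that] p_def by (auto simp: power_mult_distrib)
  have p0: "p s \<noteq> 0" if s: "s \<in> I" for s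
  proof
    \<comment> \<open>Where \<open>p = 0\<close> the circle of the sphere shrinks to a point, so the surface is not regular.\<close>
    assume "p s = 0"
    obtain t where t: "(s, t) \<in> U" using s domain(2) by auto
    have "C s x = \<alpha> s - (r s * R 1 s) *\<^sub>R D 1 s" for x using C[OF s, of x] \<open>p s = 0\<close> by simp
    then have "C s = (\<lambda>x. \<alpha> s - (r s * R 1 s) *\<^sub>R D 1 s)" by blast
    then have "pd_t C s t = 0" by (simp add: pd_t_def)
    then have "ffE C s t * ffG C s t - (ffF C s t)\<^sup>2 = 0" by (simp add: ffF_def ffG_def)
    then show False using regular t unfolding regular_on_def by auto
  qed
  have dp: "(p has_real_derivative - R 1 s * (R 2 s / p s)) (at s)" if s: "s \<in> I" for s
  proof -
    have "(p s)\<^sup>2 > 0" using p0[OF s] by simp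
    then have pos: "1 - (R 1 s)\<^sup>2 > 0" using up[OF s] by linarith
    have "(p has_real_derivative \<sigma> * (- 2 * R 1 s * R 2 s * (inverse (sqrt (1 - (R 1 s)\<^sup>2)) / 2))) (at s)"
      unfolding p_def using pos
      by (auto intro!: derivative_eq_intros DERIV_real_sqrt[THEN DERIV_chain2] R'(1)[OF s] simp del: One_nat_def)
    moreover have "\<sigma> * (- 2 * R 1 s * R 2 s * (inverse (sqrt (1 - (R 1 s)\<^sup>2)) / 2)) = - R 1 s * (R 2 s / p s)"
      using sign by (auto simp: p_def field_simps)
    ultimately show ?thesis by simp
  qed
  define a where "a = (\<lambda>s. R 2 s / p s)"
  define a' where "a' = (\<lambda>s. (R 3 s + R 1 s * (a s)\<^sup>2) / p s)"
  have da: "(a has_real_derivative a' s) (at s)" if s: "s \<in> I" for s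
    unfolding a_def a'_def using p0[OF s]
    by (auto intro!: derivative_eq_intros R'[OF s] dp[OF s] simp: field_simps power2_eq_square)
  have "\<exists>d. (a' has_real_derivative d) (at s)" if s: "s \<in> I" for s
    using DERIV_divide[OF DERIV_add[OF R'(3)[OF s] DERIV_mult[OF R'(1)[OF s] DERIV_power[OF da[OF s], of 2]]]
        dp[OF s] p0[OF s]]
    unfolding a'_def by blast
  then obtain a'' where da': "(a' has_real_derivative a'' s) (at s)" if "s \<in> I" for s by metis
  interpret canal_frame I r "R 1" p a a' a'' \<kappa> \<kappa>' \<kappa>'' \<tau> \<tau>' \<alpha> "D 1" N B C U
  proof unfold_locales
    fix s assume s: "s \<in> I"
    show "(R 1 has_real_derivative p s * a s) (at s)" using R'(1)[OF s] p0[OF s] by (simp add: a_def)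
    show "(p has_real_derivative - R 1 s * a s) (at s)" using dp[OF s] by (simp add: a_def)
    show "\<kappa> s \<noteq> 0" using nz[OF s] by (simp add: \<kappa>_def)
    show "(D 1 has_vector_derivative \<kappa> s *\<^sub>R N s) (at s)"
      using D'(1)[OF s] nz[OF s] by (simp add: N[OF s] \<kappa>_def)
    show "(N has_vector_derivative - \<kappa> s *\<^sub>R D 1 s + \<tau> s *\<^sub>R B s) (at s)"
      using has_vector_derivative_transform_within_open[OF dN[OF s] interval(1) s] N B[OF s] by simp
    show "(B has_vector_derivative - \<tau> s *\<^sub>R N s) (at s)"
      using has_vector_derivative_transform_within_open[OF dB[OF s] interval(1) s] B N[OF s] by simp
  next
    fix s t assume "(s, t) \<in> U"
    then show "s \<in> I" using domain(2) by force
  qed (use interval domain R1 da da' d\<kappa> d\<tau> radius p0 up D1 unit NN TN N B C regular nondegenerate Weingarten in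
     \<open>simp_all\<close>)
  have U: "\<exists>t. (s, t) \<in> U" if "s \<in> I" for s using domain(2) that by auto
  have "convex I" using interval(2) by (simp add: is_interval_convex_1)
  have "\<exists>c. \<forall>s\<in>I. r s = c"
    by (rule has_field_derivative_zero_constant[OF \<open>convex I\<close>])
      (use R1 u_zero U in \<open>metis has_field_derivative_at_within\<close>)
  then have "tubular_surface I r" by (simp add: tubular_surface_def)
  moreover have "\<exists>c. \<forall>s\<in>I. \<kappa> s = c"
    by (rule has_field_derivative_zero_constant[OF \<open>convex I\<close>])
      (use d\<kappa>(1) \<kappa>'_zero U in \<open>metis has_field_derivative_at_within\<close>)
  then obtain c where "\<forall>s\<in>I. \<kappa> s = c" by blast
  then have "c \<noteq> 0 \<and> (\<forall>s\<in>I. curvature \<alpha> s = c)" using s0 curv by (auto simp: \<kappa>_def)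
  ultimately show ?thesis by blast
qed simp

end
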